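(* Let $K$ be a unital commutative ring and let $A$ be an associative unital $K$-superalgebra which is free as a $K$-module with a $K$-basis containing the identity. Let $\mathcal{W}=\Pi(A_2)^6$ and let $\mathfrak{st}(3,1,A)^{\sharp}=\mathfrak{st}(3,1,A)\oplus\mathcal{W}$ be the Lie superalgebra with bracket $[(x,w_1),(y,w_2)]=\big([x,y],\psi(x,y)\big)$, where $\psi$ is the super 2-cocycle on $\mathfrak{st}(3,1,A)$ specified in the context. Then the universal central extension of $\mathfrak{sl}(3,1,A)$ is $\mathfrak{st}(3,1,A)^{\sharp}$ (with structure map the composite of the projection $\mathfrak{st}(3,1,A)^{\sharp}\to\mathfrak{st}(3,1,A)$ and the canonical epimorphism $\mathfrak{st}(3,1,A)\to\mathfrak{sl}(3,1,A)$, $F_{ij}(a)\mapsto E_{ij}(a)$). Moreover, $\mathrm{H}_2\big(\mathfrak{st}(3,1,A)\big)=\mathcal{W}$.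
   Context: $K$ is regarded as concentrated in even degree; $A=A_{\bar 0}\oplus A_{\bar 1}$ is $\mathbb{Z}/2$-graded and $|a|$ denotes the degree of a homogeneous element. Lie superalgebras: a Lie superalgebra over $K$ is a $\mathbb{Z}/2$-graded $K$-module $L$ with an even $K$-bilinear bracket such that $[x,y]=-(-1)^{|x||y|}[y,x]$, $[x_{\bar 0},x_{\bar 0}]=0$ for $x_{\bar 0}\in L_{\bar 0}$, and $(-1)^{|x||z|}[[x,y],z]+(-1)^{|x||y|}[[y,z],x]+(-1)^{|y||z|}[[z,x],y]=0$ for homogeneous $x,y,z$. A central extension of $L$ is a surjective (even) Lie superalgebra homomorphism $M\to L$ whose kernel lies in the centre of $M$. It is universal if for every central extension $\tau\colon M'\to L$ there is a unique Lie superalgebra homomorphism $\rho\colon M\to M'$ whose composite with $\tau$ is the given map $M\to L$. For a perfect Lie superalgebra $L$, the second homology $\mathrm{H}_2(L)$ is the kernel of the universal central extension of $L$. Indices $1,2,3$ are even ($|i|=\bar 0$) and $4$ is odd ($|4|=\bar 1$). $\mathfrak{gl}(3,1,A)$ is the associative superalgebra of $4\times 4$ matrices over $A$ with the usual matrix product, graded so that the matrix $E_{ij}(a)$ with $a$ (homogeneous) in position $(i,j)$ and zeros elsewhere has degree $|i|+|j|+|a|$; it is a Lie superalgebra under $[x,y]=xy-(-1)^{|x||y|}yx$, and $\mathfrak{sl}(3,1,A)=[\mathfrak{gl}(3,1,A),\mathfrak{gl}(3,1,A)]$. $\mathfrak{st}(3,1,A)$ is the Lie superalgebra over $K$ generated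 by homogeneous elements $F_{ij}(a)$, $1\le i\ne j\le 4$, $a\in A$ homogeneous, of degree $|F_{ij}(a)|=|i|+|j|+|a|$, subject to: $a\mapsto F_{ij}(a)$ is $K$-linear; $[F_{ij}(a),F_{jk}(b)]=F_{ik}(ab)$ for distinct $i,j,k$; $[F_{ij}(a),F_{kl}(b)]=0$ for $j\ne k$, $i\ne l$. It is perfect. Put $H_{ij}(a,b)=[F_{ij}(a),F_{ji}(b)]$, let $\mathcal{H}$ be the subalgebra generated by all $H_{ij}(a,b)$, and $F_{ij}(A)=\{F_{ij}(a):a\in A\}$. As a $K$-module, $\mathfrak{st}(3,1,A)=\mathcal{H}\oplus\bigoplus_{1\le i\ne j\le 4}F_{ij}(A)$. $A_2=A/\mathcal{I}_2$, where $\mathcal{I}_2$ is the graded ideal of $A$ generated by all $2a$ and all $ab-(-1)^{|a||b|}ba$; $\bar a$ is the class of $a$. $\Pi(A_2)$ is $A_2$ with the parity changed: $\Pi(A_2)_{\bar 0}=(A_2)_{\bar 1}$, $\Pi(A_2)_{\bar 1}=(A_2)_{\bar 0}$. $\mathcal{W}=\Pi(A_2)^6$ is the direct sum of six copies, and $\epsilon_r\colon\Pi(A_2)\to\mathcal{W}$ is the inclusion in position $r$, $1\le r\le 6$. Partition the set $S_4$ of quadruples $(i,j,k,l)$ of distinct elements of $\{1,2,3,4\}$ into the six cosets of $\{(1,2,3,4),(3,2,1,4),(1,4,3,2),(3,4,1,2)\}$, i.e. into the classes $\{(i,j,k,l),(k,j,i,l),(i,l,k,j),(k,l,i,j)\}$,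 labelled $P_1,\dots,P_6$, and put $\theta((i,j,k,l))=r$ if $(i,j,k,l)\in P_r$. The map $\psi\colon\mathfrak{st}(3,1,A)\times\mathfrak{st}(3,1,A)\to\mathcal{W}$ is the $K$-bilinear map with $\psi\big(F_{ij}(a),F_{kl}(b)\big)=\epsilon_{\theta((i,j,k,l))}(\overline{ab})$ for $i,j,k,l$ distinct, $\psi\big(F_{ij}(a),F_{kl}(b)\big)=0$ if $i,j,k,l$ are not all distinct, and $\psi(x,y)=0$ if $x$ or $y$ belongs to $\mathcal{H}$. *)

theory Defs
  imports "HOL-Algebra.QuotRing" "HOL-Algebra.Module" "HOL-Library.Z2"
begin

text \<open>
  Superalgebras over a commutative ring: the field \<open>mult\<close> is the product of an associative
  superalgebra and the bracket of a Lie superalgebra; in the latter case \<open>one\<close> plays no role and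
  is left \<open>undefined\<close>. \<open>gr M p\<close> is the homogeneous component of degree \<open>p\<close>.
\<close>

record ('k, 'a) superalgebra = "('k, 'a) module" +
  gr :: "bit \<Rightarrow> 'a set"

locale graded_module = module K M
  for K :: "('k, 'r) ring_scheme" and M :: "('k, 'a, 'm) superalgebra_scheme" (structure) +
  assumes gr_submodule: "submodule (gr M p) K M"
    and gr_sum: "gr M 0 <+> gr M 1 = carrier M"
    and gr_direct: "gr M 0 \<inter> gr M 1 = {\<zero>}"

locale superalgebra = graded_module +
  assumes mult_closed: "\<lbrakk>x \<in> carrier M; y \<in> carrier M\<rbrakk> \<Longrightarrow> x \<otimes> y \<in> carrier M"
    and mult_add_left:
      "\<lbrakk>x \<in> carrier M; y \<in> carrier M; z \<in> carrier M\<rbrakk> \<Longrightarrow> (x \<oplus> y) \<otimes> z = x \<otimes> z \<oplus> y \<otimes> z"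
    and mult_add_right:
      "\<lbrakk>x \<in> carrier M; y \<in> carrier M; z \<in> carrier M\<rbrakk> \<Longrightarrow> x \<otimes> (y \<oplus> z) = x \<otimes> y \<oplus> x \<otimes> z"
    and mult_smult_left:
      "\<lbrakk>c \<in> carrier K; x \<in> carrier M; y \<in> carrier M\<rbrakk> \<Longrightarrow> (c \<odot> x) \<otimes> y = c \<odot> (x \<otimes> y)"
    and mult_smult_right:
      "\<lbrakk>c \<in> carrier K; x \<in> carrier M; y \<in> carrier M\<rbrakk> \<Longrightarrow> x \<otimes> (c \<odot> y) = c \<odot> (x \<otimes> y)"
    and mult_gr: "\<lbrakk>x \<in> gr M p; y \<in> gr M q\<rbrakk> \<Longrightarrow> x \<otimes> y \<in> gr M (p + q)"

locale assoc_superalgebra = superalgebra K A + ring A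
  for K :: "('k, 'r) ring_scheme" and A :: "('k, 'a, 'm) superalgebra_scheme" (structure)

text \<open>\<open>psign M r x\<close> is $(-1)^r x$.\<close>

definition psign :: "('a, 'm) ring_scheme \<Rightarrow> bit \<Rightarrow> 'a \<Rightarrow> 'a"
  where "psign M r x = (if r = 1 then \<ominus>\<^bsub>M\<^esub> x else x)"

locale lie_superalgebra = superalgebra K L
  for K :: "('k, 'r) ring_scheme" and L :: "('k, 'a, 'm) superalgebra_scheme" (structure) +
  assumes skew: "\<lbrakk>x \<in> gr L p; y \<in> gr L q\<rbrakk> \<Longrightarrow> x \<otimes> y = \<ominus> psign L (p * q) (y \<otimes> x)"
    and even_alt: "x \<in> gr L 0 \<Longrightarrow> x \<otimes> x = \<zero>"
    and jacobi: "\<lbrakk>x \<in> gr L p; y \<in> gr L q; z \<in> gr L r\<rbrakk> \<Longrightarrow>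
      psign L (p * r) ((x \<otimes> y) \<otimes> z) \<oplus> psign L (p * q) ((y \<otimes> z) \<otimes> x)
        \<oplus> psign L (q * r) ((z \<otimes> x) \<otimes> y) = \<zero>"

text \<open>A basis of \<open>M\<close>, not required to be homogeneous.\<close>

definition is_basis :: "('k, 'r) ring_scheme \<Rightarrow> ('k, 'a, 'm) module_scheme \<Rightarrow> 'a set \<Rightarrow> bool"
  where "is_basis K M B \<longleftrightarrow> B \<subseteq> carrier M \<and>
    (\<forall>x\<in>carrier M. \<exists>!c. c \<in> B \<rightarrow>\<^sub>E carrier K \<and> finite {b \<in> B. c b \<noteq> \<zero>\<^bsub>K\<^esub>} \<and>
       x = (\<Oplus>\<^bsub>M\<^esub>b\<in>{b \<in> B. c b \<noteq> \<zero>\<^bsub>K\<^esub>}. c b \<odot>\<^bsub>M\<^esub> b))"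

definition hcomp :: "('k, 'a, 'm) superalgebra_scheme \<Rightarrow> bit \<Rightarrow> 'a \<Rightarrow> 'a"
  where "hcomp M p x = (THE y. y \<in> gr M p \<and> (\<exists>z\<in>gr M (p + 1). x = y \<oplus>\<^bsub>M\<^esub> z))"


section \<open>Homomorphisms, central extensions, second homology\<close>

definition graded_hom ::
  "('k, 'r) ring_scheme \<Rightarrow> ('k, 'a) superalgebra \<Rightarrow> ('k, 'b) superalgebra \<Rightarrow> ('a \<Rightarrow> 'b) set"
  where "graded_hom K L M = {f \<in> carrier L \<rightarrow> carrier M.
    (\<forall>x\<in>carrier L. \<forall>y\<in>carrier L. f (x \<oplus>\<^bsub>L\<^esub> y) = f x \<oplus>\<^bsub>M\<^esub> f y) \<and>
    (\<forall>c\<in>carrier K. \<forall>x\<in>carrier L. f (c \<odot>\<^bsub>L\<^esub> x) = c \<odot>\<^bsub>M\<^esub> f x) \<and>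
    (\<forall>p. f ` gr L p \<subseteq> gr M p)}"

definition lie_hom ::
  "('k, 'r) ring_scheme \<Rightarrow> ('k, 'a) superalgebra \<Rightarrow> ('k, 'b) superalgebra \<Rightarrow> ('a \<Rightarrow> 'b) set"
  where "lie_hom K L M = {f \<in> graded_hom K L M.
    \<forall>x\<in>carrier L. \<forall>y\<in>carrier L. f (x \<otimes>\<^bsub>L\<^esub> y) = f x \<otimes>\<^bsub>M\<^esub> f y}"

definition graded_iso ::
  "('k, 'r) ring_scheme \<Rightarrow> ('k, 'a) superalgebra \<Rightarrow> ('k, 'b) superalgebra \<Rightarrow> bool"
  where "graded_iso K V W \<longleftrightarrow>
    (\<exists>f \<in> graded_hom K V W. bij_betw f (carrier V) (carrier W) \<and> (\<forall>p. f ` gr V p = gr W p))"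

definition restrict_to :: "('k, 'a) superalgebra \<Rightarrow> 'a set \<Rightarrow> ('k, 'a) superalgebra"
  where "restrict_to L N = L\<lparr>carrier := N, gr := \<lambda>p. gr L p \<inter> N\<rparr>"

definition centre :: "('k, 'a) superalgebra \<Rightarrow> 'a set"
  where "centre L = {z \<in> carrier L. \<forall>x\<in>carrier L. z \<otimes>\<^bsub>L\<^esub> x = \<zero>\<^bsub>L\<^esub>}"

definition derived :: "('k, 'r) ring_scheme \<Rightarrow> ('k, 'a) superalgebra \<Rightarrow> ('k, 'a) superalgebra"
  where "derived K L = restrict_to L
    (\<Inter>{N. submodule N K L \<and> (\<forall>x\<in>carrier L. \<forall>y\<in>carrier L. x \<otimes>\<^bsub>L\<^esub> y \<in> N)})"

definition perfect :: "('k, 'r) ring_scheme \<Rightarrow> ('k, 'a) superalgebra \<Rightarrow> bool"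
  where "perfect K L \<longleftrightarrow> carrier (derived K L) = carrier L"

definition subalgebra_generated ::
  "('k, 'r) ring_scheme \<Rightarrow> ('k, 'a) superalgebra \<Rightarrow> 'a set \<Rightarrow> 'a set"
  where "subalgebra_generated K L S =
    \<Inter>{N. submodule N K L \<and> (\<forall>x\<in>N. \<forall>y\<in>N. x \<otimes>\<^bsub>L\<^esub> y \<in> N) \<and> S \<subseteq> N}"

definition central_extension ::
  "('k, 'r) ring_scheme \<Rightarrow> ('k, 'a) superalgebra \<Rightarrow> ('k, 'b) superalgebra \<Rightarrow> ('a \<Rightarrow> 'b) \<Rightarrow> bool"
  where "central_extension K M L \<pi> \<longleftrightarrow>
    lie_superalgebra K M \<and> lie_superalgebra K L \<and> \<pi> \<in> lie_hom K M L \<and>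
    \<pi> ` carrier M = carrier L \<and> a_kernel M L \<pi> \<subseteq> centre M"

text \<open>
  HOL cannot quantify over the carrier type of the competing central extension inside a formula;
  that type is the parameter \<open>'n\<close>, which remains a free type variable (hence is universally
  quantified) in the theorem.
\<close>

definition universal_central_extension ::
  "'n itself \<Rightarrow> ('k, 'r) ring_scheme \<Rightarrow> ('k, 'a) superalgebra \<Rightarrow> ('k, 'b) superalgebra
    \<Rightarrow> ('a \<Rightarrow> 'b) \<Rightarrow> bool"
  where "universal_central_extension TN K M L \<pi> \<longleftrightarrow> central_extension K M L \<pi> \<and>
    (\<forall>(M' :: ('k, 'n) superalgebra) \<tau>. central_extension K M' L \<tau> \<longrightarrow>
      (\<exists>\<rho> \<in> lie_hom K M M'. \<forall>x\<in>carrier M. \<tau> (\<rho> x) = \<pi> x) \<and>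
      (\<forall>\<rho> \<in> lie_hom K M M'. \<forall>\<rho>' \<in> lie_hom K M M'.
         (\<forall>x\<in>carrier M. \<tau> (\<rho> x) = \<pi> x) \<and> (\<forall>x\<in>carrier M. \<tau> (\<rho>' x) = \<pi> x) \<longrightarrow>
         (\<forall>x\<in>carrier M. \<rho> x = \<rho>' x)))"

text \<open>
  \<open>V\<close> is the second homology of the perfect Lie superalgebra \<open>L\<close>, computed as the kernel of the
  universal central extension \<open>\<pi>\<close> from \<open>M\<close> onto \<open>L\<close>.
\<close>

definition is_second_homology ::
  "'n itself \<Rightarrow> ('k, 'r) ring_scheme \<Rightarrow> ('k, 'b) superalgebra \<Rightarrow> ('k, 'a) superalgebra
    \<Rightarrow> ('a \<Rightarrow> 'b) \<Rightarrow> ('k, 'v) superalgebra \<Rightarrow> bool"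
  where "is_second_homology TN K L M \<pi> V \<longleftrightarrow>
    perfect K L \<and> universal_central_extension TN K M L \<pi> \<and>
    graded_iso K (restrict_to M (a_kernel M L \<pi>)) V"


section \<open>Lie superalgebras given by homogeneous generators and relations\<close>

datatype ('k, 'x) lterm =
    Gen 'x
  | Zer
  | Add "('k, 'x) lterm" "('k, 'x) lterm"
  | Smul 'k "('k, 'x) lterm"
  | Brk "('k, 'x) lterm" "('k, 'x) lterm"

primrec wf_lterm :: "('k, 'r) ring_scheme \<Rightarrow> 'x set \<Rightarrow> ('k, 'x) lterm \<Rightarrow> bool" where
  "wf_lterm K X (Gen x) = (x \<in> X)"
| "wf_lterm K X Zer = True"
| "wf_lterm K X (Add s t) = (wf_lterm K X s \<and> wf_lterm K X t)"
| "wf_lterm K X (Smul c t) = (c \<in> carrier K \<and> wf_lterm K X t)"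
| "wf_lterm K X (Brk s t) = (wf_lterm K X s \<and> wf_lterm K X t)"

text \<open>Terms all of whose summands visibly have degree \<open>p\<close>.\<close>

primrec hom_lterm ::
  "('k, 'r) ring_scheme \<Rightarrow> 'x set \<Rightarrow> ('x \<Rightarrow> bit) \<Rightarrow> bit \<Rightarrow> ('k, 'x) lterm \<Rightarrow> bool" where
  "hom_lterm K X d p (Gen x) = (x \<in> X \<and> d x = p)"
| "hom_lterm K X d p Zer = True"
| "hom_lterm K X d p (Add s t) = (hom_lterm K X d p s \<and> hom_lterm K X d p t)"
| "hom_lterm K X d p (Smul c t) = (c \<in> carrier K \<and> hom_lterm K X d p t)"
| "hom_lterm K X d p (Brk s t) =
     ((hom_lterm K X d 0 s \<and> hom_lterm K X d p t) \<or> (hom_lterm K X d 1 s \<and> hom_lterm K X d (p + 1) t))"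

definition Neg :: "('k, 'r) ring_scheme \<Rightarrow> ('k, 'x) lterm \<Rightarrow> ('k, 'x) lterm"
  where "Neg K t = Smul (\<ominus>\<^bsub>K\<^esub> \<one>\<^bsub>K\<^esub>) t"

definition Psign :: "('k, 'r) ring_scheme \<Rightarrow> bit \<Rightarrow> ('k, 'x) lterm \<Rightarrow> ('k, 'x) lterm"
  where "Psign K r t = (if r = 1 then Neg K t else t)"

text \<open>
  The least congruence on well-formed terms that contains the relations \<open>R\<close> and the axioms of
  Lie superalgebras over \<open>K\<close>.
\<close>

inductive lcong ::
  "('k, 'r) ring_scheme \<Rightarrow> 'x set \<Rightarrow> ('x \<Rightarrow> bit) \<Rightarrow> (('k, 'x) lterm \<times> ('k, 'x) lterm) set
    \<Rightarrow> ('k, 'x) lterm \<Rightarrow> ('k, 'x) lterm \<Rightarrow> bool"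
  for K :: "('k, 'r) ring_scheme" and X :: "'x set" and d :: "'x \<Rightarrow> bit"
    and R :: "(('k, 'x) lterm \<times> ('k, 'x) lterm) set"
where
  refl: "wf_lterm K X t \<Longrightarrow> lcong K X d R t t"
| sym: "lcong K X d R s t \<Longrightarrow> lcong K X d R t s"
| trans: "lcong K X d R s t \<Longrightarrow> lcong K X d R t u \<Longrightarrow> lcong K X d R s u"
| Add: "lcong K X d R s s' \<Longrightarrow> lcong K X d R t t' \<Longrightarrow> lcong K X d R (Add s t) (Add s' t')"
| Smul: "c \<in> carrier K \<Longrightarrow> lcong K X d R t t' \<Longrightarrow> lcong K X d R (Smul c t) (Smul c t')"
| Brk: "lcong K X d R s s' \<Longrightarrow> lcong K X d R t t' \<Longrightarrow> lcong K X d R (Brk s t) (Brk s' t')"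
| rel: "(s, t) \<in> R \<Longrightarrow> wf_lterm K X s \<Longrightarrow> wf_lterm K X t \<Longrightarrow> lcong K X d R s t"
| add_assoc: "wf_lterm K X s \<Longrightarrow> wf_lterm K X t \<Longrightarrow> wf_lterm K X u \<Longrightarrow>
    lcong K X d R (Add (Add s t) u) (Add s (Add t u))"
| add_comm: "wf_lterm K X s \<Longrightarrow> wf_lterm K X t \<Longrightarrow> lcong K X d R (Add s t) (Add t s)"
| add_zero: "wf_lterm K X t \<Longrightarrow> lcong K X d R (Add Zer t) t"
| add_neg: "wf_lterm K X t \<Longrightarrow> lcong K X d R (Add (Neg K t) t) Zer"
| smul_add_left: "a \<in> carrier K \<Longrightarrow> b \<in> carrier K \<Longrightarrow> wf_lterm K X t \<Longrightarrow>
    lcong K X d R (Smul (a \<oplus>\<^bsub>K\<^esub> b) t) (Add (Smul a t) (Smul b t))"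
| smul_add_right: "a \<in> carrier K \<Longrightarrow> wf_lterm K X s \<Longrightarrow> wf_lterm K X t \<Longrightarrow>
    lcong K X d R (Smul a (Add s t)) (Add (Smul a s) (Smul a t))"
| smul_assoc: "a \<in> carrier K \<Longrightarrow> b \<in> carrier K \<Longrightarrow> wf_lterm K X t \<Longrightarrow>
    lcong K X d R (Smul (a \<otimes>\<^bsub>K\<^esub> b) t) (Smul a (Smul b t))"
| smul_one: "wf_lterm K X t \<Longrightarrow> lcong K X d R (Smul \<one>\<^bsub>K\<^esub> t) t"
| brk_add_left: "wf_lterm K X s \<Longrightarrow> wf_lterm K X t \<Longrightarrow> wf_lterm K X u \<Longrightarrow>
    lcong K X d R (Brk (Add s t) u) (Add (Brk s u) (Brk t u))"
| brk_add_right: "wf_lterm K X s \<Longrightarrow> wf_lterm K X t \<Longrightarrow> wf_lterm K X u \<Longrightarrow>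
    lcong K X d R (Brk s (Add t u)) (Add (Brk s t) (Brk s u))"
| brk_smul_left: "c \<in> carrier K \<Longrightarrow> wf_lterm K X s \<Longrightarrow> wf_lterm K X t \<Longrightarrow>
    lcong K X d R (Brk (Smul c s) t) (Smul c (Brk s t))"
| brk_smul_right: "c \<in> carrier K \<Longrightarrow> wf_lterm K X s \<Longrightarrow> wf_lterm K X t \<Longrightarrow>
    lcong K X d R (Brk s (Smul c t)) (Smul c (Brk s t))"
| brk_skew: "hom_lterm K X d p s \<Longrightarrow> hom_lterm K X d q t \<Longrightarrow>
    lcong K X d R (Brk s t) (Neg K (Psign K (p * q) (Brk t s)))"
| brk_even: "hom_lterm K X d 0 t \<Longrightarrow> lcong K X d R (Brk t t) Zer"
| brk_jacobi: "hom_lterm K X d p s \<Longrightarrow> hom_lterm K X d q t \<Longrightarrow> hom_lterm K X d r u \<Longrightarrow>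
    lcong K X d R
      (Add (Add (Psign K (p * r) (Brk (Brk s t) u)) (Psign K (p * q) (Brk (Brk t u) s)))
           (Psign K (q * r) (Brk (Brk u s) t)))
      Zer"

definition lclass ::
  "('k, 'r) ring_scheme \<Rightarrow> 'x set \<Rightarrow> ('x \<Rightarrow> bit) \<Rightarrow> (('k, 'x) lterm \<times> ('k, 'x) lterm) set
    \<Rightarrow> ('k, 'x) lterm \<Rightarrow> ('k, 'x) lterm set"
  where "lclass K X d R t = {s. lcong K X d R t s}"

definition presented ::
  "('k, 'r) ring_scheme \<Rightarrow> 'x set \<Rightarrow> ('x \<Rightarrow> bit) \<Rightarrow> (('k, 'x) lterm \<times> ('k, 'x) lterm) set
    \<Rightarrow> ('k, ('k, 'x) lterm set) superalgebra"
  where "presented K X d R =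
    \<lparr>carrier = lclass K X d R ` {t. wf_lterm K X t},
     mult = (\<lambda>S T. \<Union>s\<in>S. \<Union>t\<in>T. lclass K X d R (Brk s t)),
     one = undefined,
     zero = lclass K X d R Zer,
     add = (\<lambda>S T. \<Union>s\<in>S. \<Union>t\<in>T. lclass K X d R (Add s t)),
     smult = (\<lambda>c T. \<Union>t\<in>T. lclass K X d R (Smul c t)),
     gr = (\<lambda>p. lclass K X d R ` {t. hom_lterm K X d p t})\<rparr>"


section \<open>The Lie superalgebras \<open>gl(3,1,A)\<close> and \<open>sl(3,1,A)\<close>\<close>

datatype index = I1 | I2 | I3 | I4

lemma UNIV_index: "(UNIV :: index set) = {I1, I2, I3, I4}"
  using index.exhaust by auto

instance index :: finite
  by standard (simp add: UNIV_index)

fun par :: "index \<Rightarrow> bit"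
  where "par I4 = 1" | "par _ = 0"

definition mat_superalgebra ::
  "('k, 'a) superalgebra \<Rightarrow> ('k, index \<Rightarrow> index \<Rightarrow> 'a) superalgebra"
  where "mat_superalgebra A =
    \<lparr>carrier = {x. \<forall>i j. x i j \<in> carrier A},
     mult = (\<lambda>x y i j. \<Oplus>\<^bsub>A\<^esub>k\<in>UNIV. x i k \<otimes>\<^bsub>A\<^esub> y k j),
     one = (\<lambda>i j. if i = j then \<one>\<^bsub>A\<^esub> else \<zero>\<^bsub>A\<^esub>),
     zero = (\<lambda>i j. \<zero>\<^bsub>A\<^esub>),
     add = (\<lambda>x y i j. x i j \<oplus>\<^bsub>A\<^esub> y i j),
     smult = (\<lambda>c x i j. c \<odot>\<^bsub>A\<^esub> x i j),
     gr = (\<lambda>p. {x. \<forall>i j. x i j \<in> gr A (p + par i + par j)})\<rparr>"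

text \<open>The supercommutator, extended from homogeneous elements by biadditivity.\<close>

definition super_commutator :: "('k, 'a) superalgebra \<Rightarrow> 'a \<Rightarrow> 'a \<Rightarrow> 'a"
  where "super_commutator A x y =
    (\<Oplus>\<^bsub>A\<^esub>p\<in>{0, 1}. \<Oplus>\<^bsub>A\<^esub>q\<in>{0, 1}.
       hcomp A p x \<otimes>\<^bsub>A\<^esub> hcomp A q y \<ominus>\<^bsub>A\<^esub> psign A (p * q) (hcomp A q y \<otimes>\<^bsub>A\<^esub> hcomp A p x))"

definition gl31 :: "('k, 'a) superalgebra \<Rightarrow> ('k, index \<Rightarrow> index \<Rightarrow> 'a) superalgebra"
  where "gl31 A = (mat_superalgebra A)\<lparr>mult := super_commutator (mat_superalgebra A)\<rparr>"

definition sl31 ::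
  "('k, 'r) ring_scheme \<Rightarrow> ('k, 'a) superalgebra \<Rightarrow> ('k, index \<Rightarrow> index \<Rightarrow> 'a) superalgebra"
  where "sl31 K A = derived K (gl31 A)"

definition E_elem :: "('k, 'a) superalgebra \<Rightarrow> index \<Rightarrow> index \<Rightarrow> 'a \<Rightarrow> index \<Rightarrow> index \<Rightarrow> 'a"
  where "E_elem A i j a = (\<lambda>k l. if k = i \<and> l = j then a else \<zero>\<^bsub>A\<^esub>)"


section \<open>The Steinberg Lie superalgebra \<open>st(3,1,A)\<close>\<close>

text \<open>
  The generator \<open>(i, j, p, a)\<close> stands for $F_{ij}(a)$ with \<open>a\<close> of degree \<open>p\<close>. The tag \<open>p\<close> only
  matters for \<open>a = \<zero>\<close>, which is homogeneous of both degrees.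
\<close>

type_synonym 'a st_gen = "index \<times> index \<times> bit \<times> 'a"

definition st_gens :: "('k, 'a) superalgebra \<Rightarrow> 'a st_gen set"
  where "st_gens A = {(i, j, p, a). i \<noteq> j \<and> a \<in> gr A p}"

definition st_deg :: "'a st_gen \<Rightarrow> bit"
  where "st_deg = (\<lambda>(i, j, p, a). par i + par j + p)"

inductive_set st_rels ::
  "('k, 'r) ring_scheme \<Rightarrow> ('k, 'a) superalgebra
    \<Rightarrow> (('k, 'a st_gen) lterm \<times> ('k, 'a st_gen) lterm) set"
  for K :: "('k, 'r) ring_scheme" and A :: "('k, 'a) superalgebra"
where
  add: "\<lbrakk>i \<noteq> j; a \<in> gr A p; b \<in> gr A p\<rbrakk> \<Longrightarrow>
    (Gen (i, j, p, a \<oplus>\<^bsub>A\<^esub> b), Add (Gen (i, j, p, a)) (Gen (i, j, p, b))) \<in> st_rels K A"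
| smul: "\<lbrakk>i \<noteq> j; c \<in> carrier K; a \<in> gr A p\<rbrakk> \<Longrightarrow>
    (Gen (i, j, p, c \<odot>\<^bsub>A\<^esub> a), Smul c (Gen (i, j, p, a))) \<in> st_rels K A"
| brk: "\<lbrakk>distinct [i, j, k]; a \<in> gr A p; b \<in> gr A q\<rbrakk> \<Longrightarrow>
    (Brk (Gen (i, j, p, a)) (Gen (j, k, q, b)), Gen (i, k, p + q, a \<otimes>\<^bsub>A\<^esub> b)) \<in> st_rels K A"
| brk_zero: "\<lbrakk>i \<noteq> j; k \<noteq> l; j \<noteq> k; i \<noteq> l; a \<in> gr A p; b \<in> gr A q\<rbrakk> \<Longrightarrow>
    (Brk (Gen (i, j, p, a)) (Gen (k, l, q, b)), Zer) \<in> st_rels K A"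

definition st31 ::
  "('k, 'r) ring_scheme \<Rightarrow> ('k, 'a) superalgebra \<Rightarrow> ('k, ('k, 'a st_gen) lterm set) superalgebra"
  where "st31 K A = presented K (st_gens A) st_deg (st_rels K A)"

text \<open>$F_{ij}(a)$, extended additively to inhomogeneous \<open>a\<close>.\<close>

definition F_gen ::
  "('k, 'r) ring_scheme \<Rightarrow> ('k, 'a) superalgebra \<Rightarrow> index \<Rightarrow> index \<Rightarrow> 'a
    \<Rightarrow> ('k, 'a st_gen) lterm set"
  where "F_gen K A i j a =
    lclass K (st_gens A) st_deg (st_rels K A) (Gen (i, j, 0, hcomp A 0 a)) \<oplus>\<^bsub>st31 K A\<^esub>
    lclass K (st_gens A) st_deg (st_rels K A) (Gen (i, j, 1, hcomp A 1 a))"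

definition H_sub ::
  "('k, 'r) ring_scheme \<Rightarrow> ('k, 'a) superalgebra \<Rightarrow> ('k, 'a st_gen) lterm set set"
  where "H_sub K A = subalgebra_generated K (st31 K A)
    {F_gen K A i j a \<otimes>\<^bsub>st31 K A\<^esub> F_gen K A j i b | i j a b. i \<noteq> j \<and> a \<in> carrier A \<and> b \<in> carrier A}"

definition st31_to_sl31 ::
  "('k, 'r) ring_scheme \<Rightarrow> ('k, 'a) superalgebra
    \<Rightarrow> ('k, 'a st_gen) lterm set \<Rightarrow> index \<Rightarrow> index \<Rightarrow> 'a"
  where "st31_to_sl31 K A = (THE f. f \<in> extensional (carrier (st31 K A)) \<and>
    f \<in> lie_hom K (st31 K A) (sl31 K A) \<and>
    (\<forall>i j. \<forall>a\<in>carrier A. i \<noteq> j \<longrightarrow> f (F_gen K A i j a) = E_elem A i j a))"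


section \<open>The module \<open>W\<close>, the cocycle and the extension of \<open>st(3,1,A)\<close>\<close>

text \<open>
  This is the two-sided ideal generated by these elements; it is automatically graded and stable
  under \<open>K\<close>.
\<close>

definition I2_ideal :: "('k, 'a) superalgebra \<Rightarrow> 'a set"
  where "I2_ideal A = genideal A
    ({a \<oplus>\<^bsub>A\<^esub> a | a. a \<in> carrier A} \<union>
     {a \<otimes>\<^bsub>A\<^esub> b \<ominus>\<^bsub>A\<^esub> psign A (p * q) (b \<otimes>\<^bsub>A\<^esub> a) | a b p q. a \<in> gr A p \<and> b \<in> gr A q})"

definition A2_class :: "('k, 'a) superalgebra \<Rightarrow> 'a \<Rightarrow> 'a set"
  where "A2_class A a = I2_ideal A +>\<^bsub>A\<^esub> a"

definition A2 :: "('k, 'a) superalgebra \<Rightarrow> ('k, 'a set) superalgebra"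
  where "A2 A = (let Q = A Quot I2_ideal A in
    \<lparr>carrier = carrier Q, mult = mult Q, one = one Q, zero = zero Q, add = add Q,
     smult = (\<lambda>c X. \<Union>x\<in>X. A2_class A (c \<odot>\<^bsub>A\<^esub> x)),
     gr = (\<lambda>p. A2_class A ` gr A p)\<rparr>)"

text \<open>Only the graded module structure of a parity change is meaningful.\<close>

definition parity_change :: "('k, 'a) superalgebra \<Rightarrow> ('k, 'a) superalgebra"
  where "parity_change M = M\<lparr>gr := \<lambda>p. gr M (p + 1)\<rparr>"

text \<open>For finite \<open>I\<close> this is a direct sum of copies of \<open>M\<close>; it carries the zero bracket.\<close>

definition direct_power :: "'i set \<Rightarrow> ('k, 'a) superalgebra \<Rightarrow> ('k, 'i \<Rightarrow> 'a) superalgebra"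
  where "direct_power I M =
    \<lparr>carrier = I \<rightarrow>\<^sub>E carrier M,
     mult = (\<lambda>v w. \<lambda>i\<in>I. \<zero>\<^bsub>M\<^esub>),
     one = undefined,
     zero = (\<lambda>i\<in>I. \<zero>\<^bsub>M\<^esub>),
     add = (\<lambda>v w. \<lambda>i\<in>I. v i \<oplus>\<^bsub>M\<^esub> w i),
     smult = (\<lambda>c v. \<lambda>i\<in>I. c \<odot>\<^bsub>M\<^esub> v i),
     gr = (\<lambda>p. I \<rightarrow>\<^sub>E gr M p)\<rparr>"

definition W_mod :: "('k, 'a) superalgebra \<Rightarrow> ('k, nat \<Rightarrow> 'a set) superalgebra"
  where "W_mod A = direct_power {1..6} (parity_change (A2 A))"

definition W_incl :: "('k, 'a) superalgebra \<Rightarrow> nat \<Rightarrow> 'a set \<Rightarrow> nat \<Rightarrow> 'a set"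
  where "W_incl A r v = (\<lambda>s\<in>{1..6}. if s = r then v else \<zero>\<^bsub>A2 A\<^esub>)"

type_synonym quad = "index \<times> index \<times> index \<times> index"

definition quads :: "quad set"
  where "quads = {(i, j, k, l). distinct [i, j, k, l]}"

definition quad_class :: "quad \<Rightarrow> quad set"
  where "quad_class = (\<lambda>(i, j, k, l). {(i, j, k, l), (k, j, i, l), (i, l, k, j), (k, l, i, j)})"

text \<open>A labelling of the six classes by \<open>1, \<dots>, 6\<close>.\<close>

definition quad_labelling :: "(nat \<Rightarrow> quad set) \<Rightarrow> bool"
  where "quad_labelling P \<longleftrightarrow> bij_betw P {1..6} (quad_class ` quads)"

definition theta :: "(nat \<Rightarrow> quad set) \<Rightarrow> quad \<Rightarrow> nat"
  where "theta P u = (THE r. r \<in> {1..6} \<and> u \<in> P r)"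

definition is_psi ::
  "('k, 'r) ring_scheme \<Rightarrow> ('k, 'a) superalgebra \<Rightarrow> (nat \<Rightarrow> quad set)
    \<Rightarrow> (('k, 'a st_gen) lterm set \<times> ('k, 'a st_gen) lterm set \<Rightarrow> nat \<Rightarrow> 'a set) \<Rightarrow> bool"
  where "is_psi K A P f \<longleftrightarrow> (let S = st31 K A; V = W_mod A in
    f \<in> carrier S \<times> carrier S \<rightarrow>\<^sub>E carrier V \<and>
    (\<forall>x\<in>carrier S. \<forall>y\<in>carrier S. \<forall>z\<in>carrier S.
       f (x \<oplus>\<^bsub>S\<^esub> y, z) = f (x, z) \<oplus>\<^bsub>V\<^esub> f (y, z) \<and> f (z, x \<oplus>\<^bsub>S\<^esub> y) = f (z, x) \<oplus>\<^bsub>V\<^esub> f (z, y)) \<and>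
    (\<forall>c\<in>carrier K. \<forall>x\<in>carrier S. \<forall>y\<in>carrier S.
       f (c \<odot>\<^bsub>S\<^esub> x, y) = c \<odot>\<^bsub>V\<^esub> f (x, y) \<and> f (x, c \<odot>\<^bsub>S\<^esub> y) = c \<odot>\<^bsub>V\<^esub> f (x, y)) \<and>
    (\<forall>i j k l. \<forall>a\<in>carrier A. \<forall>b\<in>carrier A. i \<noteq> j \<longrightarrow> k \<noteq> l \<longrightarrow>
       f (F_gen K A i j a, F_gen K A k l b) =
         (if distinct [i, j, k, l] then W_incl A (theta P (i, j, k, l)) (A2_class A (a \<otimes>\<^bsub>A\<^esub> b))
          else \<zero>\<^bsub>V\<^esub>)) \<and>
    (\<forall>x\<in>carrier S. \<forall>h\<in>H_sub K A. f (x, h) = \<zero>\<^bsub>V\<^esub> \<and> f (h, x) = \<zero>\<^bsub>V\<^esub>))"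

definition psi ::
  "('k, 'r) ring_scheme \<Rightarrow> ('k, 'a) superalgebra \<Rightarrow> (nat \<Rightarrow> quad set)
    \<Rightarrow> ('k, 'a st_gen) lterm set \<times> ('k, 'a st_gen) lterm set \<Rightarrow> nat \<Rightarrow> 'a set"
  where "psi K A P = (THE f. is_psi K A P f)"

definition st31_sharp ::
  "('k, 'r) ring_scheme \<Rightarrow> ('k, 'a) superalgebra \<Rightarrow> (nat \<Rightarrow> quad set)
    \<Rightarrow> ('k, ('k, 'a st_gen) lterm set \<times> (nat \<Rightarrow> 'a set)) superalgebra"
  where "st31_sharp K A P = (let S = st31 K A; V = W_mod A in
    \<lparr>carrier = carrier S \<times> carrier V,
     mult = (\<lambda>(x, v) (y, w). (x \<otimes>\<^bsub>S\<^esub> y, psi K A P (x, y))),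
     one = undefined,
     zero = (\<zero>\<^bsub>S\<^esub>, \<zero>\<^bsub>V\<^esub>),
     add = (\<lambda>(x, v) (y, w). (x \<oplus>\<^bsub>S\<^esub> y, v \<oplus>\<^bsub>V\<^esub> w)),
     smult = (\<lambda>c (x, v). (c \<odot>\<^bsub>S\<^esub> x, c \<odot>\<^bsub>V\<^esub> v)),
     gr = (\<lambda>p. gr S p \<times> gr V p)\<rparr>)"

end

theory Submission
  imports Defs
begin

text \<open>
  Write \<open>st\<close> and \<open>sl\<close> for \<open>st(3,1,A)\<close> and \<open>sl(3,1,A)\<close>, and \<open>\<phi>\<close> for the canonical map from \<open>st\<close> to matrices. Its
  image is \<open>sl\<close> (\<open>sl_carrier\<close>), and its kernel is central (\<open>kernel_central\<close>): an element of the kernel lies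
  in \<open>H\<close>, so it normalises each \<open>F\<^sub>i\<^sub>j(A)\<close>, and \<open>\<phi>\<close> is injective there.

  The cocycle factors through \<open>\<phi>\<close>. Over \<open>A\<^sub>2\<close>, which is commutative with \<open>2 = 0\<close>, its component at the class of
  \<open>(i, j, k, l)\<close> is the polarised determinant of the block with rows \<open>i, k\<close> and columns \<open>j, l\<close>. The
  cyclic sum in the cocycle identity is a combination of the traces of the three matrices
  (\<open>block_jacobi\<close>), and traces of elements of \<open>sl\<close> vanish in \<open>A\<^sub>2\<close> (\<open>trace_Im\<close>). So \<open>st(3,1,A)\<^sup>\<sharp>\<close> is a Lie
  superalgebra. It is perfect (\<open>SH_perfect\<close>), whence lifts to central extensions are unique.

  For the existence of lifts let \<open>\<tau>\<close> from \<open>M\<close> to \<open>L\<close> be a central extension, where \<open>L\<close> is a quotient of \<open>st\<close>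
  that maps to matrices; the theorem needs \<open>L = sl\<close> and \<open>L = st\<close>. For \<open>x\<close>, \<open>y\<close> in \<open>st\<close> let \<open>B x y\<close> be the
  bracket of arbitrary lifts to \<open>M\<close> of their images in \<open>L\<close>. This is a well-defined bilinear map, which
  inherits skew symmetry and the identity \<open>B(x, [y, z]) = B([x, y], z) \<plusminus> B(y, [x, z])\<close>. The elements
  \<open>f\<^sub>i\<^sub>j(a) = B(F\<^sub>i\<^sub>k(a), F\<^sub>k\<^sub>j(1))\<close> are independent of \<open>k\<close> and linear in \<open>a\<close>, and they satisfy the relations of
  \<open>st\<close> (\<open>B_chain\<close>, \<open>B_vanish\<close>) with one exception: \<open>B(F\<^sub>i\<^sub>j(a), F\<^sub>k\<^sub>l(b))\<close> need not be zero for four distinct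
  indices. Writing \<open>F\<^sub>k\<^sub>l\<close> as a bracket through \<open>i\<close> or through \<open>j\<close> gives two expressions for this
  obstruction. Their signs show that it is killed by 2 (\<open>B_torsion\<close>), and their arguments show that it
  only depends on the class of \<open>ab\<close> in \<open>A\<^sub>2\<close> (\<open>gam_I2\<close>) and on the class of \<open>(i, j, k, l)\<close>
  (\<open>gam_class\<close>). Therefore it is \<open>\<gamma>(\<psi>(F\<^sub>i\<^sub>j(a), F\<^sub>k\<^sub>l(b)))\<close> for a linear map \<open>\<gamma>\<close> from \<open>W\<close> to the kernel of \<open>\<tau>\<close>.

  Finally the bracket of \<open>M\<close> is replaced by \<open>[x, y] + \<gamma>(\<psi>(\<tau>(x), \<tau>(y)))\<close>. Because \<open>\<psi>\<close> is a cocycle, this is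
  again a Lie superalgebra (\<open>twist_lie\<close>), in which the \<open>f\<^sub>i\<^sub>j(a)\<close> satisfy all relations of \<open>st\<close>. The universal
  property of \<open>st\<close> yields a homomorphism \<open>\<sigma>\<close> to it, and \<open>(x, w) \<mapsto> \<sigma>(x) + \<gamma>(w)\<close> is the required lift to \<open>M\<close> with
  its original bracket.
\<close>

section \<open>Graded modules\<close>

lemma bit_add_self [simp]: "(r::bit) + r = 0" "r + (r + s) = s"
  by (cases r; cases s; simp)+

(* Rewriting sums and products of degrees into boolean operations would hide their group structure. *)
declare add_bit_eq_xor [simp del] mult_bit_eq_and [simp del]

lemma graded_moduleI:
  fixes M (structure)
  assumes "module K M"
    and "\<And>p. submodule (gr M p) K M"
    and "\<And>x. x \<in> carrier M \<Longrightarrow> \<exists>y\<in>gr M 0. \<exists>z\<in>gr M 1. x = y \<oplus> z"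
    and "\<And>x. x \<in> gr M 0 \<Longrightarrow> x \<in> gr M 1 \<Longrightarrow> x = \<zero>"
  shows "graded_module K M"
proof -
  interpret module K M by fact
  have sub: "gr M p \<subseteq> carrier M" for p using submoduleE(1)[OF assms(2)] .
  have "\<zero> \<in> gr M p" for p
    using subgroup.one_closed[OF submodule.axioms(1)[OF assms(2)]] by simp
  moreover have "gr M 0 <+> gr M 1 = carrier M"
  proof
    show "gr M 0 <+> gr M 1 \<subseteq> carrier M"
      using sub[of 0] sub[of 1] by (auto simp: set_add_def')
    show "carrier M \<subseteq> gr M 0 <+> gr M 1"
      using assms(3) by (auto simp: set_add_def')
  qed
  ultimately show ?thesis
    using assms by (intro graded_module.intro graded_module_axioms.intro) auto
qed

lemma module_cong:
  assumes "module K M" "carrier M' = carrier M" "add M' = add M" "zero M' = zero M" "smult M' = smult M"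
  shows "module K M'"
proof -
  interpret module K M by fact
  have "abelian_group M'"
    by (rule abelian_groupI)
      (use assms in \<open>auto simp: M.a_ac intro: bexI[of _ "\<ominus>\<^bsub>M\<^esub> x" for x] M.l_neg\<close>)
  then show ?thesis
    using assms by (intro moduleI) (auto simp: smult_l_distr smult_r_distr smult_assoc1 is_cring)
qed

lemma a_inv_cong:
  assumes "carrier M' = carrier M" "add M' = add M" "zero M' = zero M"
  shows "a_inv M' = a_inv M"
  using assms by (simp add: a_inv_def m_inv_def fun_eq_iff)

lemma graded_module_cong:
  assumes "graded_module K M" "carrier M' = carrier M" "add M' = add M" "zero M' = zero M"
    "smult M' = smult M" "gr M' = gr M"
  shows "graded_module K M'"
proof -
  interpret graded_module K M by fact
  interpret M': module K M' using module_cong[OF module_axioms assms(2-5)] .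
  show ?thesis
  proof (intro graded_module.intro graded_module_axioms.intro M'.module_axioms)
    fix p
    show "submodule (gr M' p) K M'"
      using submoduleE[OF gr_submodule[of p]] subgroup.one_closed[OF submodule.axioms(1)[OF gr_submodule[of p]]]
      by (intro M'.submoduleI) (simp_all add: assms a_inv_cong[OF assms(2-4)])
  qed (use gr_sum gr_direct assms in \<open>simp_all add: set_add_def'\<close>)
qed

context graded_module
begin

lemma gr_carrier: "x \<in> gr M p \<Longrightarrow> x \<in> carrier M"
  using submoduleE(1)[OF gr_submodule] by blast

lemma gr_zero [simp]: "\<zero> \<in> gr M p"
  using subgroup.one_closed[OF submodule.axioms(1)[OF gr_submodule]] by simp

lemma gr_add [simp]: "x \<in> gr M p \<Longrightarrow> y \<in> gr M p \<Longrightarrow> x \<oplus> y \<in> gr M p"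
  using submoduleE(5)[OF gr_submodule] by blast

lemma gr_neg [simp]: "x \<in> gr M p \<Longrightarrow> \<ominus> x \<in> gr M p"
  using submoduleE(3)[OF gr_submodule] by blast

lemma gr_smult [simp]: "c \<in> carrier K \<Longrightarrow> x \<in> gr M p \<Longrightarrow> c \<odot> x \<in> gr M p"
  using submoduleE(4)[OF gr_submodule] by blast

lemma gr_minus [simp]: "x \<in> gr M p \<Longrightarrow> y \<in> gr M p \<Longrightarrow> x \<ominus> y \<in> gr M p"
  by (simp add: a_minus_def)

lemma gr_disjoint: "x \<in> gr M p \<Longrightarrow> x \<in> gr M (p + 1) \<Longrightarrow> x = \<zero>"
  using gr_direct by (cases p) auto

lemma gr_decomp:
  assumes "x \<in> carrier M"
  obtains y z where "y \<in> gr M p" "z \<in> gr M (p + 1)" "x = y \<oplus> z"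
proof -
  obtain y z where yz: "y \<in> gr M 0" "z \<in> gr M 1" "x = y \<oplus> z"
    using assms unfolding gr_sum[symmetric] set_add_def' by blast
  then have "x = z \<oplus> y" using gr_carrier by (simp add: M.a_comm)
  with yz that show thesis by (cases p) auto
qed

lemma gr_unique:
  assumes "y \<in> gr M p" "z \<in> gr M (p + 1)" "y' \<in> gr M p" "z' \<in> gr M (p + 1)" "y \<oplus> z = y' \<oplus> z'"
  shows "y = y'"
proof -
  note c = assms(1-4)[THEN gr_carrier]
  have "y \<ominus> y' \<oplus> z = \<ominus> y' \<oplus> (y \<oplus> z)" using c by (simp add: a_minus_def M.a_ac)
  also have "\<dots> = z'" using c by (simp add: assms(5) M.r_neg1)
  finally have "z' \<ominus> z = y \<ominus> y'" using c by (auto simp: a_minus_def M.a_assoc M.r_neg)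
  then have "y \<ominus> y' \<in> gr M p" "y \<ominus> y' \<in> gr M (p + 1)"
    using assms gr_minus[of z' "p + 1" z] by auto
  then have "y \<ominus> y' = \<zero>" by (rule gr_disjoint)
  then show ?thesis using c M.minus_equality[of y "\<ominus> y'"] by (simp add: a_minus_def)
qed

lemma hcomp_eq: "y \<in> gr M p \<Longrightarrow> z \<in> gr M (p + 1) \<Longrightarrow> hcomp M p (y \<oplus> z) = y"
  unfolding hcomp_def by (rule the_equality) (use gr_unique in blast)+

lemma hcomp_gr [simp]: "x \<in> carrier M \<Longrightarrow> hcomp M p x \<in> gr M p"
  by (rule gr_decomp[of x p]) (auto simp: hcomp_eq)

lemma hcomp_closed [simp]: "x \<in> carrier M \<Longrightarrow> hcomp M p x \<in> carrier M"
  using hcomp_gr gr_carrier by blast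

lemma hcomp_decomp: "x \<in> carrier M \<Longrightarrow> hcomp M p x \<oplus> hcomp M (p + 1) x = x"
proof -
  assume "x \<in> carrier M"
  then obtain y z where yz: "y \<in> gr M p" "z \<in> gr M (p + 1)" "x = y \<oplus> z" by (rule gr_decomp[of x p])
  have "z \<oplus> y = y \<oplus> z" using yz gr_carrier by (simp add: M.a_comm)
  then show ?thesis using yz hcomp_eq[of z "p + 1" y] hcomp_eq[of y p z] by (simp add: add.assoc)
qed

lemma hcomp_sum: "x \<in> carrier M \<Longrightarrow> x = hcomp M 0 x \<oplus> hcomp M 1 x"
  using hcomp_decomp[of x 0] by simp

lemma hcomp_same [simp]: "x \<in> gr M p \<Longrightarrow> hcomp M p x = x"
  using hcomp_eq[of x p \<zero>] by (simp add: gr_carrier)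

lemma hcomp_other: "x \<in> gr M p \<Longrightarrow> q \<noteq> p \<Longrightarrow> hcomp M q x = \<zero>"
  using hcomp_eq[of \<zero> q x] by (cases p; cases q) (auto simp: gr_carrier)

lemma hcomp_add:
  assumes "x \<in> carrier M" "y \<in> carrier M"
  shows "hcomp M p (x \<oplus> y) = hcomp M p x \<oplus> hcomp M p y"
proof -
  have "x \<oplus> y = (hcomp M p x \<oplus> hcomp M (p+1) x) \<oplus> (hcomp M p y \<oplus> hcomp M (p+1) y)"
    using assms by (simp add: hcomp_decomp)
  also have "\<dots> = (hcomp M p x \<oplus> hcomp M p y) \<oplus> (hcomp M (p+1) x \<oplus> hcomp M (p+1) y)"
    using assms by (simp add: M.a_ac)
  finally show ?thesis using assms by (simp add: hcomp_eq)
qed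

lemma hcomp_smult:
  assumes "c \<in> carrier K" "x \<in> carrier M"
  shows "hcomp M p (c \<odot> x) = c \<odot> hcomp M p x"
proof -
  have "c \<odot> x = c \<odot> (hcomp M p x \<oplus> hcomp M (p+1) x)"
    using assms by (simp add: hcomp_decomp)
  also have "\<dots> = c \<odot> hcomp M p x \<oplus> c \<odot> hcomp M (p+1) x"
    using assms by (simp add: smult_r_distr)
  finally show ?thesis using assms by (simp add: hcomp_eq)
qed

text \<open>The signs in the axioms of superalgebras are only specified on homogeneous elements, so
  every additive statement is reduced to them by this rule.\<close>

lemma gr_induct [consumes 1, case_names hom add]:
  assumes "x \<in> carrier M"
    and "\<And>p x. x \<in> gr M p \<Longrightarrow> Q x"
    and "\<And>x y. x \<in> carrier M \<Longrightarrow> y \<in> carrier M \<Longrightarrow> Q x \<Longrightarrow> Q y \<Longrightarrow> Q (x \<oplus> y)"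
  shows "Q x"
proof -
  have "Q (hcomp M 0 x \<oplus> hcomp M 1 x)"
    using assms(1) by (intro assms(3) assms(2)[of _ 0] assms(2)[of _ 1]) auto
  then show ?thesis using assms(1) hcomp_sum by simp
qed

lemma psign_simps [simp]: "psign M 0 x = x" "psign M 1 x = \<ominus> x"
  by (simp_all add: psign_def)

lemma psign_closed [simp]: "x \<in> carrier M \<Longrightarrow> psign M r x \<in> carrier M"
  by (cases r) auto

lemma psign_gr [simp]: "x \<in> gr M p \<Longrightarrow> psign M r x \<in> gr M p"
  by (cases r) auto

lemma psign_zero [simp]: "psign M r \<zero> = \<zero>"
  by (cases r) auto

lemma neg_smult: "x \<in> carrier M \<Longrightarrow> \<ominus>\<^bsub>K\<^esub> \<one>\<^bsub>K\<^esub> \<odot> x = \<ominus> x"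
  by (simp add: smult_l_minus)

lemma submodule_psign: "submodule N K M \<Longrightarrow> x \<in> N \<Longrightarrow> psign M r x \<in> N"
  by (cases r) (auto dest: submoduleE(3))

lemma submodule_zero: "submodule N K M \<Longrightarrow> \<zero> \<in> N"
  using subgroup.one_closed[OF submodule.axioms(1)] by fastforce

end

context superalgebra
begin

lemma mult_zero_left [simp]: "x \<in> carrier M \<Longrightarrow> \<zero> \<otimes> x = \<zero>"
  using mult_smult_left[of "\<zero>\<^bsub>K\<^esub>" \<zero> x] by (simp add: mult_closed)

lemma mult_zero_right [simp]: "x \<in> carrier M \<Longrightarrow> x \<otimes> \<zero> = \<zero>"
  using mult_smult_right[of "\<zero>\<^bsub>K\<^esub>" x \<zero>] by (simp add: mult_closed)

lemma mult_neg_left: "x \<in> carrier M \<Longrightarrow> y \<in> carrier M \<Longrightarrow> \<ominus> x \<otimes> y = \<ominus> (x \<otimes> y)"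
  using mult_smult_left[of "\<ominus>\<^bsub>K\<^esub> \<one>\<^bsub>K\<^esub>" x y] by (simp add: mult_closed neg_smult)

lemma mult_neg_right: "x \<in> carrier M \<Longrightarrow> y \<in> carrier M \<Longrightarrow> x \<otimes> \<ominus> y = \<ominus> (x \<otimes> y)"
  using mult_smult_right[of "\<ominus>\<^bsub>K\<^esub> \<one>\<^bsub>K\<^esub>" x y] by (simp add: mult_closed neg_smult)

lemma mult_psign_left: "x \<in> carrier M \<Longrightarrow> y \<in> carrier M \<Longrightarrow> psign M r x \<otimes> y = psign M r (x \<otimes> y)"
  by (cases r) (auto simp: mult_neg_left)

lemma mult_psign_right: "x \<in> carrier M \<Longrightarrow> y \<in> carrier M \<Longrightarrow> x \<otimes> psign M r y = psign M r (x \<otimes> y)"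
  by (cases r) (auto simp: mult_neg_right)

lemma mult_split:
  assumes x: "x \<in> carrier M" and y: "y \<in> carrier M" and N: "submodule N K M"
    and hom: "\<And>p q. hcomp M p x \<otimes> hcomp M q y \<in> N"
  shows "x \<otimes> y \<in> N"
proof -
  have "x \<otimes> y = (hcomp M 0 x \<oplus> hcomp M 1 x) \<otimes> (hcomp M 0 y \<oplus> hcomp M 1 y)"
    using x y hcomp_sum by simp
  also have "\<dots> = (hcomp M 0 x \<otimes> hcomp M 0 y \<oplus> hcomp M 1 x \<otimes> hcomp M 0 y)
     \<oplus> (hcomp M 0 x \<otimes> hcomp M 1 y \<oplus> hcomp M 1 x \<otimes> hcomp M 1 y)"
    using x y by (simp add: mult_add_left mult_add_right mult_closed)
  also have "\<dots> \<in> N" by (intro submoduleE(5)[OF N] hom)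
  finally show ?thesis .
qed

end

section \<open>Homomorphisms\<close>

lemma graded_homD:
  assumes "f \<in> graded_hom K L M"
  shows "x \<in> carrier L \<Longrightarrow> f x \<in> carrier M"
    and "x \<in> carrier L \<Longrightarrow> y \<in> carrier L \<Longrightarrow> f (x \<oplus>\<^bsub>L\<^esub> y) = f x \<oplus>\<^bsub>M\<^esub> f y"
    and "c \<in> carrier K \<Longrightarrow> x \<in> carrier L \<Longrightarrow> f (c \<odot>\<^bsub>L\<^esub> x) = c \<odot>\<^bsub>M\<^esub> f x"
    and "x \<in> gr L p \<Longrightarrow> f x \<in> gr M p"
  using assms by (auto simp: graded_hom_def image_subset_iff)

lemma lie_homD:
  assumes "f \<in> lie_hom K L M"
  shows "f \<in> graded_hom K L M"
    and "x \<in> carrier L \<Longrightarrow> y \<in> carrier L \<Longrightarrow> f (x \<otimes>\<^bsub>L\<^esub> y) = f x \<otimes>\<^bsub>M\<^esub> f y"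
  using assms by (auto simp: lie_hom_def)

lemma graded_homI:
  assumes "\<And>x. x \<in> carrier L \<Longrightarrow> f x \<in> carrier M"
    and "\<And>x y. x \<in> carrier L \<Longrightarrow> y \<in> carrier L \<Longrightarrow> f (x \<oplus>\<^bsub>L\<^esub> y) = f x \<oplus>\<^bsub>M\<^esub> f y"
    and "\<And>c x. c \<in> carrier K \<Longrightarrow> x \<in> carrier L \<Longrightarrow> f (c \<odot>\<^bsub>L\<^esub> x) = c \<odot>\<^bsub>M\<^esub> f x"
    and "\<And>x p. x \<in> gr L p \<Longrightarrow> f x \<in> gr M p"
  shows "f \<in> graded_hom K L M"
  using assms by (auto simp: graded_hom_def)

lemma lie_homI:
  assumes "f \<in> graded_hom K L M"
    and "\<And>x y. x \<in> carrier L \<Longrightarrow> y \<in> carrier L \<Longrightarrow> f (x \<otimes>\<^bsub>L\<^esub> y) = f x \<otimes>\<^bsub>M\<^esub> f y"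
  shows "f \<in> lie_hom K L M"
  using assms by (auto simp: lie_hom_def)

lemma lie_hom_comp:
  assumes "f \<in> lie_hom K L M" "g \<in> lie_hom K M N"
  shows "g \<circ> f \<in> lie_hom K L N"
  using assms[THEN lie_homD(1), THEN graded_homD(1)] assms[THEN lie_homD(1), THEN graded_homD(2)]
    assms[THEN lie_homD(1), THEN graded_homD(3)] assms[THEN lie_homD(1), THEN graded_homD(4)]
    assms[THEN lie_homD(2)]
  by (intro lie_homI graded_homI) auto

locale graded_map = L: graded_module K L + M: graded_module K M
  for K :: "('k, 'r) ring_scheme" and L :: "('k, 'a) superalgebra" and M :: "('k, 'b) superalgebra" +
  fixes f
  assumes hom: "f \<in> graded_hom K L M"
begin

lemmas closed [simp] = graded_homD(1)[OF hom]
  and add = graded_homD(2)[OF hom]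
  and smult = graded_homD(3)[OF hom]
  and gr = graded_homD(4)[OF hom]

lemma zero [simp]: "f \<zero>\<^bsub>L\<^esub> = \<zero>\<^bsub>M\<^esub>"
  using smult[of "\<zero>\<^bsub>K\<^esub>" "\<zero>\<^bsub>L\<^esub>"] by simp

lemma neg: "x \<in> carrier L \<Longrightarrow> f (\<ominus>\<^bsub>L\<^esub> x) = \<ominus>\<^bsub>M\<^esub> f x"
  using smult[of "\<ominus>\<^bsub>K\<^esub> \<one>\<^bsub>K\<^esub>" x] by (simp add: L.neg_smult M.neg_smult)

lemma psign: "x \<in> carrier L \<Longrightarrow> f (psign L r x) = psign M r (f x)"
  by (cases r) (auto simp: neg)

lemma hcomp: "x \<in> carrier L \<Longrightarrow> f (hcomp L p x) = hcomp M p (f x)"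
  using M.hcomp_eq[of "f (hcomp L p x)" p "f (hcomp L (p+1) x)"]
  by (simp add: gr flip: add) (simp add: L.hcomp_decomp)

lemma kernel_submodule: "submodule (a_kernel L M f) K L"
  by (rule L.submoduleI) (auto simp: a_kernel_def' add smult neg)

lemma image_submodule: "submodule (f ` carrier L) K M"
proof (rule M.submoduleI)
  show "\<zero>\<^bsub>M\<^esub> \<in> f ` carrier L" using zero L.M.zero_closed by (metis imageI)
next
  fix y assume "y \<in> f ` carrier L"
  then show "\<ominus>\<^bsub>M\<^esub> y \<in> f ` carrier L" by (metis (no_types, lifting) L.M.a_inv_closed imageE imageI neg)
next
  fix y z assume "y \<in> f ` carrier L" "z \<in> f ` carrier L"
  then show "y \<oplus>\<^bsub>M\<^esub> z \<in> f ` carrier L"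
    by (metis (no_types, lifting) L.M.a_closed imageE imageI add)
next
  fix c y assume "c \<in> carrier K" "y \<in> f ` carrier L"
  then show "c \<odot>\<^bsub>M\<^esub> y \<in> f ` carrier L"
    by (metis (no_types, lifting) L.smult_closed imageE imageI smult)
qed auto

lemma kernel_hcomp: "x \<in> a_kernel L M f \<Longrightarrow> hcomp L p x \<in> a_kernel L M f"
  using M.hcomp_same[of "\<zero>\<^bsub>M\<^esub>" p] by (auto simp: a_kernel_def' hcomp)

end

section \<open>Lie superalgebras\<close>

lemma superalgebraI:
  assumes "graded_module K L"
    and "\<And>x y. x \<in> carrier L \<Longrightarrow> y \<in> carrier L \<Longrightarrow> x \<otimes>\<^bsub>L\<^esub> y \<in> carrier L"
    and "\<And>x y z. x \<in> carrier L \<Longrightarrow> y \<in> carrier L \<Longrightarrow> z \<in> carrier L \<Longrightarrow>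
      (x \<oplus>\<^bsub>L\<^esub> y) \<otimes>\<^bsub>L\<^esub> z = x \<otimes>\<^bsub>L\<^esub> z \<oplus>\<^bsub>L\<^esub> y \<otimes>\<^bsub>L\<^esub> z"
    and "\<And>x y z. x \<in> carrier L \<Longrightarrow> y \<in> carrier L \<Longrightarrow> z \<in> carrier L \<Longrightarrow>
      x \<otimes>\<^bsub>L\<^esub> (y \<oplus>\<^bsub>L\<^esub> z) = x \<otimes>\<^bsub>L\<^esub> y \<oplus>\<^bsub>L\<^esub> x \<otimes>\<^bsub>L\<^esub> z"
    and "\<And>c x y. c \<in> carrier K \<Longrightarrow> x \<in> carrier L \<Longrightarrow> y \<in> carrier L \<Longrightarrow>
      (c \<odot>\<^bsub>L\<^esub> x) \<otimes>\<^bsub>L\<^esub> y = c \<odot>\<^bsub>L\<^esub> (x \<otimes>\<^bsub>L\<^esub> y)"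
    and "\<And>c x y. c \<in> carrier K \<Longrightarrow> x \<in> carrier L \<Longrightarrow> y \<in> carrier L \<Longrightarrow>
      x \<otimes>\<^bsub>L\<^esub> (c \<odot>\<^bsub>L\<^esub> y) = c \<odot>\<^bsub>L\<^esub> (x \<otimes>\<^bsub>L\<^esub> y)"
    and "\<And>x y p q. x \<in> gr L p \<Longrightarrow> y \<in> gr L q \<Longrightarrow> x \<otimes>\<^bsub>L\<^esub> y \<in> gr L (p + q)"
  shows "superalgebra K L"
  using assms by (intro superalgebra.intro superalgebra_axioms.intro)

lemma lie_superalgebraI:
  assumes "superalgebra K L"
    and "\<And>x y p q. x \<in> gr L p \<Longrightarrow> y \<in> gr L q \<Longrightarrow> x \<otimes>\<^bsub>L\<^esub> y = \<ominus>\<^bsub>L\<^esub> psign L (p * q) (y \<otimes>\<^bsub>L\<^esub> x)"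
    and "\<And>x. x \<in> gr L 0 \<Longrightarrow> x \<otimes>\<^bsub>L\<^esub> x = \<zero>\<^bsub>L\<^esub>"
    and "\<And>x y z p q r. x \<in> gr L p \<Longrightarrow> y \<in> gr L q \<Longrightarrow> z \<in> gr L r \<Longrightarrow>
      psign L (p * r) ((x \<otimes>\<^bsub>L\<^esub> y) \<otimes>\<^bsub>L\<^esub> z) \<oplus>\<^bsub>L\<^esub> psign L (p * q) ((y \<otimes>\<^bsub>L\<^esub> z) \<otimes>\<^bsub>L\<^esub> x)
        \<oplus>\<^bsub>L\<^esub> psign L (q * r) ((z \<otimes>\<^bsub>L\<^esub> x) \<otimes>\<^bsub>L\<^esub> y) = \<zero>\<^bsub>L\<^esub>"
  shows "lie_superalgebra K L"
  using assms by (intro lie_superalgebra.intro lie_superalgebra_axioms.intro)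

context lie_superalgebra
begin

text \<open>
  The Jacobi identity says that bracketing with \<open>x\<close> is a superderivation; only this form of it is
  used for calculations.
\<close>

lemma leibniz:
  assumes "x \<in> gr L p" "y \<in> gr L q" "z \<in> gr L r"
  shows "x \<otimes> (y \<otimes> z) = (x \<otimes> y) \<otimes> z \<oplus> psign L (p * q) (y \<otimes> (x \<otimes> z))"
proof -
  note c = assms[THEN gr_carrier]
  have *: "a = \<ominus> (b \<oplus> d)" if "b \<oplus> a \<oplus> d = \<zero>" "a \<in> carrier L" "b \<in> carrier L" "d \<in> carrier L" for a b d
    using that M.minus_equality[of a "b \<oplus> d"] by (simp add: M.a_ac)
  have 1: "x \<otimes> (y \<otimes> z) = \<ominus> psign L (p * (q + r)) ((y \<otimes> z) \<otimes> x)"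
    using assms mult_gr by (intro skew) auto
  have 2: "y \<otimes> (x \<otimes> z) = \<ominus> psign L (q * (p + r)) ((x \<otimes> z) \<otimes> y)"
    using assms mult_gr by (intro skew) auto
  have 3: "(z \<otimes> x) \<otimes> y = \<ominus> psign L (r * p) ((x \<otimes> z) \<otimes> y)"
    using c by (simp add: skew[OF assms(3,1)] mult_neg_left mult_psign_left mult_closed)
  define a b d where "a = (y \<otimes> z) \<otimes> x" and "b = (x \<otimes> y) \<otimes> z" and "d = (x \<otimes> z) \<otimes> y"
  have cl: "a \<in> carrier L" "b \<in> carrier L" "d \<in> carrier L"
    using c by (simp_all add: mult_closed a_def b_def d_def)
  have 4: "psign L (p * q) a = \<ominus> (psign L (p * r) b \<oplus> psign L (q * r) (\<ominus> psign L (r * p) d))"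
    using cl jacobi[OF assms] by (intro *) (simp_all add: 3 a_def b_def d_def)
  show ?thesis
    unfolding 1 2 b_def[symmetric] a_def[symmetric] d_def[symmetric] using 4 cl
    by (cases p; cases q; cases r) (simp_all add: M.minus_add)
qed

lemma leibniz':
  assumes "x \<in> gr L p" "y \<in> gr L q" "z \<in> gr L r"
  shows "(x \<otimes> y) \<otimes> z = x \<otimes> (y \<otimes> z) \<ominus> psign L (p * q) (y \<otimes> (x \<otimes> z))"
  using leibniz[OF assms] assms[THEN gr_carrier]
  by (simp add: a_minus_def mult_closed M.a_assoc M.r_neg)

text \<open>
  The elements that map \<open>V\<close> into \<open>U\<close> form a graded subalgebra. With \<open>U = V\<close> this is a normaliser
  and with \<open>U = {\<zero>}\<close> a centraliser.
\<close>

definition transporter :: "'a set \<Rightarrow> 'a set \<Rightarrow> 'a set"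
  where "transporter V U = {x \<in> carrier L. \<forall>v\<in>V. x \<otimes> v \<in> U}"

context
  fixes V U
  assumes V: "submodule V K L" "\<And>v p. v \<in> V \<Longrightarrow> hcomp L p v \<in> V"
    and U: "submodule U K L" "\<And>v p. v \<in> U \<Longrightarrow> hcomp L p v \<in> U"
    and UV: "U \<subseteq> V"
begin

private lemma VD: "v \<in> V \<Longrightarrow> v \<in> carrier L" "v \<in> U \<Longrightarrow> v \<in> carrier L"
  using submoduleE(1)[OF V(1)] submoduleE(1)[OF U(1)] by auto

lemma transporter_submodule: "submodule (transporter V U) K L"
  by (rule submoduleI)
    (auto simp: transporter_def mult_add_left mult_smult_left mult_neg_left VD submodule_zero[OF U(1)]
      intro: submoduleE(3-5)[OF U(1)])

lemma transporter_hcomp: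
  assumes "x \<in> transporter V U"
  shows "hcomp L p x \<in> transporter V U"
proof -
  have x: "x \<in> carrier L" using assms by (simp add: transporter_def)
  have hom: "hcomp L p x \<otimes> v \<in> U" if v: "v \<in> V" "v \<in> gr L q" for v q
  proof -
    have "x \<otimes> v = hcomp L p x \<otimes> v \<oplus> hcomp L (p+1) x \<otimes> v"
      using x v VD by (simp add: hcomp_decomp flip: mult_add_left)
    moreover have "hcomp L p x \<otimes> v \<in> gr L (p + q)" "hcomp L (p+1) x \<otimes> v \<in> gr L (p + q + 1)"
      using x v mult_gr[of "hcomp L (p+1) x" "p+1" v q] by (auto simp: mult_gr ac_simps)
    ultimately have "hcomp L (p + q) (x \<otimes> v) = hcomp L p x \<otimes> v" by (simp add: hcomp_eq)
    then show ?thesis using U(2)[of "x \<otimes> v" "p + q"] assms v by (simp add: transporter_def)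
  qed
  have "hcomp L p x \<otimes> v \<in> U" if v: "v \<in> V" for v
  proof -
    have "hcomp L p x \<otimes> v = hcomp L p x \<otimes> hcomp L 0 v \<oplus> hcomp L p x \<otimes> hcomp L 1 v"
      using x VD(1)[OF v] hcomp_decomp[of v 0] by (simp flip: mult_add_right)
    also have "\<dots> \<in> U"
      using hom[of "hcomp L 0 v" 0] hom[of "hcomp L 1 v" 1] V(2)[OF v] VD(1)[OF v]
      by (intro submoduleE(5)[OF U(1)]) auto
    finally show ?thesis .
  qed
  then show ?thesis using x by (simp add: transporter_def)
qed

lemma transporter_right:
  assumes "x \<in> transporter V U" "v \<in> V"
  shows "v \<otimes> x \<in> U"
proof -
  have hom: "hcomp L q v \<otimes> hcomp L p x \<in> U" for p q
    using skew[of "hcomp L q v" q "hcomp L p x" p] transporter_hcomp[OF assms(1), of p] V(2)[OF assms(2), of q]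
     assms VD(1)
    by (auto simp: transporter_def intro!: submoduleE(3)[OF U(1)] submodule_psign[OF U(1)])
  show ?thesis
    using assms VD by (intro mult_split[OF _ _ U(1) hom]) (auto simp: transporter_def)
qed

lemma transporter_mult:
  assumes "x \<in> transporter V U" "y \<in> transporter V U"
  shows "x \<otimes> y \<in> transporter V U"
proof -
  have x: "x \<in> carrier L" and y: "y \<in> carrier L" using assms by (auto simp: transporter_def)
  have hom: "(hcomp L p x \<otimes> hcomp L q y) \<otimes> hcomp L r v \<in> U" if v: "v \<in> V" for v p q r
  proof -
    have xp: "hcomp L p x \<otimes> u \<in> U" and yq: "hcomp L q y \<otimes> u \<in> U" if "u \<in> V" for u
      using that transporter_hcomp[OF assms(1)] transporter_hcomp[OF assms(2)] by (auto simp: transporter_def)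
    have "hcomp L p x \<otimes> (hcomp L q y \<otimes> hcomp L r v) \<in> U" "hcomp L q y \<otimes> (hcomp L p x \<otimes> hcomp L r v) \<in> U"
      using xp yq V(2)[OF v] UV by blast+
    then show ?thesis
      using x y VD(1)[OF v] leibniz'[of "hcomp L p x" p "hcomp L q y" q "hcomp L r v" r]
      by (simp add: a_minus_def submoduleE(3,5)[OF U(1)] submodule_psign[OF U(1)])
  qed
  have "hcomp L p x \<otimes> hcomp L q y \<in> transporter V U" for p q
  proof -
    let ?t = "hcomp L p x \<otimes> hcomp L q y"
    have t: "?t \<in> carrier L" using x y by (simp add: mult_closed)
    have "?t \<otimes> v \<in> U" if v: "v \<in> V" for v
    proof -
      have "?t \<otimes> v = ?t \<otimes> hcomp L 0 v \<oplus> ?t \<otimes> hcomp L 1 v"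
        using t VD(1)[OF v] hcomp_sum[of v] by (simp flip: mult_add_right)
      then show ?thesis using submoduleE(5)[OF U(1) hom[OF v] hom[OF v]] by simp
    qed
    then show ?thesis using t by (simp add: transporter_def)
  qed
  then show ?thesis by (rule mult_split[OF x y transporter_submodule])
qed

end

lemma zero_submodule: "submodule {\<zero>} K L"
  by (rule submoduleI) auto

lemma restrict_lie:
  fixes N
  assumes sub: "submodule N K L" and hc: "\<And>x p. x \<in> N \<Longrightarrow> hcomp L p x \<in> N"
    and mult: "\<And>x y. x \<in> N \<Longrightarrow> y \<in> N \<Longrightarrow> x \<otimes> y \<in> N"
    and K: "N = carrier R" "add R = add L" "zero R = zero L" "smult R = smult L"
     "monoid.mult R = monoid.mult L" "gr R = (\<lambda>p. gr L p \<inter> N)"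
  shows "lie_superalgebra K R"
proof -
  have NC: "x \<in> N \<Longrightarrow> x \<in> carrier L" for x using submoduleE(1)[OF sub] by auto
  interpret R: module K R
    by (rule module_cong[OF submodule.submodule_is_module[OF sub module_axioms]]) (simp_all add: K)
  have inv: "\<ominus>\<^bsub>R\<^esub> x = \<ominus> x" if "x \<in> N" for x
  proof (rule R.minus_equality)
    show "\<ominus> x \<oplus>\<^bsub>R\<^esub> x = \<zero>\<^bsub>R\<^esub>" using that NC by (simp add: K M.l_neg)
    show "x \<in> carrier R" using that K by simp
    show "\<ominus> x \<in> carrier R" using submoduleE(3)[OF sub that] K by simp
  qed
  have ps: "psign R r x = psign L r x" if "x \<in> N" for r x using that inv by (simp add: psign_def)
  have g: "graded_module K R"
  proof (rule graded_moduleI)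
    fix p show "submodule (gr R p) K R"
      using submoduleE[OF sub] submodule_zero[OF sub] inv
      by (intro R.submoduleI) (auto simp: K(2-6) K(1)[symmetric])
  next
    fix x assume "x \<in> carrier R"
    then have "x \<in> N" by (simp add: K)
    then show "\<exists>y\<in>gr R 0. \<exists>z\<in>gr R 1. x = y \<oplus>\<^bsub>R\<^esub> z"
      using hc[of x 0] hc[of x 1] NC[of x] hcomp_sum[of x] by (auto simp: K(2-6) intro!: bexI)
  next
    fix x assume "x \<in> gr R 0" "x \<in> gr R 1" then show "x = \<zero>\<^bsub>R\<^esub>"
      using gr_disjoint[of x 0] by (simp add: K)
  qed (rule R.module_axioms)
  show ?thesis
  proof (rule lie_superalgebraI)
    show "superalgebra K R"
      by (rule superalgebraI[OF g])
        (auto simp: K(2-6) K(1)[symmetric] mult mult_gr mult_add_left mult_add_right mult_smult_left mult_smult_right NC)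
  next
    fix x y p q assume "x \<in> gr R p" "y \<in> gr R q"
    then show "x \<otimes>\<^bsub>R\<^esub> y = \<ominus>\<^bsub>R\<^esub> psign R (p * q) (y \<otimes>\<^bsub>R\<^esub> x)"
      using mult[of x y] mult[of y x] skew[of x p y q] by (auto simp: K(2-6) ps inv submodule_psign[OF sub])
  next
    fix x assume "x \<in> gr R 0" then show "x \<otimes>\<^bsub>R\<^esub> x = \<zero>\<^bsub>R\<^esub>" by (simp add: K even_alt)
  next
    fix x y z p q r assume "x \<in> gr R p" "y \<in> gr R q" "z \<in> gr R r"
    then show "psign R (p * r) ((x \<otimes>\<^bsub>R\<^esub> y) \<otimes>\<^bsub>R\<^esub> z) \<oplus>\<^bsub>R\<^esub> psign R (p * q) ((y \<otimes>\<^bsub>R\<^esub> z) \<otimes>\<^bsub>R\<^esub> x)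
        \<oplus>\<^bsub>R\<^esub> psign R (q * r) ((z \<otimes>\<^bsub>R\<^esub> x) \<otimes>\<^bsub>R\<^esub> y) = \<zero>\<^bsub>R\<^esub>"
      using jacobi[of x p y q z r] by (simp add: K(2-6) ps mult)
  qed
qed

end

section \<open>Presented Lie superalgebras\<close>

lemma hom_lterm_wf: "hom_lterm K X d p t \<Longrightarrow> wf_lterm K X t"
  by (induction t arbitrary: p) auto

lemma hom_Brk: "hom_lterm K X d p s \<Longrightarrow> hom_lterm K X d q t \<Longrightarrow> hom_lterm K X d (p + q) (Brk s t)"
  by (cases p) (auto simp: add.commute add.assoc)

locale presentation =
  fixes K :: "('k, 'r) ring_scheme" and X :: "'x set" and d :: "'x \<Rightarrow> bit"
    and R :: "(('k, 'x) lterm \<times> ('k, 'x) lterm) set"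
  assumes K: "cring K"
    and R_hom: "(s, t) \<in> R \<Longrightarrow> \<exists>p. hom_lterm K X d p s \<and> hom_lterm K X d p t"
begin

interpretation K: cring K by (rule K)

abbreviation wf where "wf \<equiv> wf_lterm K X"
abbreviation hom where "hom \<equiv> hom_lterm K X d"
abbreviation cl where "cl \<equiv> lclass K X d R"
abbreviation cong where "cong \<equiv> lcong K X d R"
abbreviation Q where "Q \<equiv> presented K X d R"

lemma wf_Neg [simp]: "wf (Neg K t) = wf t" and hom_Neg [simp]: "hom p (Neg K t) = hom p t"
  by (auto simp: Neg_def)

lemma wf_Psign [simp]: "wf (Psign K r t) = wf t" and hom_Psign [simp]: "hom p (Psign K r t) = hom p t"
  by (auto simp: Psign_def)

lemma cl_eqI: "cong s t \<Longrightarrow> cl s = cl t"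
  unfolding lclass_def by (blast intro: lcong.trans lcong.sym)

lemma cl_eq_iff: "wf s \<Longrightarrow> cl s = cl t \<longleftrightarrow> cong s t"
  using cl_eqI lcong.refl unfolding lclass_def by (blast intro: lcong.sym)

lemma mem_cl: "s \<in> cl t \<longleftrightarrow> cong t s"
  by (simp add: lclass_def)

lemma carrier_Q: "carrier Q = cl ` Collect wf" and gr_Q: "gr Q p = cl ` Collect (hom p)"
  by (simp_all add: presented_def)

lemma zero_Q: "\<zero>\<^bsub>Q\<^esub> = cl Zer"
  by (simp add: presented_def)

lemma add_Q: "wf s \<Longrightarrow> wf t \<Longrightarrow> cl s \<oplus>\<^bsub>Q\<^esub> cl t = cl (Add s t)"
  and mult_Q: "wf s \<Longrightarrow> wf t \<Longrightarrow> cl s \<otimes>\<^bsub>Q\<^esub> cl t = cl (Brk s t)"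
proof -
  assume "wf s" "wf t"
  then have st: "s \<in> cl s" "t \<in> cl t" by (simp_all add: mem_cl lcong.refl)
  have const: "(\<Union>s'\<in>cl s. \<Union>t'\<in>cl t. h s' t') = h s t"
    if "\<And>s' t'. cong s s' \<Longrightarrow> cong t t' \<Longrightarrow> h s t = h s' t'" for h :: "_ \<Rightarrow> _ \<Rightarrow> ('k, 'x) lterm set"
  proof -
    have "(\<Union>s'\<in>cl s. \<Union>t'\<in>cl t. h s' t') = (\<Union>s'\<in>cl s. \<Union>t'\<in>cl t. h s t)"
      by (intro SUP_cong[OF HOL.refl] that[symmetric]) (auto simp: mem_cl)
    then show ?thesis using st by auto
  qed
  show "cl s \<oplus>\<^bsub>Q\<^esub> cl t = cl (Add s t)"
    unfolding presented_def by (simp, rule const, intro cl_eqI lcong.Add)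
  show "cl s \<otimes>\<^bsub>Q\<^esub> cl t = cl (Brk s t)"
    unfolding presented_def by (simp, rule const, intro cl_eqI lcong.Brk)
qed

lemma smult_Q:
  assumes "c \<in> carrier K" "wf t" shows "c \<odot>\<^bsub>Q\<^esub> cl t = cl (Smul c t)"
proof -
  have "t \<in> cl t" using assms by (simp add: mem_cl lcong.refl)
  moreover have "(\<Union>t'\<in>cl t. cl (Smul c t')) = (\<Union>t'\<in>cl t. cl (Smul c t))"
    using assms(1) by (intro SUP_cong[OF HOL.refl] cl_eqI lcong.Smul) (auto simp: mem_cl intro: lcong.sym)
  ultimately show ?thesis by (auto simp: presented_def simp del: UN_simps)
qed

lemmas ops_Q = zero_Q add_Q mult_Q smult_Q

lemma module_Q: "module K Q"
proof (rule moduleI[OF K])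
  show "abelian_group Q"
  proof (rule abelian_groupI)
    fix x assume "x \<in> carrier Q"
    then obtain t where "wf t" "x = cl t" by (auto simp: carrier_Q)
    then show "\<exists>y\<in>carrier Q. y \<oplus>\<^bsub>Q\<^esub> x = \<zero>\<^bsub>Q\<^esub>"
      by (intro bexI[of _ "cl (Neg K t)"]) (auto simp: carrier_Q ops_Q intro!: cl_eqI lcong.add_neg del: equalityI)
  qed (auto simp: carrier_Q ops_Q intro!: cl_eqI lcong.add_assoc lcong.add_comm lcong.add_zero imageI del: equalityI)
qed (auto simp: carrier_Q ops_Q intro!: cl_eqI lcong.smul_add_left lcong.smul_add_right
    lcong.smul_assoc lcong.smul_one imageI del: equalityI)

interpretation Q: module K Q by (rule module_Q)

lemma cl_closed: "wf t \<Longrightarrow> cl t \<in> carrier Q"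
  by (simp add: carrier_Q)

lemma cl_gr: "hom p t \<Longrightarrow> cl t \<in> gr Q p"
  by (simp add: gr_Q)

lemma mult_closed_Q: "x \<in> carrier Q \<Longrightarrow> y \<in> carrier Q \<Longrightarrow> x \<otimes>\<^bsub>Q\<^esub> y \<in> carrier Q"
  by (auto simp: carrier_Q mult_Q intro!: imageI)

lemma bilinear_Q:
  "x \<in> carrier Q \<Longrightarrow> y \<in> carrier Q \<Longrightarrow> z \<in> carrier Q \<Longrightarrow> (x \<oplus>\<^bsub>Q\<^esub> y) \<otimes>\<^bsub>Q\<^esub> z = x \<otimes>\<^bsub>Q\<^esub> z \<oplus>\<^bsub>Q\<^esub> y \<otimes>\<^bsub>Q\<^esub> z"
  "x \<in> carrier Q \<Longrightarrow> y \<in> carrier Q \<Longrightarrow> z \<in> carrier Q \<Longrightarrow> x \<otimes>\<^bsub>Q\<^esub> (y \<oplus>\<^bsub>Q\<^esub> z) = x \<otimes>\<^bsub>Q\<^esub> y \<oplus>\<^bsub>Q\<^esub> x \<otimes>\<^bsub>Q\<^esub> z"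
  "c \<in> carrier K \<Longrightarrow> x \<in> carrier Q \<Longrightarrow> y \<in> carrier Q \<Longrightarrow> (c \<odot>\<^bsub>Q\<^esub> x) \<otimes>\<^bsub>Q\<^esub> y = c \<odot>\<^bsub>Q\<^esub> (x \<otimes>\<^bsub>Q\<^esub> y)"
  "c \<in> carrier K \<Longrightarrow> x \<in> carrier Q \<Longrightarrow> y \<in> carrier Q \<Longrightarrow> x \<otimes>\<^bsub>Q\<^esub> (c \<odot>\<^bsub>Q\<^esub> y) = c \<odot>\<^bsub>Q\<^esub> (x \<otimes>\<^bsub>Q\<^esub> y)"
  by (auto simp: carrier_Q ops_Q intro!: cl_eqI lcong.brk_add_left lcong.brk_add_right
      lcong.brk_smul_left lcong.brk_smul_right del: equalityI)

lemma zero_mult_Q: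
  assumes "x \<in> carrier Q" shows "\<zero>\<^bsub>Q\<^esub> \<otimes>\<^bsub>Q\<^esub> x = \<zero>\<^bsub>Q\<^esub>" "x \<otimes>\<^bsub>Q\<^esub> \<zero>\<^bsub>Q\<^esub> = \<zero>\<^bsub>Q\<^esub>"
  using bilinear_Q(3)[of "\<zero>\<^bsub>K\<^esub>" "\<zero>\<^bsub>Q\<^esub>" x] bilinear_Q(4)[of "\<zero>\<^bsub>K\<^esub>" x "\<zero>\<^bsub>Q\<^esub>"] assms
  by (simp_all add: mult_closed_Q)

lemma neg_Q: "wf t \<Longrightarrow> cl (Neg K t) = \<ominus>\<^bsub>Q\<^esub> cl t"
  using Q.smult_l_minus[of "\<one>\<^bsub>K\<^esub>" "cl t"] by (simp add: Neg_def smult_Q[symmetric] cl_closed)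

text \<open>
  The homogeneous component of degree \<open>p\<close> of the class of a term, computed from the term. That it
  only depends on the class is what makes the sum of the two homogeneous parts direct.
\<close>

primrec cmp :: "bit \<Rightarrow> ('k, 'x) lterm \<Rightarrow> ('k, 'x) lterm set" where
  "cmp p (Gen x) = (if d x = p then cl (Gen x) else \<zero>\<^bsub>Q\<^esub>)"
| "cmp p Zer = \<zero>\<^bsub>Q\<^esub>"
| "cmp p (Add s t) = cmp p s \<oplus>\<^bsub>Q\<^esub> cmp p t"
| "cmp p (Smul c t) = c \<odot>\<^bsub>Q\<^esub> cmp p t"
| "cmp p (Brk s t) =
    (if p = 0 then cmp 0 s \<otimes>\<^bsub>Q\<^esub> cmp 0 t \<oplus>\<^bsub>Q\<^esub> cmp 1 s \<otimes>\<^bsub>Q\<^esub> cmp 1 t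
     else cmp 0 s \<otimes>\<^bsub>Q\<^esub> cmp 1 t \<oplus>\<^bsub>Q\<^esub> cmp 1 s \<otimes>\<^bsub>Q\<^esub> cmp 0 t)"

lemma gr_Q_add: "x \<in> gr Q p \<Longrightarrow> y \<in> gr Q p \<Longrightarrow> x \<oplus>\<^bsub>Q\<^esub> y \<in> gr Q p"
  by (auto simp: gr_Q add_Q hom_lterm_wf intro!: imageI)

lemma gr_Q_smult: "c \<in> carrier K \<Longrightarrow> x \<in> gr Q p \<Longrightarrow> c \<odot>\<^bsub>Q\<^esub> x \<in> gr Q p"
  by (auto simp: gr_Q smult_Q hom_lterm_wf intro!: imageI)

lemma gr_Q_mult: "x \<in> gr Q p \<Longrightarrow> y \<in> gr Q q \<Longrightarrow> x \<otimes>\<^bsub>Q\<^esub> y \<in> gr Q (p + q)"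
  by (auto simp: gr_Q mult_Q hom_lterm_wf simp del: hom_lterm.simps intro!: imageI hom_Brk)

lemma gr_Q_zero: "\<zero>\<^bsub>Q\<^esub> \<in> gr Q p"
  by (auto simp: gr_Q zero_Q intro!: imageI)

lemma gr_Q_carrier: "x \<in> gr Q p \<Longrightarrow> x \<in> carrier Q"
  by (auto simp: gr_Q carrier_Q hom_lterm_wf)

lemma cmp_gr: "wf t \<Longrightarrow> cmp p t \<in> gr Q p"
proof (induction t arbitrary: p)
  case (Brk s t)
  then show ?case
    using gr_Q_mult[of "cmp 0 s" 0 "cmp 0 t" 0] gr_Q_mult[of "cmp 1 s" 1 "cmp 1 t" 1]
      gr_Q_mult[of "cmp 0 s" 0 "cmp 1 t" 1] gr_Q_mult[of "cmp 1 s" 1 "cmp 0 t" 0]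
    by (cases p) (auto simp: gr_Q_add)
qed (auto simp: gr_Q_add gr_Q_smult gr_Q_zero cl_gr)

lemma cmp_closed: "wf t \<Longrightarrow> cmp p t \<in> carrier Q"
  using cmp_gr gr_Q_carrier by blast

lemma cmp_sum: "wf t \<Longrightarrow> cl t = cmp 0 t \<oplus>\<^bsub>Q\<^esub> cmp 1 t"
proof (induction t)
  case (Gen x)
  then show ?case by (cases "d x") (auto simp: cl_closed)
next
  case (Brk s t)
  have "cl (Brk s t) = (cmp 0 s \<oplus>\<^bsub>Q\<^esub> cmp 1 s) \<otimes>\<^bsub>Q\<^esub> (cmp 0 t \<oplus>\<^bsub>Q\<^esub> cmp 1 t)"
    using Brk by (simp add: mult_Q[symmetric])
  then show ?case using Brk.prems
    by (simp add: bilinear_Q cmp_closed mult_closed_Q Q.M.a_ac)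
qed (auto simp: ops_Q[symmetric] cmp_closed Q.M.a_ac Q.smult_r_distr)

lemma cmp_hom: "hom p t \<Longrightarrow> cmp q t = (if q = p then cl t else \<zero>\<^bsub>Q\<^esub>)"
proof (induction t arbitrary: p q)
  case (Brk s t)
  then consider "hom 0 s" "hom p t" | "hom 1 s" "hom (p + 1) t" by auto
  then show ?case
  proof cases
    case 1
    then have "wf s" "wf t" by (auto dest: hom_lterm_wf)
    with 1 Brk.IH(1)[of 0] Brk.IH(2)[of p] show ?thesis
      by (cases p; cases q) (auto simp: mult_Q zero_mult_Q cl_closed mult_closed_Q)
  next
    case 2
    then have "wf s" "wf t" by (auto dest: hom_lterm_wf)
    with 2 Brk.IH(1)[of 1] Brk.IH(2)[of "p + 1"] show ?thesis
      by (cases p; cases q) (auto simp: mult_Q zero_mult_Q cl_closed mult_closed_Q)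
  qed
qed (auto simp: zero_Q[symmetric] add_Q smult_Q hom_lterm_wf)

text \<open>
  The axioms that are only imposed on homogeneous terms, and the relations, have both sides of the
  same degree, so that \<open>cmp_hom\<close> applies to them; all other axioms are compatible with the
  formation of components by bilinearity.
\<close>

lemma cmp_cong: "cong s t \<Longrightarrow> cmp p s = cmp p t"
proof (induction arbitrary: p rule: lcong.induct)
  case (rel s t)
  then obtain q where q: "hom q s" "hom q t" using R_hom by blast
  have "cl s = cl t" using rel by (intro cl_eqI lcong.rel)
  then show ?case using q by (simp add: cmp_hom)
next
  case (brk_skew q s r t)
  have h: "hom (q + r) (Brk s t)" "hom (q + r) (Neg K (Psign K (q * r) (Brk t s)))"
    using hom_Brk[OF brk_skew] hom_Brk[OF brk_skew(2,1)] by (simp_all add: add.commute del: hom_lterm.simps)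
  show ?case using cl_eqI[OF lcong.brk_skew[OF brk_skew]]
    unfolding cmp_hom[OF h(1)] cmp_hom[OF h(2)] by simp
next
  case (brk_even t)
  have h: "hom 0 (Brk t t)" "hom 0 Zer" using brk_even by auto
  show ?case using cl_eqI[OF lcong.brk_even[OF brk_even]]
    unfolding cmp_hom[OF h(1)] cmp_hom[OF h(2)] by simp
next
  case (brk_jacobi a s b t c u)
  note J = brk_jacobi
  let ?J = "Add (Add (Psign K (a * c) (Brk (Brk s t) u)) (Psign K (a * b) (Brk (Brk t u) s)))
           (Psign K (b * c) (Brk (Brk u s) t))"
  have h: "hom (a + b + c) ?J" "hom (a + b + c) Zer"
    using hom_Brk[OF hom_Brk[OF J(1,2)] J(3)] hom_Brk[OF hom_Brk[OF J(2,3)] J(1)]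
      hom_Brk[OF hom_Brk[OF J(3,1)] J(2)] by (simp_all add: ac_simps del: hom_lterm.simps(5))
  show ?case using cl_eqI[OF lcong.brk_jacobi[OF J]]
    unfolding cmp_hom[OF h(1)] cmp_hom[OF h(2)] by simp
qed (auto simp: cmp_closed mult_closed_Q bilinear_Q Q.M.a_ac Neg_def Q.smult_l_minus Q.M.r_neg
    Q.smult_l_distr Q.smult_r_distr Q.smult_assoc1)

lemma graded_module_Q: "graded_module K Q"
proof (rule graded_moduleI[OF module_Q])
  fix p
  show "submodule (gr Q p) K Q"
  proof (rule Q.submoduleI)
    fix a assume "a \<in> gr Q p"
    then show "\<ominus>\<^bsub>Q\<^esub> a \<in> gr Q p"
      by (auto simp: gr_Q neg_Q[symmetric] hom_lterm_wf intro!: imageI)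
  qed (auto simp: gr_Q_zero gr_Q_add gr_Q_smult gr_Q_carrier)
next
  fix x assume "x \<in> carrier Q"
  then obtain t where "wf t" "x = cl t" by (auto simp: carrier_Q)
  then show "\<exists>y\<in>gr Q 0. \<exists>z\<in>gr Q 1. x = y \<oplus>\<^bsub>Q\<^esub> z"
    using cmp_sum cmp_gr by blast
next
  fix x assume "x \<in> gr Q 0" "x \<in> gr Q 1"
  then obtain s t where st: "hom 0 s" "hom 1 t" "x = cl s" "x = cl t" by (auto simp: gr_Q)
  then have "cong s t" using cl_eq_iff[of s t] by (auto dest: hom_lterm_wf)
  then have "cmp 0 s = cmp 0 t" by (rule cmp_cong)
  then show "x = \<zero>\<^bsub>Q\<^esub>" using st by (simp add: cmp_hom)
qed

interpretation Q: graded_module K Q by (rule graded_module_Q)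

lemma psign_Q: "wf t \<Longrightarrow> psign Q r (cl t) = cl (Psign K r t)"
  by (simp add: psign_def Psign_def neg_Q)

lemma lie_superalgebra_Q: "lie_superalgebra K Q"
proof (rule lie_superalgebraI)
  show "superalgebra K Q"
    by (rule superalgebraI[OF graded_module_Q]) (auto simp: mult_closed_Q bilinear_Q gr_Q_mult)
next
  fix x y p q assume "x \<in> gr Q p" "y \<in> gr Q q"
  then show "x \<otimes>\<^bsub>Q\<^esub> y = \<ominus>\<^bsub>Q\<^esub> psign Q (p * q) (y \<otimes>\<^bsub>Q\<^esub> x)"
    by (auto simp: gr_Q mult_Q hom_lterm_wf psign_Q neg_Q[symmetric] intro!: cl_eqI lcong.brk_skew del: equalityI)
next
  fix x assume "x \<in> gr Q 0" then show "x \<otimes>\<^bsub>Q\<^esub> x = \<zero>\<^bsub>Q\<^esub>"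
    by (auto simp: gr_Q ops_Q hom_lterm_wf intro!: cl_eqI lcong.brk_even del: equalityI)
next
  fix x y z p q r assume "x \<in> gr Q p" "y \<in> gr Q q" "z \<in> gr Q r"
  then show "psign Q (p * r) ((x \<otimes>\<^bsub>Q\<^esub> y) \<otimes>\<^bsub>Q\<^esub> z) \<oplus>\<^bsub>Q\<^esub> psign Q (p * q) ((y \<otimes>\<^bsub>Q\<^esub> z) \<otimes>\<^bsub>Q\<^esub> x)
        \<oplus>\<^bsub>Q\<^esub> psign Q (q * r) ((z \<otimes>\<^bsub>Q\<^esub> x) \<otimes>\<^bsub>Q\<^esub> y) = \<zero>\<^bsub>Q\<^esub>"
    by (auto simp: gr_Q ops_Q hom_lterm_wf psign_Q intro!: cl_eqI lcong.brk_jacobi del: equalityI)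
qed

lemma Q_induct [consumes 1, case_names Gen zero add smult mult]:
  assumes "x \<in> carrier Q"
    and "\<And>y. y \<in> X \<Longrightarrow> P (cl (Gen y))"
    and "P \<zero>\<^bsub>Q\<^esub>"
    and "\<And>x y. x \<in> carrier Q \<Longrightarrow> y \<in> carrier Q \<Longrightarrow> P x \<Longrightarrow> P y \<Longrightarrow> P (x \<oplus>\<^bsub>Q\<^esub> y)"
    and "\<And>c x. c \<in> carrier K \<Longrightarrow> x \<in> carrier Q \<Longrightarrow> P x \<Longrightarrow> P (c \<odot>\<^bsub>Q\<^esub> x)"
    and "\<And>x y. x \<in> carrier Q \<Longrightarrow> y \<in> carrier Q \<Longrightarrow> P x \<Longrightarrow> P y \<Longrightarrow> P (x \<otimes>\<^bsub>Q\<^esub> y)"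
  shows "P x"
proof -
  have "wf t \<Longrightarrow> P (cl t)" for t
    by (induction t) (auto simp: ops_Q[symmetric] cl_closed intro: assms(2-6))
  with assms(1) show ?thesis by (auto simp: carrier_Q)
qed

primrec ev :: "('k, 'm) superalgebra \<Rightarrow> ('x \<Rightarrow> 'm) \<Rightarrow> ('k, 'x) lterm \<Rightarrow> 'm" where
  "ev M g (Gen x) = g x"
| "ev M g Zer = \<zero>\<^bsub>M\<^esub>"
| "ev M g (Add s t) = ev M g s \<oplus>\<^bsub>M\<^esub> ev M g t"
| "ev M g (Smul c t) = c \<odot>\<^bsub>M\<^esub> ev M g t"
| "ev M g (Brk s t) = ev M g s \<otimes>\<^bsub>M\<^esub> ev M g t"

text \<open>
  The evaluation of terms in \<open>M\<close> is constant on congruence classes, since every clause of the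
  congruence holds in \<open>M\<close>. This is the universal property of the presentation.
\<close>

lemma presented_hom:
  fixes M :: "('k, 'm) superalgebra"
  assumes "lie_superalgebra K M"
    and g: "\<And>x. x \<in> X \<Longrightarrow> g x \<in> gr M (d x)"
    and rel: "\<And>s t. (s, t) \<in> R \<Longrightarrow> ev M g s = ev M g t"
  obtains f where "f \<in> lie_hom K Q M" "\<And>x. x \<in> X \<Longrightarrow> f (cl (Gen x)) = g x"
proof -
  interpret M: lie_superalgebra K M by fact
  let ?e = "ev M g"
  have e_gr: "hom p t \<Longrightarrow> ?e t \<in> gr M p" for p t
  proof (induction t arbitrary: p)
    case (Brk s t)
    then show ?case using M.mult_gr[of "?e s" 0 "?e t" p] M.mult_gr[of "?e s" 1 "?e t" "p + 1"]
      by (auto simp: add.commute add.assoc)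
  qed (auto simp: g)
  have e_wf: "wf t \<Longrightarrow> ?e t \<in> carrier M" for t
    by (induction t) (auto simp: M.mult_closed M.gr_carrier[OF g])
  have e_neg: "wf t \<Longrightarrow> ?e (Neg K t) = \<ominus>\<^bsub>M\<^esub> ?e t" for t
    by (simp add: Neg_def M.neg_smult e_wf)
  have e_psign: "wf t \<Longrightarrow> ?e (Psign K r t) = psign M r (?e t)" for r t
    by (simp add: Psign_def psign_def e_neg)
  have e_cong: "cong s t \<Longrightarrow> ?e s = ?e t" for s t
  proof (induction rule: lcong.induct)
    case (brk_skew p s q t)
    then show ?case
      using M.skew[OF e_gr e_gr, OF brk_skew] by (simp add: e_neg e_psign hom_lterm_wf)
  next
    case (brk_even t)
    then show ?case using M.even_alt e_gr by simp
  next
    case (brk_jacobi p s q t r u)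
    then show ?case
      using M.jacobi[OF e_gr e_gr e_gr, OF brk_jacobi] by (simp add: e_psign hom_lterm_wf)
  qed (auto simp: rel e_wf e_neg M.mult_closed M.mult_add_left M.mult_add_right M.mult_smult_left
      M.mult_smult_right M.M.a_ac M.M.r_neg M.smult_l_distr M.smult_r_distr M.smult_assoc1)
  define f where "f c = ?e (SOME t. wf t \<and> c = cl t)" for c
  have f: "f (cl t) = ?e t" if "wf t" for t
  proof -
    have "wf (SOME t'. wf t' \<and> cl t = cl t') \<and> cl t = cl (SOME t'. wf t' \<and> cl t = cl t')"
      by (rule someI[of _ t]) (simp add: that)
    then show ?thesis unfolding f_def using that cl_eq_iff e_cong by metis
  qed
  show thesis
  proof (rule that[of f])
    show "f \<in> lie_hom K Q M"
      by (intro lie_homI graded_homI) (auto simp: carrier_Q gr_Q ops_Q f e_wf e_gr hom_lterm_wf)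
  qed (simp add: f)
qed

end

lemma (in presentation) presented_hom_unique:
  assumes "lie_superalgebra K M" "f \<in> lie_hom K Q M" "g \<in> lie_hom K Q M"
    and "\<And>y. y \<in> X \<Longrightarrow> f (cl (Gen y)) = g (cl (Gen y))" and "x \<in> carrier Q"
  shows "f x = g x"
proof -
  interpret M: lie_superalgebra K M by fact
  interpret Q: lie_superalgebra K Q by (rule lie_superalgebra_Q)
  interpret f: graded_map K Q M f
    using lie_homD(1)[OF assms(2)] by unfold_locales
  interpret g: graded_map K Q M g
    using lie_homD(1)[OF assms(3)] by unfold_locales
  from \<open>x \<in> carrier Q\<close> show ?thesis
    by (induction rule: Q_induct)
      (simp_all add: assms(4) f.add g.add f.smult g.smult lie_homD(2)[OF assms(2)] lie_homD(2)[OF assms(3)])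
qed

section \<open>Supercommutators and matrices\<close>

locale coefficient_superalgebra = assoc_superalgebra K A
  for K :: "('k, 'r) ring_scheme" and A :: "('k, 'a) superalgebra" (structure)
begin

lemma super_commutator_eq:
  assumes "x \<in> carrier A" "y \<in> carrier A"
  defines "t \<equiv> \<lambda>p q. hcomp A p x \<otimes> hcomp A q y \<ominus> psign A (p * q) (hcomp A q y \<otimes> hcomp A p x)"
  shows "super_commutator A x y = (t 0 0 \<oplus> t 0 1) \<oplus> (t 1 0 \<oplus> t 1 1)"
proof -
  have [simp]: "t p q \<in> carrier A" for p q using assms(1,2) by (simp add: t_def)
  have "super_commutator A x y = (\<Oplus>p\<in>{0,1}. \<Oplus>q\<in>{0,1}. t p q)"
    by (simp add: super_commutator_def t_def)
  also have "\<dots> = (t 0 0 \<oplus> t 0 1) \<oplus> (t 1 0 \<oplus> t 1 1)"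
    by (simp add: Pi_def a_ac)
  finally show ?thesis .
qed

lemma super_commutator_hom:
  assumes "x \<in> gr A p" "y \<in> gr A q"
  shows "super_commutator A x y = x \<otimes> y \<ominus> psign A (p * q) (y \<otimes> x)"
proof -
  note c = assms[THEN gr_carrier]
  have z: "u \<in> gr A r \<Longrightarrow> r = 0 \<Longrightarrow> hcomp A 1 u = \<zero>" "u \<in> gr A r \<Longrightarrow> r = 1 \<Longrightarrow> hcomp A 0 u = \<zero>" for u r
    by (auto intro: hcomp_other)
  show ?thesis
    unfolding super_commutator_eq[OF c] using assms c z[OF assms(1)] z[OF assms(2)]
    by (cases p; cases q) (simp_all add: a_minus_def)
qed

lemma super_commutator_closed: "x \<in> carrier A \<Longrightarrow> y \<in> carrier A \<Longrightarrow> super_commutator A x y \<in> carrier A"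
  by (simp add: super_commutator_eq)

lemma psign_add: "x \<in> carrier A \<Longrightarrow> y \<in> carrier A \<Longrightarrow> psign A r (x \<oplus> y) = psign A r x \<oplus> psign A r y"
  by (cases r) (simp_all add: minus_add)

lemma psign_smult: "c \<in> carrier K \<Longrightarrow> x \<in> carrier A \<Longrightarrow> psign A r (c \<odot> x) = c \<odot> psign A r x"
  by (cases r) (simp_all add: smult_r_minus)

lemma super_commutator_add:
  assumes "x \<in> carrier A" "y \<in> carrier A" "z \<in> carrier A"
  shows "super_commutator A (x \<oplus> y) z = super_commutator A x z \<oplus> super_commutator A y z"
    and "super_commutator A z (x \<oplus> y) = super_commutator A z x \<oplus> super_commutator A z y"
  using assms
  by (simp_all add: super_commutator_eq hcomp_add l_distr r_distr psign_add a_minus_def minus_add a_ac)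

lemma smult_minus: "\<lbrakk>c \<in> carrier K; x \<in> carrier A; y \<in> carrier A\<rbrakk> \<Longrightarrow> c \<odot> (x \<ominus> y) = c \<odot> x \<ominus> c \<odot> y"
  by (simp add: a_minus_def smult_r_distr smult_r_minus)

lemma super_commutator_smult:
  assumes "c \<in> carrier K" "y \<in> carrier A" "z \<in> carrier A"
  shows "super_commutator A (c \<odot> y) z = c \<odot> super_commutator A y z"
    and "super_commutator A z (c \<odot> y) = c \<odot> super_commutator A z y"
  using assms
  by (simp_all add: super_commutator_eq hcomp_smult mult_smult_left mult_smult_right psign_smult
      smult_minus smult_r_distr smult_r_minus)

lemma super_commutator_gr:
  "x \<in> gr A p \<Longrightarrow> y \<in> gr A q \<Longrightarrow> super_commutator A x y \<in> gr A (p + q)"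
  using mult_gr[of x p y q] mult_gr[of y q x p] by (simp add: super_commutator_hom add.commute)

text \<open>
  For homogeneous elements the Jacobi sum is a signed sum of twelve products of three factors,
  which cancel in pairs by associativity.
\<close>

lemma super_commutator_lie:
  assumes L: "carrier L = carrier A" "add L = add A" "zero L = zero A" "smult L = smult A"
    "gr L = gr A" "monoid.mult L = super_commutator A"
  shows "lie_superalgebra K L"
proof -
  have inv: "a_inv L = a_inv A" using L by (intro a_inv_cong)
  have ps: "psign L = psign A" by (intro ext) (simp only: psign_def inv)
  have "graded_module K L" using L by (intro graded_module_cong[OF graded_module_axioms])
  then have "superalgebra K L"
    by (rule superalgebraI)
      (simp_all add: L super_commutator_closed super_commutator_add super_commutator_smult super_commutator_gr)
  then show ?thesis
  proof (rule lie_superalgebraI, unfold L inv ps)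
    fix x y p q assume *: "x \<in> gr A p" "y \<in> gr A q"
    then show "super_commutator A x y = \<ominus> psign A (p * q) (super_commutator A y x)"
      using *[THEN gr_carrier]
      by (cases p; cases q) (simp_all add: super_commutator_hom a_minus_def minus_add a_comm)
  next
    fix x assume "x \<in> gr A 0"
    then show "super_commutator A x x = \<zero>"
      using gr_carrier by (simp add: super_commutator_hom a_minus_def r_neg)
  next
    fix x y z p q r assume *: "x \<in> gr A p" "y \<in> gr A q" "z \<in> gr A r"
    note c = *[THEN gr_carrier]
    have "super_commutator A (super_commutator A x y) z
      = (x \<otimes> y \<ominus> psign A (p * q) (y \<otimes> x)) \<otimes> z \<ominus> psign A ((p + q) * r) (z \<otimes> (x \<otimes> y \<ominus> psign A (p * q) (y \<otimes> x)))"
      "super_commutator A (super_commutator A y z) x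
      = (y \<otimes> z \<ominus> psign A (q * r) (z \<otimes> y)) \<otimes> x \<ominus> psign A ((q + r) * p) (x \<otimes> (y \<otimes> z \<ominus> psign A (q * r) (z \<otimes> y)))"
      "super_commutator A (super_commutator A z x) y
      = (z \<otimes> x \<ominus> psign A (r * p) (x \<otimes> z)) \<otimes> y \<ominus> psign A ((r + p) * q) (y \<otimes> (z \<otimes> x \<ominus> psign A (r * p) (x \<otimes> z)))"
      unfolding super_commutator_hom[OF super_commutator_gr[OF *(1,2)] *(3)]
          super_commutator_hom[OF super_commutator_gr[OF *(2,3)] *(1)]
          super_commutator_hom[OF super_commutator_gr[OF *(3,1)] *(2)]
      by (simp_all only: super_commutator_hom[OF *(1,2)] super_commutator_hom[OF *(2,3)]
          super_commutator_hom[OF *(3,1)])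
    note J = this
    define a b d e f g where "a = x \<otimes> (y \<otimes> z)" "b = y \<otimes> (x \<otimes> z)" "d = z \<otimes> (x \<otimes> y)"
      "e = z \<otimes> (y \<otimes> x)" "f = y \<otimes> (z \<otimes> x)" "g = x \<otimes> (z \<otimes> y)"
    note defs = this
    have cl: "a \<in> carrier A" "b \<in> carrier A" "d \<in> carrier A" "e \<in> carrier A" "f \<in> carrier A" "g \<in> carrier A"
      using c by (simp_all add: defs)
    have J': "super_commutator A (super_commutator A x y) z
      = (a \<ominus> psign A (p * q) b) \<ominus> psign A ((p + q) * r) (d \<ominus> psign A (p * q) e)"
     "super_commutator A (super_commutator A y z) x
      = (f \<ominus> psign A (q * r) e) \<ominus> psign A ((q + r) * p) (a \<ominus> psign A (q * r) g)"
     "super_commutator A (super_commutator A z x) y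
      = (d \<ominus> psign A (r * p) g) \<ominus> psign A ((r + p) * q) (f \<ominus> psign A (r * p) b)"
      unfolding J using c
      by (simp_all add: a_minus_def l_distr r_distr l_minus r_minus mult_psign_left mult_psign_right m_assoc defs)
    have canc: "u \<oplus> (v \<oplus> \<ominus> u) = v" if "u \<in> carrier A" "v \<in> carrier A" for u v
      using that by (simp add: a_comm[of v] r_neg2)
    show "psign A (p * r) (super_commutator A (super_commutator A x y) z)
      \<oplus> psign A (p * q) (super_commutator A (super_commutator A y z) x)
      \<oplus> psign A (q * r) (super_commutator A (super_commutator A z x) y) = \<zero>"
      unfolding J' using cl
      by (cases p; cases q; cases r; simp add: a_minus_def minus_add a_ac r_neg1 r_neg2 canc;
          simp add: minus_add[symmetric] a_assoc[symmetric] r_neg)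
  qed
qed

abbreviation (input) "Mat \<equiv> mat_superalgebra A"

lemma mat_simps [simp]:
  "carrier Mat = {x. \<forall>i j. x i j \<in> carrier A}" "\<zero>\<^bsub>Mat\<^esub> = (\<lambda>i j. \<zero>)"
  "x \<oplus>\<^bsub>Mat\<^esub> y = (\<lambda>i j. x i j \<oplus> y i j)" "c \<odot>\<^bsub>Mat\<^esub> x = (\<lambda>i j. c \<odot> x i j)"
  "gr Mat p = {x. \<forall>i j. x i j \<in> gr A (p + par i + par j)}"
  "\<one>\<^bsub>Mat\<^esub> = (\<lambda>i j. if i = j then \<one> else \<zero>)"
  by (simp_all add: mat_superalgebra_def)

lemma mat_mult:
  assumes "\<And>k. x i k \<in> carrier A" "\<And>k. y k j \<in> carrier A"
  shows "(x \<otimes>\<^bsub>Mat\<^esub> y) i j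
    = x i I1 \<otimes> y I1 j \<oplus> (x i I2 \<otimes> y I2 j \<oplus> (x i I3 \<otimes> y I3 j \<oplus> x i I4 \<otimes> y I4 j))"
  using assms by (simp add: mat_superalgebra_def UNIV_index)

lemma mat_module: "module K Mat"
proof (rule moduleI[OF R.is_cring])
  show "abelian_group Mat"
  proof (rule abelian_groupI)
    fix x assume "x \<in> carrier Mat"
    then show "\<exists>y\<in>carrier Mat. y \<oplus>\<^bsub>Mat\<^esub> x = \<zero>\<^bsub>Mat\<^esub>"
      by (intro bexI[of _ "\<lambda>i j. \<ominus> x i j"]) (simp_all add: l_neg)
  qed (auto simp: a_ac)
qed (auto simp: smult_l_distr smult_r_distr smult_assoc1)

lemma mat_neg: assumes "x \<in> carrier Mat" shows "\<ominus>\<^bsub>Mat\<^esub> x = (\<lambda>i j. \<ominus> x i j)"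
proof -
  interpret Mat: module K Mat by (rule mat_module)
  show ?thesis using assms by (intro Mat.minus_equality) (simp_all add: l_neg)
qed

lemma mat_graded: "graded_module K Mat"
proof -
  interpret Mat: module K Mat by (rule mat_module)
  show ?thesis
  proof (rule graded_moduleI[OF mat_module])
    fix p
    have sub: "x \<in> gr Mat p \<Longrightarrow> x \<in> carrier Mat" for x using gr_carrier by auto
    show "submodule (gr Mat p) K Mat"
    proof (rule Mat.submoduleI)
      show "gr Mat p \<subseteq> carrier Mat" using sub by blast
    next
      fix a assume "a \<in> gr Mat p"
      with mat_neg[OF sub] show "\<ominus>\<^bsub>Mat\<^esub> a \<in> gr Mat p" by simp
    qed auto
  next
    fix x assume "x \<in> carrier Mat"
    then show "\<exists>y\<in>gr Mat 0. \<exists>z\<in>gr Mat 1. x = y \<oplus>\<^bsub>Mat\<^esub> z"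
    proof (intro bexI)
      show "x = (\<lambda>i j. hcomp A (par i + par j) (x i j)) \<oplus>\<^bsub>Mat\<^esub> (\<lambda>i j. hcomp A (par i + par j + 1) (x i j))"
        using \<open>x \<in> carrier Mat\<close> by (simp add: fun_eq_iff hcomp_decomp)
    qed (simp_all add: ac_simps)
  next
    fix x assume "x \<in> gr Mat 0" "x \<in> gr Mat 1"
    then have "x i j = \<zero>" for i j
      using gr_disjoint[of "x i j" "par i + par j"] by (simp add: add.commute add.left_commute)
    then show "x = \<zero>\<^bsub>Mat\<^esub>" by (simp add: fun_eq_iff)
  qed
qed

text \<open>
  Write \<open>1 = e + f\<close> with \<open>e\<close> even and \<open>f\<close> odd. If \<open>x\<close> is homogeneous, then \<open>xf = x - xe\<close> has two
  different degrees, so \<open>x = xe\<close>; hence \<open>e\<close> is a right unit and equals \<open>1\<close>.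
\<close>

lemma one_even: "\<one> \<in> gr A 0"
proof -
  obtain e f where ef: "e \<in> gr A 0" "f \<in> gr A 1" "\<one> = e \<oplus> f"
    using gr_decomp[OF one_closed, of 0] by auto
  note c = ef(1,2)[THEN gr_carrier]
  have hom: "x \<otimes> e = x" if x: "x \<in> gr A p" for x p
  proof -
    have "x = x \<otimes> e \<oplus> x \<otimes> f"
      using gr_carrier[OF x] c by (simp add: ef(3)[symmetric] flip: r_distr)
    moreover have "x \<otimes> e \<in> gr A p" "x \<otimes> f \<in> gr A (p + 1)"
      using mult_gr[OF x ef(1)] mult_gr[OF x ef(2)] by simp_all
    ultimately show ?thesis using x hcomp_eq hcomp_same by metis
  qed
  have "x \<otimes> e = x" if "x \<in> carrier A" for x
    using that by (induction rule: gr_induct) (auto simp: hom l_distr c)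
  from this[of \<one>] have "\<one> = e" using c by simp
  then show ?thesis using ef by simp
qed

lemma mat_coefficient: "coefficient_superalgebra K Mat"
proof -
  interpret Mat: graded_module K Mat by (rule mat_graded)
  have cl: "x \<otimes>\<^bsub>Mat\<^esub> y \<in> carrier Mat" if "x \<in> carrier Mat" "y \<in> carrier Mat" for x y
    using that by (simp add: mat_mult)
  have l: "(x \<oplus>\<^bsub>Mat\<^esub> y) \<otimes>\<^bsub>Mat\<^esub> z = x \<otimes>\<^bsub>Mat\<^esub> z \<oplus>\<^bsub>Mat\<^esub> y \<otimes>\<^bsub>Mat\<^esub> z"
    if "x \<in> carrier Mat" "y \<in> carrier Mat" "z \<in> carrier Mat" for x y z
    using that by (simp add: fun_eq_iff mat_mult l_distr a_ac)
  have r: "z \<otimes>\<^bsub>Mat\<^esub> (x \<oplus>\<^bsub>Mat\<^esub> y) = z \<otimes>\<^bsub>Mat\<^esub> x \<oplus>\<^bsub>Mat\<^esub> z \<otimes>\<^bsub>Mat\<^esub> y"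
    if "x \<in> carrier Mat" "y \<in> carrier Mat" "z \<in> carrier Mat" for x y z
    using that by (simp add: fun_eq_iff mat_mult r_distr a_ac)
  have "superalgebra K Mat"
  proof (rule superalgebraI[OF mat_graded cl l r])
    fix x y p q assume xy: "x \<in> gr Mat p" "y \<in> gr Mat q"
    have "x i k \<otimes> y k j \<in> gr A (p + q + par i + par j)" for i j k
    proof -
      have "x i k \<in> gr A (p + par i + par k)" "y k j \<in> gr A (q + par k + par j)" using xy by simp_all
      from mult_gr[OF this] show ?thesis by (simp add: ac_simps)
    qed
    moreover have "x i j \<in> carrier A" "y i j \<in> carrier A" for i j
      using xy gr_carrier[of "x i j" "p + par i + par j"] gr_carrier[of "y i j" "q + par i + par j"] by auto
    ultimately show "x \<otimes>\<^bsub>Mat\<^esub> y \<in> gr Mat (p + q)"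
      by (simp add: mat_mult)
  qed (simp_all add: fun_eq_iff mat_mult mult_smult_left mult_smult_right smult_r_distr)
  moreover have "ring Mat"
  proof (rule ringI)
    show "Group.monoid Mat"
    proof (rule monoidI)
      fix x y z assume *: "x \<in> carrier Mat" "y \<in> carrier Mat" "z \<in> carrier Mat"
      show "x \<otimes>\<^bsub>Mat\<^esub> y \<otimes>\<^bsub>Mat\<^esub> z = x \<otimes>\<^bsub>Mat\<^esub> (y \<otimes>\<^bsub>Mat\<^esub> z)"
        using * cl[OF *(1,2)] cl[OF *(2,3)]
        by (simp add: fun_eq_iff mat_mult l_distr r_distr m_assoc) (simp add: a_ac)
    next
      fix x assume *: "x \<in> carrier Mat"
      show "\<one>\<^bsub>Mat\<^esub> \<otimes>\<^bsub>Mat\<^esub> x = x"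
      proof (intro ext)
        fix i j show "(\<one>\<^bsub>Mat\<^esub> \<otimes>\<^bsub>Mat\<^esub> x) i j = x i j"
          using * by (subst mat_mult) (cases i; simp)+
      qed
      show "x \<otimes>\<^bsub>Mat\<^esub> \<one>\<^bsub>Mat\<^esub> = x"
      proof (intro ext)
        fix i j show "(x \<otimes>\<^bsub>Mat\<^esub> \<one>\<^bsub>Mat\<^esub>) i j = x i j"
          using * by (subst mat_mult) (cases j; simp)+
      qed
    qed (use cl in auto)
  qed (use l r Mat.M.abelian_group_axioms in auto)
  ultimately show ?thesis by (intro coefficient_superalgebra.intro assoc_superalgebra.intro)
qed

lemma gl_lie: "lie_superalgebra K (gl31 A)"
  by (rule coefficient_superalgebra.super_commutator_lie[OF mat_coefficient]) (simp_all add: gl31_def)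

lemma gl_simps [simp]:
  "carrier (gl31 A) = {x. \<forall>i j. x i j \<in> carrier A}" "\<zero>\<^bsub>gl31 A\<^esub> = (\<lambda>i j. \<zero>)"
  "x \<oplus>\<^bsub>gl31 A\<^esub> y = (\<lambda>i j. x i j \<oplus> y i j)" "c \<odot>\<^bsub>gl31 A\<^esub> x = (\<lambda>i j. c \<odot> x i j)"
  "gr (gl31 A) p = {x. \<forall>i j. x i j \<in> gr A (p + par i + par j)}"
  by (simp_all add: gl31_def)

lemma gl_neg: assumes "x \<in> carrier (gl31 A)" shows "\<ominus>\<^bsub>gl31 A\<^esub> x = (\<lambda>i j. \<ominus> x i j)"
  using mat_neg[of x] a_inv_cong[of "gl31 A" Mat] assms by (simp add: gl31_def)

lemma gl_mult_hom:
  assumes "x \<in> gr (gl31 A) p" "y \<in> gr (gl31 A) q"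
  shows "(x \<otimes>\<^bsub>gl31 A\<^esub> y) i j = (x \<otimes>\<^bsub>Mat\<^esub> y) i j \<ominus> psign A (p * q) ((y \<otimes>\<^bsub>Mat\<^esub> x) i j)"
proof -
  interpret Mat: coefficient_superalgebra K Mat by (rule mat_coefficient)
  have xy: "x \<in> gr Mat p" "y \<in> gr Mat q" using assms by simp_all
  have c: "y \<otimes>\<^bsub>Mat\<^esub> x \<in> carrier Mat"
    using xy[THEN Mat.gr_carrier] by (rule Mat.m_closed[rotated])
  have "x \<otimes>\<^bsub>gl31 A\<^esub> y = x \<otimes>\<^bsub>Mat\<^esub> y \<ominus>\<^bsub>Mat\<^esub> psign Mat (p * q) (y \<otimes>\<^bsub>Mat\<^esub> x)"
    using Mat.super_commutator_hom[OF xy] by (simp add: gl31_def)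
  then show ?thesis using mat_neg[OF c] mat_neg[OF Mat.psign_closed[OF c, of "p * q"]] c
    by (cases p; cases q) (simp_all add: a_minus_def)
qed

lemma E_elem_gr: "a \<in> gr A p \<Longrightarrow> E_elem A i j a \<in> gr (gl31 A) (p + par i + par j)"
  by (simp add: E_elem_def ac_simps)

lemma E_elem_closed: "a \<in> carrier A \<Longrightarrow> E_elem A i j a \<in> carrier (gl31 A)"
  by (simp add: E_elem_def)

lemma E_mult_E:
  assumes "a \<in> carrier A" "b \<in> carrier A"
  shows "E_elem A i j a \<otimes>\<^bsub>Mat\<^esub> E_elem A k l b = (if j = k then E_elem A i l (a \<otimes> b) else (\<lambda>i j. \<zero>))"
proof (intro ext)
  fix m n
  have E: "E_elem A i j a m k \<in> carrier A" "E_elem A k' l b k n \<in> carrier A" for k k'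
    using assms by (simp_all add: E_elem_def)
  show "(E_elem A i j a \<otimes>\<^bsub>Mat\<^esub> E_elem A k l b) m n
      = (if j = k then E_elem A i l (a \<otimes> b) else (\<lambda>i j. \<zero>)) m n"
    unfolding mat_mult[of "E_elem A i j a" m "E_elem A k l b" n, OF E] using assms by (cases j) (auto simp: E_elem_def)
qed

lemma E_bracket_E:
  assumes "a \<in> gr A p" "b \<in> gr A q"
  shows "E_elem A i j a \<otimes>\<^bsub>gl31 A\<^esub> E_elem A k l b
   = (\<lambda>m n. (if j = k then E_elem A i l (a \<otimes> b) m n else \<zero>) \<ominus>
       psign A ((p + par i + par j) * (q + par k + par l)) (if l = i then E_elem A k j (b \<otimes> a) m n else \<zero>))"
  using gl_mult_hom[OF E_elem_gr[OF assms(1)] E_elem_gr[OF assms(2)]] assms[THEN gr_carrier]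
  by (simp add: fun_eq_iff E_mult_E)

end

section \<open>The Steinberg Lie superalgebra\<close>

lemma (in module) Inter_submodule:
  assumes "\<N> \<noteq> {}" "\<And>N. N \<in> \<N> \<Longrightarrow> submodule N R M"
  shows "submodule (\<Inter>\<N>) R M"
proof (rule submoduleI)
  show "\<Inter>\<N> \<subseteq> carrier M" using assms(1) submoduleE(1)[OF assms(2)] by fast
qed (use submoduleE(3-5)[OF assms(2)] subgroup.one_closed[OF submodule.axioms(1)[OF assms(2)]] in auto)

lemma subalgebra_generated_submodule:
  assumes "lie_superalgebra K L" "G \<subseteq> carrier L"
  shows "submodule (subalgebra_generated K L G) K L"
proof -
  interpret lie_superalgebra K L by fact
  show ?thesis
    unfolding subalgebra_generated_def
    by (rule Inter_submodule) (use carrier_is_submodule mult_closed assms(2) in auto)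
qed

lemma subalgebra_generated_mult:
  "x \<in> subalgebra_generated K L G \<Longrightarrow> y \<in> subalgebra_generated K L G
    \<Longrightarrow> x \<otimes>\<^bsub>L\<^esub> y \<in> subalgebra_generated K L G"
  by (auto simp: subalgebra_generated_def)

lemma subalgebra_generated_incl: "x \<in> G \<Longrightarrow> x \<in> subalgebra_generated K L G"
  by (auto simp: subalgebra_generated_def)

lemma subalgebra_generated_least:
  "\<lbrakk>x \<in> subalgebra_generated K L G; submodule N K L; \<And>x y. x \<in> N \<Longrightarrow> y \<in> N \<Longrightarrow> x \<otimes>\<^bsub>L\<^esub> y \<in> N; G \<subseteq> N\<rbrakk>
    \<Longrightarrow> x \<in> N"
  by (auto simp: subalgebra_generated_def)

sublocale coefficient_superalgebra \<subseteq> G: lie_superalgebra K "gl31 A"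
  by (rule gl_lie)

context coefficient_superalgebra
begin

lemma E_add: "E_elem A i j a \<oplus>\<^bsub>gl31 A\<^esub> E_elem A i j b = E_elem A i j (a \<oplus> b)"
  by (auto simp: E_elem_def fun_eq_iff)

lemma E_smult: "c \<in> carrier K \<Longrightarrow> c \<odot>\<^bsub>gl31 A\<^esub> E_elem A i j b = E_elem A i j (c \<odot> b)"
  by (auto simp: E_elem_def fun_eq_iff)

lemma E_zero: "E_elem A i j \<zero> = \<zero>\<^bsub>gl31 A\<^esub>"
  by (auto simp: E_elem_def fun_eq_iff)

lemma E_inject: "E_elem A i j a = E_elem A i j b \<Longrightarrow> a = b"
  by (auto simp: E_elem_def fun_eq_iff split: if_splits)

lemma E_mult_upper:
  assumes "a \<in> gr A p" "b \<in> gr A q" "i \<noteq> l"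
  shows "E_elem A i j a \<otimes>\<^bsub>gl31 A\<^esub> E_elem A j l b = E_elem A i l (a \<otimes> b)"
  unfolding E_bracket_E[OF assms(1,2)] using assms assms(1,2)[THEN gr_carrier]
  by (auto simp: E_elem_def fun_eq_iff a_minus_def)

lemma E_mult_lower:
  assumes "a \<in> gr A p" "b \<in> gr A q" "j \<noteq> k"
  shows "E_elem A i j a \<otimes>\<^bsub>gl31 A\<^esub> E_elem A k i b
    = E_elem A k j (\<ominus> psign A ((p + par i + par j) * (q + par k + par i)) (b \<otimes> a))"
  unfolding E_bracket_E[OF assms(1,2)] using assms assms(1,2)[THEN gr_carrier]
  by (auto simp: E_elem_def fun_eq_iff a_minus_def)

lemma E_mult_zero:
  assumes "a \<in> gr A p" "b \<in> gr A q" "j \<noteq> k" "i \<noteq> l"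
  shows "E_elem A i j a \<otimes>\<^bsub>gl31 A\<^esub> E_elem A k l b = \<zero>\<^bsub>gl31 A\<^esub>"
  unfolding E_bracket_E[OF assms(1,2)] using assms assms(1,2)[THEN gr_carrier]
  by (auto simp: E_elem_def fun_eq_iff a_minus_def)

lemma E_mult_diag:
  assumes "a \<in> gr A p" "b \<in> gr A q"
  shows "E_elem A i j a \<otimes>\<^bsub>gl31 A\<^esub> E_elem A j i b
    = E_elem A i i (a \<otimes> b) \<oplus>\<^bsub>gl31 A\<^esub>
      E_elem A j j (\<ominus> psign A ((p + par i + par j) * (q + par i + par j)) (b \<otimes> a))"
  unfolding E_bracket_E[OF assms(1,2)] using assms assms(1,2)[THEN gr_carrier]
  by (auto simp: E_elem_def fun_eq_iff a_minus_def ac_simps)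

text \<open>
  Every matrix is a sum of matrices with a single homogeneous entry.
\<close>

lemma gl_induct [consumes 1, case_names E add]:
  assumes "x \<in> carrier (gl31 A)"
    and E: "\<And>i j a p. a \<in> gr A p \<Longrightarrow> P (E_elem A i j a)"
    and add: "\<And>x y. x \<in> carrier (gl31 A) \<Longrightarrow> y \<in> carrier (gl31 A) \<Longrightarrow> P x \<Longrightarrow> P y \<Longrightarrow> P (x \<oplus>\<^bsub>gl31 A\<^esub> y)"
  shows "P x"
proof -
  have E': "P (E_elem A i j a)" if "a \<in> carrier A" for i j a
    using that
  proof (induction rule: gr_induct)
    case (add x y)
    then show ?case unfolding E_add[symmetric] by (intro assms(3) E_elem_closed)
  qed (rule E)
  have "P (\<lambda>i j. if (i, j) \<in> D then x i j else \<zero>)" if "finite D" for D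
    using that
  proof induction
    case empty
    show ?case using E'[of \<zero> I1 I1] by (simp add: E_zero)
  next
    case (insert d D)
    obtain i j where d: "d = (i, j)" by (cases d)
    have eq: "(\<lambda>i j. if (i, j) \<in> insert d D then x i j else \<zero>)
        = E_elem A i j (x i j) \<oplus>\<^bsub>gl31 A\<^esub> (\<lambda>i j. if (i, j) \<in> D then x i j else \<zero>)"
      using insert(2) assms(1) by (auto simp: d E_elem_def fun_eq_iff)
    show ?case unfolding eq
      using insert.IH assms(1) by (intro add E' E_elem_closed) auto
  qed
  from this[of UNIV] show ?thesis by simp
qed

abbreviation (input) "S \<equiv> st31 K A"
abbreviation (input) "G \<equiv> gl31 A"
abbreviation (input) "F \<equiv> F_gen K A"
abbreviation (input) "E \<equiv> E_elem A"
abbreviation (input) "Hs \<equiv> H_sub K A"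

end

sublocale coefficient_superalgebra \<subseteq> P: presentation K "st_gens A" st_deg "st_rels K A"
proof
  fix s t assume "(s, t) \<in> st_rels K A"
  then show "\<exists>p. hom_lterm K (st_gens A) st_deg p s \<and> hom_lterm K (st_gens A) st_deg p t"
  proof cases
    case (brk i j k a p b q)
    have "hom_lterm K (st_gens A) st_deg ((par i + par j + p) + (par j + par k + q))
        (Brk (Gen (i, j, p, a)) (Gen (j, k, q, b)))"
      using brk by (intro hom_Brk) (auto simp: st_gens_def st_deg_def)
    moreover have "(par i + par j + p) + (par j + par k + q) = par i + par k + (p + q)"
      by (simp add: ac_simps)
    ultimately show ?thesis using brk mult_gr
      by (intro exI[of _ "par i + par k + (p + q)"]) (auto simp: st_gens_def st_deg_def)
  next
    case (brk_zero i j k l a p b q)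
    have "hom_lterm K (st_gens A) st_deg ((par i + par j + p) + (par k + par l + q))
        (Brk (Gen (i, j, p, a)) (Gen (k, l, q, b)))"
      using brk_zero by (intro hom_Brk) (auto simp: st_gens_def st_deg_def)
    then show ?thesis using brk_zero by auto
  qed (auto simp: st_gens_def st_deg_def)
qed

sublocale coefficient_superalgebra \<subseteq> S: lie_superalgebra K "st31 K A"
  unfolding st31_def by (rule P.lie_superalgebra_Q)

lemma mem_st_gens [simp]: "(i, j, p, a) \<in> st_gens A \<longleftrightarrow> i \<noteq> j \<and> a \<in> gr A p"
  by (simp add: st_gens_def)

context coefficient_superalgebra
begin

text \<open>
  The degree tag of a generator only distinguishes the two copies of \<open>F\<^sub>i\<^sub>j(0)\<close>, and both of them
  vanish by the relation for multiplication with the scalar \<open>0\<close>.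
\<close>

lemma F_hom: "a \<in> gr A p \<Longrightarrow> i \<noteq> j \<Longrightarrow> F i j a = P.cl (Gen (i, j, p, a))"
proof -
  assume a: "a \<in> gr A p" and ij: "i \<noteq> j"
  have z: "P.cl (Gen (i, j, q, \<zero>)) = \<zero>\<^bsub>S\<^esub>" for q
  proof -
    have "P.cl (Gen (i, j, q, \<zero>\<^bsub>K\<^esub> \<odot> \<zero>)) = P.cl (Smul \<zero>\<^bsub>K\<^esub> (Gen (i, j, q, \<zero>)))"
      using ij by (intro P.cl_eqI lcong.rel st_rels.smul) auto
    also have "\<dots> = \<zero>\<^bsub>K\<^esub> \<odot>\<^bsub>S\<^esub> P.cl (Gen (i, j, q, \<zero>))"
      using ij by (simp add: P.smult_Q st31_def)
    also have "\<dots> = \<zero>\<^bsub>S\<^esub>"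
      using ij P.cl_closed[of "Gen (i, j, q, \<zero>)"] by (simp add: st31_def[symmetric])
    finally show ?thesis by simp
  qed
  have c: "P.cl (Gen (i, j, p, a)) \<in> carrier S"
    using a ij P.cl_closed[of "Gen (i, j, p, a)"] by (simp add: st31_def)
  show ?thesis
    using a c hcomp_other[OF a] by (cases p) (simp_all add: F_gen_def z)
qed

lemma F_gr: "i \<noteq> j \<Longrightarrow> a \<in> gr A p \<Longrightarrow> F i j a \<in> gr S (par i + par j + p)"
  using P.cl_gr[of "par i + par j + p" "Gen (i, j, p, a)"]
  by (simp add: F_hom st31_def st_deg_def)

lemma F_split: "F i j a = F i j (hcomp A 0 a) \<oplus>\<^bsub>S\<^esub> F i j (hcomp A 1 a)" if "a \<in> carrier A" "i \<noteq> j"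
  using that F_hom[of "hcomp A 0 a" 0] F_hom[of "hcomp A 1 a" 1] by (simp add: F_gen_def)

lemma F_closed: "i \<noteq> j \<Longrightarrow> a \<in> carrier A \<Longrightarrow> F i j a \<in> carrier S"
  using F_gr[of i j "hcomp A 0 a" 0] F_gr[of i j "hcomp A 1 a" 1]
  by (simp add: F_split[of a] S.gr_carrier)

lemma F_add_hom: "i \<noteq> j \<Longrightarrow> a \<in> gr A p \<Longrightarrow> b \<in> gr A p \<Longrightarrow> F i j (a \<oplus> b) = F i j a \<oplus>\<^bsub>S\<^esub> F i j b"
  using P.add_Q[of "Gen (i, j, p, a)" "Gen (i, j, p, b)"]
    P.cl_eqI[OF lcong.rel[OF st_rels.add[of i j a A p b K]]]
  by (simp add: F_hom[of _ p] st31_def)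

lemma F_smult_hom: "i \<noteq> j \<Longrightarrow> c \<in> carrier K \<Longrightarrow> a \<in> gr A p \<Longrightarrow> F i j (c \<odot> a) = c \<odot>\<^bsub>S\<^esub> F i j a"
  using P.smult_Q[of c "Gen (i, j, p, a)"] P.cl_eqI[OF lcong.rel[OF st_rels.smul[of i j c K a A p]]]
  by (simp add: F_hom[of _ p] st31_def)

lemma F_add:
  assumes "i \<noteq> j" "a \<in> carrier A" "b \<in> carrier A"
  shows "F i j (a \<oplus> b) = F i j a \<oplus>\<^bsub>S\<^esub> F i j b"
proof -
  have c: "F i j (hcomp A p a) \<in> carrier S" "F i j (hcomp A p b) \<in> carrier S" for p
    using assms by (auto intro: F_closed)
  show ?thesis
    using assms c
    by (simp add: F_split[of "a \<oplus> b"] F_split[of a] F_split[of b] hcomp_add F_add_hom[of _ _ _ 0]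
        F_add_hom[of _ _ _ 1] S.M.a_ac)
qed

lemma F_smult:
  assumes "i \<noteq> j" "c \<in> carrier K" "a \<in> carrier A"
  shows "F i j (c \<odot> a) = c \<odot>\<^bsub>S\<^esub> F i j a"
  using assms by (simp add: F_split[of "c \<odot> a"] F_split[of a] hcomp_smult F_smult_hom[of _ _ _ _ 0]
      F_smult_hom[of _ _ _ _ 1] S.smult_r_distr F_closed)

lemma F_zero [simp]: "i \<noteq> j \<Longrightarrow> F i j \<zero> = \<zero>\<^bsub>S\<^esub>"
  using F_smult[of i j "\<zero>\<^bsub>K\<^esub>" \<zero>] by (simp add: F_closed)

lemma F_neg: "i \<noteq> j \<Longrightarrow> a \<in> carrier A \<Longrightarrow> F i j (\<ominus> a) = \<ominus>\<^bsub>S\<^esub> F i j a"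
  using F_smult[of i j "\<ominus>\<^bsub>K\<^esub> \<one>\<^bsub>K\<^esub>" a] by (simp add: F_closed neg_smult S.neg_smult)

lemma F_mult_hom:
  assumes "distinct [i, j, k]" "a \<in> gr A p" "b \<in> gr A q"
  shows "F i j a \<otimes>\<^bsub>S\<^esub> F j k b = F i k (a \<otimes> b)"
  using P.mult_Q[of "Gen (i, j, p, a)" "Gen (j, k, q, b)"] mult_gr[OF assms(2,3)] assms
    P.cl_eqI[OF lcong.rel[OF st_rels.brk[of i j k a A p b q K]]]
  by (simp add: F_hom st31_def)

lemma F_mult0_hom:
  assumes "i \<noteq> j" "k \<noteq> l" "j \<noteq> k" "i \<noteq> l" "a \<in> gr A p" "b \<in> gr A q"
  shows "F i j a \<otimes>\<^bsub>S\<^esub> F k l b = \<zero>\<^bsub>S\<^esub>"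
  using P.mult_Q[of "Gen (i, j, p, a)" "Gen (k, l, q, b)"] assms P.zero_Q
    P.cl_eqI[OF lcong.rel[OF st_rels.brk_zero[of i j k l a A p b q K]]]
  by (simp add: F_hom st31_def)

lemma F_mult:
  assumes d: "distinct [i, j, k]" and "a \<in> carrier A" "b \<in> carrier A"
  shows "F i j a \<otimes>\<^bsub>S\<^esub> F j k b = F i k (a \<otimes> b)"
  using assms(2)
proof (induction rule: gr_induct)
  case (hom p a)
  from assms(3) show ?case
  proof (induction rule: gr_induct)
    case (hom q b)
    then show ?case using F_mult_hom[OF d \<open>a \<in> gr A p\<close>] by blast
  next
    case (add x y)
    then show ?case using d gr_carrier[OF hom] by (simp add: F_add F_closed S.mult_add_right r_distr)
  qed
next
  case (add x y)
  then show ?case using d assms(3) by (simp add: F_add F_closed S.mult_add_left l_distr)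
qed

lemma F_mult0:
  assumes d: "i \<noteq> j" "k \<noteq> l" "j \<noteq> k" "i \<noteq> l" and "a \<in> carrier A" "b \<in> carrier A"
  shows "F i j a \<otimes>\<^bsub>S\<^esub> F k l b = \<zero>\<^bsub>S\<^esub>"
  using assms(5)
proof (induction rule: gr_induct)
  case (hom p a)
  from assms(6) show ?case
  proof (induction rule: gr_induct)
    case (hom q b)
    then show ?case using F_mult0_hom[OF d \<open>a \<in> gr A p\<close>] by blast
  next
    case (add x y)
    then show ?case using d gr_carrier[OF hom] by (simp add: F_add F_closed S.mult_add_right)
  qed
next
  case (add x y)
  then show ?case using d assms(6) by (simp add: F_add F_closed S.mult_add_left)
qed

lemma S_induct [consumes 1, case_names F zero add smult mult]:
  assumes "x \<in> carrier S"
    and "\<And>i j a p. i \<noteq> j \<Longrightarrow> a \<in> gr A p \<Longrightarrow> Q (F i j a)"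
    and "Q \<zero>\<^bsub>S\<^esub>"
    and "\<And>x y. x \<in> carrier S \<Longrightarrow> y \<in> carrier S \<Longrightarrow> Q x \<Longrightarrow> Q y \<Longrightarrow> Q (x \<oplus>\<^bsub>S\<^esub> y)"
    and "\<And>c x. c \<in> carrier K \<Longrightarrow> x \<in> carrier S \<Longrightarrow> Q x \<Longrightarrow> Q (c \<odot>\<^bsub>S\<^esub> x)"
    and "\<And>x y. x \<in> carrier S \<Longrightarrow> y \<in> carrier S \<Longrightarrow> Q x \<Longrightarrow> Q y \<Longrightarrow> Q (x \<otimes>\<^bsub>S\<^esub> y)"
  shows "Q x"
proof (rule P.Q_induct[OF assms(1)[unfolded st31_def], where P = Q])
  fix y assume "y \<in> st_gens A"
  then show "Q (P.cl (Gen y))" using assms(2) F_hom by (cases y) (metis mem_st_gens)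
qed (use assms(3-) in \<open>auto simp: st31_def\<close>)

text \<open>
  The universal property, in terms of the maps \<open>F\<^sub>i\<^sub>j\<close> instead of generators.
\<close>

lemma st_hom:
  fixes M :: "('k, 'm) superalgebra"
  assumes "lie_superalgebra K M"
    and gr: "\<And>i j a p. i \<noteq> j \<Longrightarrow> a \<in> gr A p \<Longrightarrow> f i j a \<in> gr M (par i + par j + p)"
    and "\<And>i j a b p. i \<noteq> j \<Longrightarrow> a \<in> gr A p \<Longrightarrow> b \<in> gr A p \<Longrightarrow> f i j (a \<oplus> b) = f i j a \<oplus>\<^bsub>M\<^esub> f i j b"
    and "\<And>i j c a p. i \<noteq> j \<Longrightarrow> c \<in> carrier K \<Longrightarrow> a \<in> gr A p \<Longrightarrow> f i j (c \<odot> a) = c \<odot>\<^bsub>M\<^esub> f i j a"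
    and "\<And>i j k a b p q. distinct [i, j, k] \<Longrightarrow> a \<in> gr A p \<Longrightarrow> b \<in> gr A q
        \<Longrightarrow> f i j a \<otimes>\<^bsub>M\<^esub> f j k b = f i k (a \<otimes> b)"
    and "\<And>i j k l a b p q. i \<noteq> j \<Longrightarrow> k \<noteq> l \<Longrightarrow> j \<noteq> k \<Longrightarrow> i \<noteq> l \<Longrightarrow> a \<in> gr A p \<Longrightarrow> b \<in> gr A q
        \<Longrightarrow> f i j a \<otimes>\<^bsub>M\<^esub> f k l b = \<zero>\<^bsub>M\<^esub>"
  obtains h where "h \<in> lie_hom K S M" "\<And>i j a. i \<noteq> j \<Longrightarrow> a \<in> carrier A \<Longrightarrow> h (F i j a) = f i j (hcomp A 0 a) \<oplus>\<^bsub>M\<^esub> f i j (hcomp A 1 a)"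
proof -
  interpret M: lie_superalgebra K M by fact
  obtain h where h: "h \<in> lie_hom K S M" "\<And>x. x \<in> st_gens A \<Longrightarrow> h (P.cl (Gen x)) = (\<lambda>(i, j, p, a). f i j a) x"
    unfolding st31_def
  proof (rule P.presented_hom[OF assms(1), of "\<lambda>(i, j, p, a). f i j a"])
    fix s t assume "(s, t) \<in> st_rels K A"
    then show "P.ev M (\<lambda>(i, j, p, a). f i j a) s = P.ev M (\<lambda>(i, j, p, a). f i j a) t"
      by cases (simp_all add: assms)
  qed (auto simp: st_gens_def st_deg_def gr)
  have hF: "h (F i j a) = f i j a" if "i \<noteq> j" "a \<in> gr A p" for i j a p
    using h(2)[of "(i, j, p, a)"] that by (simp add: F_hom)
  show thesis
  proof (rule that[OF h(1)])
    fix i j :: index and a assume "i \<noteq> j" "a \<in> carrier A"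
    then show "h (F i j a) = f i j (hcomp A 0 a) \<oplus>\<^bsub>M\<^esub> f i j (hcomp A 1 a)"
      using graded_homD(2)[OF lie_homD(1)[OF h(1)]] hF[of i j "hcomp A 0 a" 0] hF[of i j "hcomp A 1 a" 1]
      by (simp add: F_split[of a] F_closed)
  qed
qed

lemma st_hom_unique:
  assumes "lie_superalgebra K M" "f \<in> lie_hom K S M" "g \<in> lie_hom K S M"
    and "\<And>i j a p. i \<noteq> j \<Longrightarrow> a \<in> gr A p \<Longrightarrow> f (F i j a) = g (F i j a)" and "x \<in> carrier S"
  shows "f x = g x"
proof (rule P.presented_hom_unique[OF assms(1) assms(2,3)[unfolded st31_def] _ assms(5)[unfolded st31_def]])
  fix y assume "y \<in> st_gens A"
  then show "f (P.cl (Gen y)) = g (P.cl (Gen y))"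
    using assms(4) F_hom by (cases y) (metis mem_st_gens)
qed

text \<open>
  The canonical map with values in all of \<open>gl(3,1,A)\<close>, where the bilinear form that induces the cocycle is
  defined. By \<open>sl_carrier\<close> its image is \<open>sl(3,1,A)\<close>.
\<close>

definition phi :: "('k, 'a st_gen) lterm set \<Rightarrow> index \<Rightarrow> index \<Rightarrow> 'a"
  where "phi = (SOME f. f \<in> lie_hom K S G \<and> (\<forall>i j. \<forall>a\<in>carrier A. i \<noteq> j \<longrightarrow> f (F i j a) = E i j a))"

lemma phi: "phi \<in> lie_hom K S G \<and> (\<forall>i j. \<forall>a\<in>carrier A. i \<noteq> j \<longrightarrow> phi (F i j a) = E i j a)"
proof -
  obtain h where h: "h \<in> lie_hom K S G"
    "\<And>i j a. i \<noteq> j \<Longrightarrow> a \<in> carrier A \<Longrightarrow> h (F i j a) = E i j (hcomp A 0 a) \<oplus>\<^bsub>G\<^esub> E i j (hcomp A 1 a)"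
  proof (rule st_hom[OF gl_lie, of E])
    fix i j k l :: index and a b c p q
    show "a \<in> gr A p \<Longrightarrow> E i j a \<in> gr G (par i + par j + p)"
      using E_elem_gr[of a p i j] by (simp add: ac_simps)
    show "E i j (a \<oplus> b) = E i j a \<oplus>\<^bsub>G\<^esub> E i j b" by (rule E_add[symmetric])
    show "distinct [i, j, k] \<Longrightarrow> a \<in> gr A p \<Longrightarrow> b \<in> gr A q \<Longrightarrow> E i j a \<otimes>\<^bsub>G\<^esub> E j k b = E i k (a \<otimes> b)"
      by (simp add: E_mult_upper)
    show "c \<in> carrier K \<Longrightarrow> E i j (c \<odot> a) = c \<odot>\<^bsub>G\<^esub> E i j a"
      by (rule E_smult[symmetric])
    show "\<lbrakk>j \<noteq> k; i \<noteq> l; a \<in> gr A p; b \<in> gr A q\<rbrakk> \<Longrightarrow> E i j a \<otimes>\<^bsub>G\<^esub> E k l b = \<zero>\<^bsub>G\<^esub>"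
      by (rule E_mult_zero)
  qed (rule that)
  have "h (F i j a) = E i j a" if "i \<noteq> j" "a \<in> carrier A" for i j a
    using h(2)[OF that] that by (simp only: E_add hcomp_sum[symmetric])
  with h(1) have "\<exists>f. f \<in> lie_hom K S G \<and> (\<forall>i j. \<forall>a\<in>carrier A. i \<noteq> j \<longrightarrow> f (F i j a) = E i j a)" by blast
  from someI_ex[OF this] show ?thesis unfolding phi_def .
qed

lemma phi_hom: "phi \<in> lie_hom K S G" and phi_F: "i \<noteq> j \<Longrightarrow> a \<in> carrier A \<Longrightarrow> phi (F i j a) = E i j a"
  using phi by auto

end

sublocale coefficient_superalgebra \<subseteq> phi: graded_map K "st31 K A" "gl31 A" phi
  by unfold_locales (rule lie_homD(1)[OF phi_hom])

context coefficient_superalgebra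
begin

lemmas phi_mult = lie_homD(2)[OF phi_hom]

lemma phi_entry [simp]: "x \<in> carrier S \<Longrightarrow> phi x i j \<in> carrier A"
  using phi.closed[of x] by simp

section \<open>The subalgebra \<open>H\<close> and the kernel of the canonical map\<close>

abbreviation (input) "FF i j \<equiv> F_gen K A i j ` carrier A"

lemma FF_carrier: "i \<noteq> j \<Longrightarrow> x \<in> FF i j \<Longrightarrow> x \<in> carrier S"
  by (auto simp: F_closed)

lemma FF_submodule:
  assumes "i \<noteq> j" shows "submodule (FF i j) K S"
proof (rule S.submoduleI)
  show "\<zero>\<^bsub>S\<^esub> \<in> FF i j" using F_zero[OF assms] zero_closed by (metis imageI)
next
  fix x y assume "x \<in> FF i j" "y \<in> FF i j"
  then obtain a b where "x = F i j a" "y = F i j b" "a \<in> carrier A" "b \<in> carrier A" by auto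
  then show "x \<oplus>\<^bsub>S\<^esub> y \<in> FF i j" using assms by (auto simp: F_add[symmetric])
next
  fix x assume "x \<in> FF i j"
  then obtain a where "x = F i j a" "a \<in> carrier A" by auto
  then show "\<ominus>\<^bsub>S\<^esub> x \<in> FF i j" using assms by (auto simp: F_neg[symmetric])
next
  fix c x assume "c \<in> carrier K" "x \<in> FF i j"
  then obtain a where "x = F i j a" "a \<in> carrier A" by auto
  then show "c \<odot>\<^bsub>S\<^esub> x \<in> FF i j" using assms \<open>c \<in> carrier K\<close> by (auto simp: F_smult[symmetric])
qed (use assms in \<open>auto simp: F_closed\<close>)

lemma F_hcomp:
  assumes "i \<noteq> j" "a \<in> carrier A"
  shows "hcomp S p (F i j a) = F i j (hcomp A (p + par i + par j) a)"
proof -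
  let ?q = "p + par i + par j"
  have "a = hcomp A ?q a \<oplus> hcomp A (?q + 1) a" using hcomp_decomp[OF assms(2)] by simp
  then have "F i j a = F i j (hcomp A ?q a) \<oplus>\<^bsub>S\<^esub> F i j (hcomp A (?q + 1) a)"
    using F_add[OF assms(1), of "hcomp A ?q a" "hcomp A (?q + 1) a"] assms(2) by simp
  moreover have "F i j (hcomp A ?q a) \<in> gr S p"
    using F_gr[OF assms(1), of "hcomp A ?q a" ?q] assms(2) by (simp add: ac_simps)
  moreover have "F i j (hcomp A (?q + 1) a) \<in> gr S (p + 1)"
    using F_gr[OF assms(1), of "hcomp A (?q + 1) a" "?q + 1"] assms(2) by (simp add: ac_simps)
  ultimately show ?thesis by (simp add: S.hcomp_eq)
qed

lemma FF_hcomp: "i \<noteq> j \<Longrightarrow> x \<in> FF i j \<Longrightarrow> hcomp S p x \<in> FF i j"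
  by (auto simp: F_hcomp)

lemma FF_mult:
  assumes d: "distinct [i, j, k]" and x: "x \<in> FF i j" and y: "y \<in> FF j k"
  shows "x \<otimes>\<^bsub>S\<^esub> y \<in> FF i k" "y \<otimes>\<^bsub>S\<^esub> x \<in> FF i k"
proof -
  have *: "u \<otimes>\<^bsub>S\<^esub> v \<in> FF i k" if "u \<in> FF i j" "v \<in> FF j k" for u v
    using that d by (auto simp: F_mult)
  show "x \<otimes>\<^bsub>S\<^esub> y \<in> FF i k" by (rule *[OF x y])
  have hom: "hcomp S q y \<otimes>\<^bsub>S\<^esub> hcomp S p x \<in> FF i k" for p q
  proof -
    have "hcomp S p x \<otimes>\<^bsub>S\<^esub> hcomp S q y \<in> FF i k"
      using d x y by (intro * FF_hcomp) auto
    then show ?thesis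
      using S.skew[of "hcomp S q y" q "hcomp S p x" p] d FF_carrier[OF _ x] FF_carrier[OF _ y]
      by (auto intro!: S.submoduleE(3)[OF FF_submodule] S.submodule_psign[OF FF_submodule])
  qed
  show "y \<otimes>\<^bsub>S\<^esub> x \<in> FF i k"
    using d x y by (intro S.mult_split[OF _ _ FF_submodule hom]) (auto simp: F_closed)
qed

lemma FF_mult0:
  "\<lbrakk>i \<noteq> j; k \<noteq> l; j \<noteq> k; i \<noteq> l; x \<in> FF i j; y \<in> FF k l\<rbrakk> \<Longrightarrow> x \<otimes>\<^bsub>S\<^esub> y = \<zero>\<^bsub>S\<^esub>"
  by (auto simp: F_mult0)

lemma ex_third: "\<exists>m::index. m \<noteq> i \<and> m \<noteq> j"
  by (cases i; cases j) (auto intro: exI[of _ I1] exI[of _ I2] exI[of _ I3] exI[of _ I4])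

lemma F_factor:
  assumes "distinct [i, m, j]" "a \<in> carrier A"
  shows "F i j a = F i m a \<otimes>\<^bsub>S\<^esub> F m j \<one>"
  using assms by (simp add: F_mult)

definition H_gens where
  "H_gens = {F i j a \<otimes>\<^bsub>S\<^esub> F j i b | i j a b. i \<noteq> j \<and> a \<in> carrier A \<and> b \<in> carrier A}"

lemma H_gensI: "i \<noteq> j \<Longrightarrow> a \<in> carrier A \<Longrightarrow> b \<in> carrier A \<Longrightarrow> F i j a \<otimes>\<^bsub>S\<^esub> F j i b \<in> H_gens"
  unfolding H_gens_def by blast

lemma H_gens_carrier: "H_gens \<subseteq> carrier S"
  by (auto simp: H_gens_def intro!: S.mult_closed F_closed)

lemma Hs_eq: "Hs = subalgebra_generated K S H_gens"
  by (simp add: H_sub_def H_gens_def)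

lemmas Hs_submodule = subalgebra_generated_submodule[OF S.lie_superalgebra_axioms H_gens_carrier, folded Hs_eq]
  and Hs_mult = subalgebra_generated_mult[of _ K S H_gens, folded Hs_eq]
  and Hs_incl = subalgebra_generated_incl[of _ H_gens K S, folded Hs_eq]
  and Hs_least = subalgebra_generated_least[of _ K S H_gens, folded Hs_eq]

lemma Hs_carrier: "x \<in> Hs \<Longrightarrow> x \<in> carrier S"
  using S.submoduleE(1)[OF Hs_submodule] by blast

text \<open>
  Bracketing \<open>F\<^sub>i\<^sub>j(A)\<close> with \<open>F\<^sub>l\<^sub>k(A)\<close> and then with \<open>F\<^sub>k\<^sub>l(A)\<close> leads back to \<open>F\<^sub>i\<^sub>j(A)\<close>, or gives zero,
  unless \<open>{i, j} = {k, l}\<close>. By the Jacobi identity \<open>H\<^sub>k\<^sub>l(a, b)\<close> normalises \<open>F\<^sub>i\<^sub>j(A)\<close>.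
\<close>

lemma H_gen_normal_hom:
  assumes kl: "k \<noteq> l" and ij: "i \<noteq> j" and xy: "x \<in> FF k l" "x \<in> gr S p" "y \<in> FF l k" "y \<in> gr S q"
    and v: "v \<in> FF i j" "v \<in> gr S r" and ne: "(i, j) \<noteq> (k, l)" "(i, j) \<noteq> (l, k)"
  shows "(x \<otimes>\<^bsub>S\<^esub> y) \<otimes>\<^bsub>S\<^esub> v \<in> FF i j"
proof -
  note c = xy(2,4)[THEN S.gr_carrier] v(2)[THEN S.gr_carrier]
  note sub = FF_submodule[OF ij]
  have 0: "\<zero>\<^bsub>S\<^esub> \<in> FF i j" by (rule S.submodule_zero[OF sub])
  have 1: "s \<otimes>\<^bsub>S\<^esub> (t \<otimes>\<^bsub>S\<^esub> v) \<in> FF i j"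
    if mn: "m \<noteq> n" and st: "s \<in> FF m n" "t \<in> FF n m" and ne: "(i, j) \<noteq> (m, n)" "(i, j) \<noteq> (n, m)" for s t m n
  proof -
    have s: "s \<in> carrier S" using st mn FF_carrier by auto
    consider "i \<noteq> n" "j \<noteq> n" "i \<noteq> m" "j \<noteq> m" | "i = n" "j \<noteq> m" | "i = m" "j \<noteq> n" | "j = m" "i \<noteq> n" | "j = n" "i \<noteq> m"
      using ne by auto
    then show ?thesis
    proof cases
      case 1
      then show ?thesis using FF_mult0[of n m i j t v] mn ij st v 0 s by simp
    next
      case 2
      then show ?thesis using FF_mult0[of n m i j t v] mn ij st v 0 s by simp
    next
      case 3
      then show ?thesis using FF_mult(1)[of n m j t v] FF_mult(1)[of m n j s "t \<otimes>\<^bsub>S\<^esub> v"] mn ij st v by simp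
    next
      case 4
      then show ?thesis using FF_mult0[of n m i j t v] mn ij st v 0 s by simp
    next
      case 5
      then show ?thesis using FF_mult(2)[of i n m v t] FF_mult(2)[of i m n "t \<otimes>\<^bsub>S\<^esub> v" s] mn ij st v by simp
    qed
  qed
  show ?thesis
    unfolding S.leibniz'[OF xy(2,4) v(2)] a_minus_def
    by (intro S.submoduleE(3,5)[OF sub] S.submodule_psign[OF sub] 1[of k l] 1[of l k]) (use kl xy ne in auto)
qed

abbreviation (input) "Norm i j \<equiv> S.transporter (FF i j) (FF i j)"

lemma
  assumes "i \<noteq> j"
  shows Norm_submodule: "submodule (Norm i j) K S"
    and Norm_mult: "x \<in> Norm i j \<Longrightarrow> y \<in> Norm i j \<Longrightarrow> x \<otimes>\<^bsub>S\<^esub> y \<in> Norm i j"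
    and Norm_right: "x \<in> Norm i j \<Longrightarrow> v \<in> FF i j \<Longrightarrow> v \<otimes>\<^bsub>S\<^esub> x \<in> FF i j"
proof -
  note T = FF_submodule[OF assms] FF_hcomp[OF assms] FF_submodule[OF assms] FF_hcomp[OF assms] order_refl
  show "submodule (Norm i j) K S" by (rule S.transporter_submodule[OF T])
  show "x \<in> Norm i j \<Longrightarrow> y \<in> Norm i j \<Longrightarrow> x \<otimes>\<^bsub>S\<^esub> y \<in> Norm i j" by (rule S.transporter_mult[OF T])
  show "x \<in> Norm i j \<Longrightarrow> v \<in> FF i j \<Longrightarrow> v \<otimes>\<^bsub>S\<^esub> x \<in> FF i j" by (rule S.transporter_right[OF T])
qed

text \<open>
  An element normalising \<open>F\<^sub>i\<^sub>m(A)\<close> and \<open>F\<^sub>m\<^sub>j(A)\<close> normalises \<open>F\<^sub>i\<^sub>j(A)\<close>, since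
  \<open>F\<^sub>i\<^sub>j(a) = [F\<^sub>i\<^sub>m(a), F\<^sub>m\<^sub>j(1)]\<close>.
\<close>

lemma Norm_chain:
  assumes d: "distinct [i, m, j]" and h: "h \<in> gr S p" "h \<in> Norm i m" "h \<in> Norm m j"
  shows "h \<in> Norm i j"
proof -
  note hc = S.gr_carrier[OF h(1)]
  note sub = FF_submodule[of i j]
  have hom: "h \<otimes>\<^bsub>S\<^esub> F i j a \<in> FF i j" if a: "a \<in> gr A q" for a q
  proof -
    have g: "F i m a \<in> gr S (par i + par m + q)" "F m j \<one> \<in> gr S (par m + par j + 0)"
      using d a one_even by (auto intro!: F_gr simp del: add_0_right)
    have f: "F i m a \<in> FF i m" "F m j \<one> \<in> FF m j" using gr_carrier[OF a] by auto
    have "h \<otimes>\<^bsub>S\<^esub> F i m a \<in> FF i m" "h \<otimes>\<^bsub>S\<^esub> F m j \<one> \<in> FF m j"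
      using h(2,3) f by (auto simp: S.transporter_def)
    then have "(h \<otimes>\<^bsub>S\<^esub> F i m a) \<otimes>\<^bsub>S\<^esub> F m j \<one> \<in> FF i j" "F i m a \<otimes>\<^bsub>S\<^esub> (h \<otimes>\<^bsub>S\<^esub> F m j \<one>) \<in> FF i j"
      using FF_mult(1)[OF d] f by blast+
    moreover have "F i j a = F i m a \<otimes>\<^bsub>S\<^esub> F m j \<one>" using d gr_carrier[OF a] by (intro F_factor) auto
    ultimately show ?thesis
      using d by (simp add: S.leibniz[OF h(1) g] S.submoduleE(5)[OF sub] S.submodule_psign[OF sub])
  qed
  have "h \<otimes>\<^bsub>S\<^esub> F i j a \<in> FF i j" if a: "a \<in> carrier A" for a
    using a
  proof (induction rule: gr_induct)
    case (add x y)
    then show ?case using d hc by (simp add: F_add S.mult_add_right F_closed S.submoduleE(5)[OF sub])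
  qed (rule hom)
  then show ?thesis using hc by (auto simp: S.transporter_def)
qed

text \<open>
  In the remaining case \<open>{i, j} = {k, l}\<close> the generators of \<open>F\<^sub>i\<^sub>j(A)\<close> are brackets that pass through a
  third index.
\<close>

lemma H_gens_Norm:
  assumes "h \<in> H_gens" "i \<noteq> j"
  shows "h \<in> Norm i j"
proof -
  obtain k l a b where h: "h = F k l a \<otimes>\<^bsub>S\<^esub> F l k b" and kl: "k \<noteq> l" and ab: "a \<in> carrier A" "b \<in> carrier A"
    using assms(1) by (auto simp: H_gens_def)
  have c: "F k l a \<in> carrier S" "F l k b \<in> carrier S" using kl ab by (auto intro: F_closed)
  have hom: "hcomp S p (F k l a) \<otimes>\<^bsub>S\<^esub> hcomp S q (F l k b) \<in> Norm i j" for p q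
  proof -
    let ?x = "hcomp S p (F k l a)" and ?y = "hcomp S q (F l k b)"
    have xy: "?x \<in> FF k l" "?x \<in> gr S p" "?y \<in> FF l k" "?y \<in> gr S q"
      using kl ab c by (auto intro!: FF_hcomp)
    have xyc: "?x \<otimes>\<^bsub>S\<^esub> ?y \<in> carrier S" using c by (simp add: S.mult_closed)
    have gen: "?x \<otimes>\<^bsub>S\<^esub> ?y \<in> Norm i j" if ij: "i \<noteq> j" and ne: "(i, j) \<noteq> (k, l)" "(i, j) \<noteq> (l, k)" for i j
    proof -
      have "(?x \<otimes>\<^bsub>S\<^esub> ?y) \<otimes>\<^bsub>S\<^esub> v \<in> FF i j" if v: "v \<in> FF i j" for v
      proof -
        have vc: "v \<in> carrier S" using v ij FF_carrier by auto
        have "v = hcomp S 0 v \<oplus>\<^bsub>S\<^esub> hcomp S 1 v" using vc S.hcomp_sum by blast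
        then have "(?x \<otimes>\<^bsub>S\<^esub> ?y) \<otimes>\<^bsub>S\<^esub> v = (?x \<otimes>\<^bsub>S\<^esub> ?y) \<otimes>\<^bsub>S\<^esub> hcomp S 0 v \<oplus>\<^bsub>S\<^esub> (?x \<otimes>\<^bsub>S\<^esub> ?y) \<otimes>\<^bsub>S\<^esub> hcomp S 1 v"
          using xyc vc S.mult_add_right[of "?x \<otimes>\<^bsub>S\<^esub> ?y" "hcomp S 0 v" "hcomp S 1 v"] by simp
        also have "\<dots> \<in> FF i j"
          using H_gen_normal_hom[OF kl ij xy FF_hcomp[OF ij v, of 0] S.hcomp_gr[OF vc] ne]
            H_gen_normal_hom[OF kl ij xy FF_hcomp[OF ij v, of 1] S.hcomp_gr[OF vc] ne]
          by (rule S.submoduleE(5)[OF FF_submodule[OF ij]])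
        finally show ?thesis .
      qed
      then show ?thesis using xyc by (simp add: S.transporter_def)
    qed
    show ?thesis
    proof (cases "(i, j) = (k, l) \<or> (i, j) = (l, k)")
      case False
      then show ?thesis using gen assms(2) by auto
    next
      case True
      obtain m where m: "m \<noteq> i" "m \<noteq> j" using ex_third by blast
      have "?x \<otimes>\<^bsub>S\<^esub> ?y \<in> gr S (p + q)" using xy by (simp add: S.mult_gr)
      then show ?thesis
        using True m assms(2) kl by (intro Norm_chain[of i m j] gen) auto
    qed
  qed
  show ?thesis unfolding h
    using assms(2) by (intro S.mult_split[OF c Norm_submodule] hom)
qed

lemma Hs_Norm: "h \<in> Hs \<Longrightarrow> i \<noteq> j \<Longrightarrow> h \<in> Norm i j"
  using H_gens_Norm by (elim Hs_least) (auto intro: Norm_submodule Norm_mult)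

text \<open>
  The additive span of \<open>H\<close> and of all \<open>F\<^sub>i\<^sub>j(A)\<close>. Since \<open>H\<close> is a subalgebra that normalises every
  \<open>F\<^sub>i\<^sub>j(A)\<close>, the span is closed under brackets, so it is everything.
\<close>

inductive_set span :: "('k, 'a st_gen) lterm set set" where
  H: "h \<in> Hs \<Longrightarrow> h \<in> span"
| F: "i \<noteq> j \<Longrightarrow> a \<in> carrier A \<Longrightarrow> F_gen K A i j a \<in> span"
| plus: "x \<in> span \<Longrightarrow> y \<in> span \<Longrightarrow> x \<oplus>\<^bsub>st31 K A\<^esub> y \<in> span"

lemma span_carrier: "x \<in> span \<Longrightarrow> x \<in> carrier S"
  by (induction rule: span.induct) (auto simp: Hs_carrier F_closed)

lemma FF_span: "i \<noteq> j \<Longrightarrow> x \<in> FF i j \<Longrightarrow> x \<in> span"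
  by (auto intro: span.F)

lemma span_mult: "x \<in> span \<Longrightarrow> y \<in> span \<Longrightarrow> x \<otimes>\<^bsub>S\<^esub> y \<in> span"
proof (induction rule: span.induct)
  case (H h)
  note hH = H(1)
  from \<open>y \<in> span\<close> show ?case
  proof (induction rule: span.induct)
    case (F i j a)
    then show ?case using Hs_Norm[OF hH] by (intro FF_span[of i j]) (auto simp: S.transporter_def)
  qed (use hH Hs_mult in \<open>auto simp: S.mult_add_right Hs_carrier span_carrier intro: span.intros\<close>)
next
  case (F i j a)
  note Fx = F
  from \<open>y \<in> span\<close> show ?case
  proof (induction rule: span.induct)
    case (H h)
    have "F i j a \<in> FF i j" using F by simp
    from Norm_right[OF Fx(1) Hs_Norm[OF H Fx(1)] this] show ?case using F by (intro FF_span[of i j]) auto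
  next
    case (F k l b)
    consider "j = k" "i = l" | "j = k" "i \<noteq> l" | "j \<noteq> k" "i = l" | "j \<noteq> k" "i \<noteq> l" by blast
    then show ?case
    proof cases
      case 1
      then show ?thesis using F Fx by (auto intro!: span.H Hs_incl H_gensI)
    next
      case 2
      then show ?thesis using F Fx by (simp add: F_mult span.F)
    next
      case 3
      then have "F i j a \<otimes>\<^bsub>S\<^esub> F k l b \<in> FF k j" using F Fx by (intro FF_mult(2)[of k i j]) auto
      then show ?thesis using 3 by (intro FF_span[of k j]) auto
    next
      case 4
      then show ?thesis using F Fx S.submodule_zero[OF Hs_submodule] by (simp add: F_mult0 span.H)
    qed
  qed (use F in \<open>auto simp: S.mult_add_right F_closed span_carrier intro: span.intros\<close>)
qed (auto simp: S.mult_add_left span_carrier intro: span.plus)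

lemma span_smult: "x \<in> span \<Longrightarrow> c \<in> carrier K \<Longrightarrow> c \<odot>\<^bsub>S\<^esub> x \<in> span"
  by (induction rule: span.induct)
    (auto simp: S.smult_r_distr span_carrier F_smult[symmetric] intro: span.intros S.submoduleE(4)[OF Hs_submodule])

lemma span_UNIV: "x \<in> carrier S \<Longrightarrow> x \<in> span"
  by (induction rule: S_induct)
    (auto intro: span.intros span_mult span_smult gr_carrier S.submodule_zero[OF Hs_submodule])

lemma st_induct [consumes 1, case_names H F add]:
  assumes "x \<in> carrier S" and "\<And>h. h \<in> Hs \<Longrightarrow> Q h"
    and "\<And>i j a. i \<noteq> j \<Longrightarrow> a \<in> carrier A \<Longrightarrow> Q (F i j a)"
    and "\<And>x y. x \<in> carrier S \<Longrightarrow> y \<in> carrier S \<Longrightarrow> Q x \<Longrightarrow> Q y \<Longrightarrow> Q (x \<oplus>\<^bsub>S\<^esub> y)"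
  shows "Q x"
  using span_UNIV[OF assms(1)] by (induction rule: span.induct) (auto intro: assms span_carrier)

lemma phi_Hs: "h \<in> Hs \<Longrightarrow> i \<noteq> j \<Longrightarrow> phi h i j = \<zero>"
proof -
  let ?D = "{x \<in> carrier S. \<forall>i j. i \<noteq> j \<longrightarrow> phi x i j = \<zero>}"
  have sub: "submodule ?D K S"
    by (rule S.submoduleI) (auto simp: phi.add phi.smult phi.neg gl_neg)
  have hc: "hcomp S p x \<in> ?D" if "x \<in> ?D" for p x
  proof -
    have "phi (hcomp S p x) i j = hcomp A (p + par i + par j) (phi x i j)" if x: "x \<in> carrier S" for i j
    proof -
      have "phi (hcomp S p x) i j \<in> gr A (p + par i + par j)"
        "phi (hcomp S (p + 1) x) i j \<in> gr A (p + par i + par j + 1)"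
        using phi.gr[OF S.hcomp_gr[OF x, of p]] phi.gr[OF S.hcomp_gr[OF x, of "p + 1"]]
        by (simp_all add: ac_simps)
      moreover have "phi x i j = phi (hcomp S p x) i j \<oplus> phi (hcomp S (p + 1) x) i j"
        using phi.add[of "hcomp S p x" "hcomp S (p + 1) x"] x by (simp add: S.hcomp_decomp)
      ultimately show ?thesis by (simp add: hcomp_eq)
    qed
    then show ?thesis using that hcomp_same[OF gr_zero] by auto
  qed
  have hom: "x \<otimes>\<^bsub>S\<^esub> y \<in> ?D" if xy: "x \<in> ?D" "y \<in> ?D" "x \<in> gr S p" "y \<in> gr S q" for x y p q
  proof -
    have z: "u = v \<or> (phi x u w \<otimes> phi y w v = \<zero> \<and> phi y u w \<otimes> phi x w v = \<zero>)" for u v w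
      using xy by (cases "u = w"; cases "w = v") auto
    have "phi (x \<otimes>\<^bsub>S\<^esub> y) i j = \<zero>" if "i \<noteq> j" for i j
      using xy z[of i j] that
      by (simp add: phi_mult gl_mult_hom[OF phi.gr[OF xy(3)] phi.gr[OF xy(4)]] mat_mult a_minus_def)
    then show ?thesis using xy by (simp add: S.mult_closed)
  qed
  have mult: "x \<otimes>\<^bsub>S\<^esub> y \<in> ?D" if xy: "x \<in> ?D" "y \<in> ?D" for x y
  proof (rule S.mult_split[OF _ _ sub])
    show "x \<in> carrier S" "y \<in> carrier S" using xy by auto
    then show "hcomp S p x \<otimes>\<^bsub>S\<^esub> hcomp S q y \<in> ?D" for p q
      by (intro hom[OF hc[OF xy(1)] hc[OF xy(2)], of p p q q] S.hcomp_gr)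
  qed
  have gen: "x \<in> ?D" if "x \<in> H_gens" for x
  proof -
    obtain k l a b where x: "x = F k l a \<otimes>\<^bsub>S\<^esub> F l k b" and kl: "k \<noteq> l" and ab: "a \<in> carrier A" "b \<in> carrier A"
      using \<open>x \<in> H_gens\<close> by (auto simp: H_gens_def)
    have D: "F k l a' \<otimes>\<^bsub>S\<^esub> F l k b' \<in> ?D" if "a' \<in> gr A p" "b' \<in> gr A q" for a' b' p q
      using kl gr_carrier[OF that(1)] gr_carrier[OF that(2)]
      by (auto simp: phi_mult F_closed phi_F E_mult_diag[OF that] S.mult_closed) (auto simp: E_elem_def)
    show ?thesis unfolding x
    proof (rule S.mult_split[OF F_closed F_closed sub])
      fix p q
      have "hcomp S p (F k l a) = F k l (hcomp A (p + par k + par l) a)"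
        "hcomp S q (F l k b) = F l k (hcomp A (q + par l + par k) b)"
        using kl ab by (simp_all add: F_hcomp)
      then show "hcomp S p (F k l a) \<otimes>\<^bsub>S\<^esub> hcomp S q (F l k b) \<in> ?D"
        using D[OF hcomp_gr[OF ab(1)] hcomp_gr[OF ab(2)]] by (simp only:)
    qed (use kl ab in auto)
  qed
  show "h \<in> Hs \<Longrightarrow> i \<noteq> j \<Longrightarrow> phi h i j = \<zero>"
    using Hs_least[OF _ sub mult] gen by blast
qed

text \<open>
  The off-diagonal part of a matrix, as an element of the Steinberg Lie superalgebra.
\<close>

definition off :: "(index \<Rightarrow> index \<Rightarrow> 'a) \<Rightarrow> ('k, 'a st_gen) lterm set"
  where "off x = (\<Oplus>\<^bsub>st31 K A\<^esub>u\<in>{(i, j). i \<noteq> j}. F_gen K A (fst u) (snd u) (x (fst u) (snd u)))"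

text \<open>
  Elements of \<open>H\<close> have diagonal image and \<open>F\<^sub>i\<^sub>j(a)\<close> has image \<open>E\<^sub>i\<^sub>j(a)\<close>. So the components of \<open>x\<close> outside
  of \<open>H\<close> can be read off from its image.
\<close>

lemma st_decomp: "x \<in> carrier S \<Longrightarrow> \<exists>h\<in>Hs. x = h \<oplus>\<^bsub>S\<^esub> off (phi x)"
proof (induction rule: st_induct)
  case (H h)
  have "off (phi h) = (\<Oplus>\<^bsub>st31 K A\<^esub>u\<in>{(i::index, j). i \<noteq> j}. \<zero>\<^bsub>S\<^esub>)"
    unfolding off_def using phi_Hs[OF H] by (intro S.M.finsum_cong') auto
  then have "off (phi h) = \<zero>\<^bsub>S\<^esub>" by simp
  then show ?case using H Hs_carrier[OF H] by (intro bexI[of _ h]) auto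
next
  case (F i j a)
  have "off (phi (F i j a)) = (\<Oplus>\<^bsub>st31 K A\<^esub>u\<in>{(i, j). i \<noteq> j}. if (i, j) = u then F i j a else \<zero>\<^bsub>S\<^esub>)"
    unfolding off_def using F by (intro S.M.finsum_cong') (auto simp: phi_F E_elem_def F_closed)
  also have "\<dots> = F i j a"
    using F by (intro S.M.add.finprod_singleton[where f = "\<lambda>_. F i j a" and i = "(i, j)"]) (auto simp: F_closed)
  finally show ?case using F S.submodule_zero[OF Hs_submodule] F_closed by (auto intro!: bexI[of _ "\<zero>\<^bsub>S\<^esub>"])
next
  case (add x y)
  then obtain g h where gh: "g \<in> Hs" "h \<in> Hs" "x = g \<oplus>\<^bsub>S\<^esub> off (phi x)" "y = h \<oplus>\<^bsub>S\<^esub> off (phi y)" by blast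
  have c: "off (phi x) \<in> carrier S" if "x \<in> carrier S" for x
    unfolding off_def using that by (intro S.M.finsum_closed) (auto simp: F_closed)
  have "off (phi (x \<oplus>\<^bsub>S\<^esub> y)) = (\<Oplus>\<^bsub>st31 K A\<^esub>u\<in>{(i, j). i \<noteq> j}.
      F (fst u) (snd u) (phi x (fst u) (snd u)) \<oplus>\<^bsub>S\<^esub> F (fst u) (snd u) (phi y (fst u) (snd u)))"
    unfolding off_def using add by (intro S.M.finsum_cong') (auto simp: phi.add F_add F_closed)
  also have "\<dots> = off (phi x) \<oplus>\<^bsub>S\<^esub> off (phi y)"
    unfolding off_def using add by (intro S.M.finsum_addf) (auto simp: F_closed)
  finally have "x \<oplus>\<^bsub>S\<^esub> y = (g \<oplus>\<^bsub>S\<^esub> h) \<oplus>\<^bsub>S\<^esub> off (phi (x \<oplus>\<^bsub>S\<^esub> y))"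
    using add(1,2) gh(1,2)[THEN Hs_carrier] c gh(3,4) by (metis (no_types, lifting) S.M.a_assoc S.M.a_closed S.M.a_lcomm)
  then show ?case using gh S.submoduleE(5)[OF Hs_submodule] by blast
qed

lemma kernel_Hs: "x \<in> carrier S \<Longrightarrow> phi x = (\<lambda>i j. \<zero>) \<Longrightarrow> x \<in> Hs"
proof -
  assume x: "x \<in> carrier S" "phi x = (\<lambda>i j. \<zero>)"
  obtain h where h: "h \<in> Hs" "x = h \<oplus>\<^bsub>S\<^esub> off (phi x)" using st_decomp[OF x(1)] by blast
  have "off (phi x) = (\<Oplus>\<^bsub>st31 K A\<^esub>u\<in>{(i::index, j). i \<noteq> j}. \<zero>\<^bsub>S\<^esub>)"
    unfolding off_def x(2) by (intro S.M.finsum_cong') auto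
  then have "off (phi x) = \<zero>\<^bsub>S\<^esub>" by simp
  with h show "x \<in> Hs" using Hs_carrier by simp
qed

text \<open>
  An element \<open>v\<close> of the kernel lies in \<open>H\<close>, so \<open>[F\<^sub>i\<^sub>j(a), v] = F\<^sub>i\<^sub>j(b)\<close> for some \<open>b\<close>. The left-hand side has
  image zero, hence \<open>b = 0\<close>. Thus the generators centralise the kernel.
\<close>

lemma kernel_central:
  assumes "x \<in> carrier S" "phi x = (\<lambda>i j. \<zero>)" "y \<in> carrier S"
  shows "x \<otimes>\<^bsub>S\<^esub> y = \<zero>\<^bsub>S\<^esub>"
proof -
  let ?N = "a_kernel S G phi"
  have ker: "v \<in> ?N \<longleftrightarrow> v \<in> carrier S \<and> phi v = (\<lambda>i j. \<zero>)" for v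
    by (simp add: a_kernel_def')
  have 0: "\<zero>\<^bsub>S\<^esub> \<in> ?N" by (simp add: ker)
  have xN: "x \<in> ?N" unfolding ker using assms(1,2) by blast
  have hz: "v \<in> {\<zero>\<^bsub>S\<^esub>} \<Longrightarrow> hcomp S p v \<in> {\<zero>\<^bsub>S\<^esub>}" for v p
    by (simp add: S.hcomp_same[OF S.gr_zero])
  have "{\<zero>\<^bsub>S\<^esub>} \<subseteq> ?N" using 0 by simp
  note T = phi.kernel_submodule phi.kernel_hcomp S.zero_submodule hz this
  have y: "y \<in> S.transporter ?N {\<zero>\<^bsub>S\<^esub>}"
    using assms(3)
  proof (induction rule: S_induct)
    case (F i j a p)
    have a: "a \<in> carrier A" using F gr_carrier by auto
    have "F i j a \<otimes>\<^bsub>S\<^esub> v = \<zero>\<^bsub>S\<^esub>" if v: "v \<in> ?N" for v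
    proof -
      have "v \<in> Hs" using v kernel_Hs by (auto simp: ker)
      then have "F i j a \<otimes>\<^bsub>S\<^esub> v \<in> FF i j"
        using Norm_right[OF F(1) Hs_Norm[OF _ F(1)], of v] a by auto
      then obtain b where b: "b \<in> carrier A" "F i j a \<otimes>\<^bsub>S\<^esub> v = F i j b" by auto
      have "E i j b = phi (F i j a) \<otimes>\<^bsub>G\<^esub> phi v"
        using b F a v phi_F[of i j b] phi_mult[of "F i j a" v] by (simp add: F_closed ker)
      also have "\<dots> = E i j \<zero>"
        using v F a G.mult_zero_right[of "E i j a"] E_elem_closed[of a i j] by (simp add: ker phi_F E_zero)
      finally have "b = \<zero>" by (rule E_inject)
      then show ?thesis using b F by simp
    qed
    then show ?case using F a F_closed by (simp add: S.transporter_def)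
  next
    case zero
    show ?case by (rule S.submodule_zero[OF S.transporter_submodule[OF T]])
  next
    case (add x y)
    then show ?case by (intro S.submoduleE(5)[OF S.transporter_submodule[OF T]])
  next
    case (smult c x)
    then show ?case by (intro S.submoduleE(4)[OF S.transporter_submodule[OF T]])
  next
    case (mult x y)
    then show ?case by (intro S.transporter_mult[OF T])
  qed
  have "x \<otimes>\<^bsub>S\<^esub> y \<in> {\<zero>\<^bsub>S\<^esub>}"
    by (rule S.transporter_right[OF T y xN])
  then show ?thesis by simp
qed

end

section \<open>The image of the Steinberg Lie superalgebra\<close>

lemma derived_cong:
  "carrier (derived K L) = \<Inter>{N. submodule N K L \<and> (\<forall>x\<in>carrier L. \<forall>y\<in>carrier L. x \<otimes>\<^bsub>L\<^esub> y \<in> N)}"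
  by (simp add: derived_def restrict_to_def)

context coefficient_superalgebra
begin

lemma F_bracket: "i \<noteq> j \<Longrightarrow> a \<in> carrier A \<Longrightarrow> \<exists>x\<in>carrier S. \<exists>y\<in>carrier S. F i j a = x \<otimes>\<^bsub>S\<^esub> y"
proof -
  assume *: "i \<noteq> j" "a \<in> carrier A"
  obtain m where "m \<noteq> i" "m \<noteq> j" using ex_third by blast
  with * have "F i j a = F i m a \<otimes>\<^bsub>S\<^esub> F m j \<one>" by (intro F_factor) auto
  then show ?thesis using * \<open>m \<noteq> i\<close> \<open>m \<noteq> j\<close> by (auto intro!: bexI F_closed)
qed

lemma st_perfect: "perfect K S"
proof -
  have "x \<in> N" if x: "x \<in> carrier S" and N: "submodule N K S" "\<forall>x\<in>carrier S. \<forall>y\<in>carrier S. x \<otimes>\<^bsub>S\<^esub> y \<in> N" for x N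
    using x
  proof (induction rule: S_induct)
    case (F i j a p)
    then show ?case using F_bracket[of i j a] gr_carrier[of a p] N(2) by fastforce
  qed (use N S.submoduleE(4,5)[OF N(1)] S.submodule_zero[OF N(1)] in auto)
  then show ?thesis unfolding perfect_def derived_cong
    using S.carrier_is_submodule S.mult_closed by (intro equalityI) blast+
qed

abbreviation (input) "Im \<equiv> phi ` carrier (st31 K A)"

lemma Im_carrier: "x \<in> Im \<Longrightarrow> x \<in> carrier G"
  using phi.closed by blast

lemma Im_hcomp: "x \<in> Im \<Longrightarrow> hcomp G p x \<in> Im"
  by (auto simp: phi.hcomp[symmetric] simp del: gl_simps)

lemma Im_mult: "x \<in> Im \<Longrightarrow> y \<in> Im \<Longrightarrow> x \<otimes>\<^bsub>G\<^esub> y \<in> Im"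
  by (auto simp: phi_mult[symmetric] S.mult_closed simp del: gl_simps)

lemma Im_E: "i \<noteq> j \<Longrightarrow> a \<in> carrier A \<Longrightarrow> E i j a \<in> Im"
  using phi_F F_closed by (metis imageI)

lemma Im_diag:
  assumes "a \<in> gr A p" "b \<in> gr A q" "i \<noteq> j"
  shows "E i i (a \<otimes> b) \<oplus>\<^bsub>G\<^esub> E j j (\<ominus> psign A ((p + par i + par j) * (q + par i + par j)) (b \<otimes> a)) \<in> Im"
  using Im_mult[OF Im_E Im_E, of i j a j i b] assms assms(1,2)[THEN gr_carrier]
  unfolding E_mult_diag[OF assms(1,2), symmetric] by auto

text \<open>
  For any \<open>j\<close> other than \<open>i\<close> this matrix is the image of \<open>H\<^sub>i\<^sub>j(a, b) - (-1)\<^bsup>|a||b|\<^esup>H\<^sub>i\<^sub>j(1, ba)\<close>, in which the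
  entries in position \<open>(j, j)\<close> cancel.
\<close>

lemma Im_commutator:
  assumes a: "a \<in> gr A p" and b: "b \<in> gr A q"
  shows "E i i (a \<otimes> b) \<oplus>\<^bsub>G\<^esub> E i i (\<ominus> psign A (p * q) (b \<otimes> a)) \<in> Im"
proof -
  obtain j where j: "j \<noteq> i" using ex_third[of i i] by blast
  define s where "s = par i + par j"
  note c = a[THEN gr_carrier] b[THEN gr_carrier]
  have ba: "b \<otimes> a \<in> gr A (q + p)" using mult_gr[OF b a] .
  let ?X = "E i i (a \<otimes> b) \<oplus>\<^bsub>G\<^esub> E j j (\<ominus> psign A ((p + s) * (q + s)) (b \<otimes> a))"
  let ?Y = "E i i (b \<otimes> a) \<oplus>\<^bsub>G\<^esub> E j j (\<ominus> psign A ((0 + s) * (q + p + s)) (b \<otimes> a))"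
  have X: "?X \<in> Im" using Im_diag[OF a b j[symmetric]] by (simp only: s_def add.assoc)
  have Y: "?Y \<in> Im"
    using Im_diag[OF one_even ba j[symmetric]] c
    by (simp only: s_def add.assoc l_one r_one m_closed)
  have "?X \<oplus>\<^bsub>G\<^esub> (\<ominus>\<^bsub>G\<^esub> psign G (p * q) ?Y) \<in> Im"
    by (rule G.submoduleE(5)[OF phi.image_submodule X G.submoduleE(3)[OF phi.image_submodule
          G.submodule_psign[OF phi.image_submodule Y]]])
  moreover have "?X \<oplus>\<^bsub>G\<^esub> (\<ominus>\<^bsub>G\<^esub> psign G (p * q) ?Y)
      = E i i (a \<otimes> b) \<oplus>\<^bsub>G\<^esub> E i i (\<ominus> psign A (p * q) (b \<otimes> a))"
  proof -
    have neg: "\<ominus>\<^bsub>G\<^esub> (E i i u \<oplus>\<^bsub>G\<^esub> E j j v) = E i i (\<ominus> u) \<oplus>\<^bsub>G\<^esub> E j j (\<ominus> v)" if "u \<in> carrier A" "v \<in> carrier A" for u v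
      using that j by (subst gl_neg) (auto simp: E_elem_def fun_eq_iff minus_add)
    have neg2: "\<ominus>\<^bsub>G\<^esub> (\<ominus>\<^bsub>G\<^esub> (E i i u \<oplus>\<^bsub>G\<^esub> E j j v)) = E i i u \<oplus>\<^bsub>G\<^esub> E j j v" if "u \<in> carrier A" "v \<in> carrier A" for u v
      using that by (intro G.M.minus_minus) (simp add: E_elem_def)
    show ?thesis
      using c j by (cases p; cases q; cases s)
        (simp_all add: neg neg2 del: gl_simps, auto simp: E_elem_def fun_eq_iff r_neg l_neg)
  qed
  ultimately show ?thesis by simp
qed

lemma E_bracket_Im:
  assumes a: "a \<in> gr A p" and b: "b \<in> gr A q"
  shows "E i j a \<otimes>\<^bsub>G\<^esub> E k l b \<in> Im"
proof -
  note c = a[THEN gr_carrier] b[THEN gr_carrier]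
  consider "j = k" "i \<noteq> l" | "j \<noteq> k" "i = l" | "j \<noteq> k" "i \<noteq> l" | "j = k" "i = l" "i = j" | "j = k" "i = l" "i \<noteq> j" by blast
  then show ?thesis
  proof cases
    case 1
    then show ?thesis using E_mult_upper[OF a b 1(2)] c Im_E by simp
  next
    case 2
    then show ?thesis using E_mult_lower[OF a b 2(1)] c Im_E by simp
  next
    case 3
    then show ?thesis using E_mult_zero[OF a b 3] G.submodule_zero[OF phi.image_submodule] by simp
  next
    case 4
    then show ?thesis using E_mult_diag[OF a b, of i i] Im_commutator[OF a b, of i] by (simp add: add.assoc del: gl_simps)
  next
    case 5
    then show ?thesis using Im_mult[OF Im_E Im_E, of i j a j i b] c by auto
  qed
qed

lemma gl_bracket_Im: "x \<in> carrier G \<Longrightarrow> y \<in> carrier G \<Longrightarrow> x \<otimes>\<^bsub>G\<^esub> y \<in> Im"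
proof (induction x rule: gl_induct)
  case (E i j a p)
  from \<open>y \<in> carrier G\<close> show ?case
  proof (induction y rule: gl_induct)
    case (E k l b q)
    then show ?case using E_bracket_Im \<open>a \<in> gr A p\<close> by blast
  next
    case (add x y)
    then show ?case using G.mult_add_right[OF E_elem_closed[OF gr_carrier[OF \<open>a \<in> gr A p\<close>]] add(1,2)]
        G.submoduleE(5)[OF phi.image_submodule] by (simp del: gl_simps)
  qed
next
  case (add x z)
  then show ?case using G.mult_add_left[OF add(1,2) \<open>y \<in> carrier G\<close>]
      G.submoduleE(5)[OF phi.image_submodule] by (simp del: gl_simps)
qed

text \<open>
  The brackets of matrix units span \<open>sl(3,1,A)\<close>. They lie in the image: off-diagonal ones are images of
  generators, and diagonal ones are images of elements \<open>H\<^sub>i\<^sub>j(a, b)\<close> and their combinations above.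
  Conversely the generators of the Steinberg Lie superalgebra are brackets.
\<close>

lemma sl_carrier: "carrier (sl31 K A) = Im"
proof
  show "carrier (sl31 K A) \<subseteq> Im"
    unfolding sl31_def derived_cong using phi.image_submodule gl_bracket_Im by blast
  have "phi x \<in> N" if x: "x \<in> carrier S" and N: "submodule N K G" "\<forall>x\<in>carrier G. \<forall>y\<in>carrier G. x \<otimes>\<^bsub>G\<^esub> y \<in> N" for x N
    using x
  proof (induction rule: S_induct)
    case (F i j a p)
    obtain u v where "u \<in> carrier S" "v \<in> carrier S" "F i j a = u \<otimes>\<^bsub>S\<^esub> v"
      using F_bracket[OF F(1) gr_carrier[OF F(2)]] by auto
    then show ?case using N(2) phi.closed by (simp add: phi_mult del: gl_simps)
  next
    case zero show ?case using G.submodule_zero[OF N(1)] by simp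
  next
    case (add x y)
    then show ?case using G.submoduleE(5)[OF N(1)] by (simp add: phi.add del: gl_simps)
  next
    case (smult c x)
    then show ?case using G.submoduleE(4)[OF N(1)] by (simp add: phi.smult del: gl_simps)
  next
    case (mult x y)
    then show ?case using N(2) phi.closed by (simp add: phi_mult del: gl_simps)
  qed
  then show "Im \<subseteq> carrier (sl31 K A)"
    unfolding sl31_def derived_cong by blast
qed

lemma sl_simps:
  "add (sl31 K A) = add G" "zero (sl31 K A) = zero G" "smult (sl31 K A) = smult G"
  "monoid.mult (sl31 K A) = monoid.mult G" "gr (sl31 K A) = (\<lambda>p. gr G p \<inter> Im)"
  using sl_carrier by (simp_all add: sl31_def derived_def restrict_to_def)

lemma sl_lie: "lie_superalgebra K (sl31 K A)"
  by (rule G.restrict_lie[OF phi.image_submodule Im_hcomp Im_mult sl_carrier[symmetric] sl_simps])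

lemma phi_sl_hom: "phi \<in> lie_hom K S (sl31 K A)"
  using phi_hom unfolding lie_hom_def graded_hom_def
  by (auto simp: sl_carrier sl_simps S.gr_carrier image_subset_iff simp del: gl_simps)

lemma sl_incl_hom: "(\<lambda>x. x) \<in> lie_hom K (sl31 K A) G"
  using Im_carrier by (auto simp: sl_carrier sl_simps simp del: gl_simps intro!: lie_homI graded_homI)

lemma st31_to_sl31_eq: "st31_to_sl31 K A = restrict phi (carrier S)"
  unfolding st31_to_sl31_def
proof (rule the_equality)
  have "restrict phi (carrier S) \<in> lie_hom K S (sl31 K A)"
    using phi_sl_hom unfolding lie_hom_def graded_hom_def
    by (auto simp: S.gr_carrier S.mult_closed image_subset_iff)
  then show "restrict phi (carrier S) \<in> extensional (carrier S) \<and>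
    restrict phi (carrier S) \<in> lie_hom K S (sl31 K A) \<and>
    (\<forall>i j. \<forall>a\<in>carrier A. i \<noteq> j \<longrightarrow> restrict phi (carrier S) (F i j a) = E i j a)"
    by (auto simp: phi_F F_closed)
next
  fix f assume f: "f \<in> extensional (carrier S) \<and> f \<in> lie_hom K S (sl31 K A) \<and>
    (\<forall>i j. \<forall>a\<in>carrier A. i \<noteq> j \<longrightarrow> f (F i j a) = E i j a)"
  have "f x = phi x" if "x \<in> carrier S" for x
  proof (rule st_hom_unique[OF sl_lie _ phi_sl_hom _ that])
    show "f \<in> lie_hom K S (sl31 K A)" using f by blast
    fix i j :: index and a p assume *: "i \<noteq> j" "a \<in> gr A p"
    then show "f (F i j a) = phi (F i j a)" using f gr_carrier[OF *(2)] by (simp add: phi_F)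
  qed
  with f show "f = restrict phi (carrier S)" by (auto simp: extensional_def restrict_def fun_eq_iff)
qed

end

section \<open>The algebra \<open>A\<^sub>2\<close>\<close>

locale char2_cring = cring R for R (structure) +
  assumes double: "x \<in> carrier R \<Longrightarrow> x \<oplus> x = \<zero>"
begin

lemma double' [simp]: "x \<in> carrier R \<Longrightarrow> y \<in> carrier R \<Longrightarrow> x \<oplus> (x \<oplus> y) = y"
  by (simp add: a_assoc[symmetric] double)

lemma neg_eq [simp]: "x \<in> carrier R \<Longrightarrow> \<ominus> x = x"
  using minus_equality[of x x] double by simp

end

context coefficient_superalgebra
begin

text \<open>
  The ideal is abbreviated by \<open>J2\<close>, as \<open>I2\<close> is one of the four indices.
\<close>

abbreviation (input) "J2 \<equiv> I2_ideal A"
abbreviation (input) "c2 \<equiv> A2_class A"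

lemma commutator_gr:
  "a \<in> gr A p \<Longrightarrow> b \<in> gr A q \<Longrightarrow> a \<otimes> b \<ominus> psign A (p * q) (b \<otimes> a) \<in> gr A (p + q)"
  using super_commutator_gr[of a p b q] by (simp add: super_commutator_hom)

lemma I2_gens_carrier:
  "{a \<oplus> a |a. a \<in> carrier A} \<union>
   {a \<otimes> b \<ominus> psign A (p * q) (b \<otimes> a) |a b p q. a \<in> gr A p \<and> b \<in> gr A q} \<subseteq> carrier A"
  using gr_carrier[OF commutator_gr] by auto

lemma I2_ideal: "ideal J2 A"
  unfolding I2_ideal_def by (rule genideal_ideal[OF I2_gens_carrier])

sublocale I2: ideal "I2_ideal A" A by (rule I2_ideal)

lemma I2_incl:
  "a \<in> carrier A \<Longrightarrow> a \<oplus> a \<in> J2"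
  "a \<in> gr A p \<Longrightarrow> b \<in> gr A q \<Longrightarrow> a \<otimes> b \<ominus> psign A (p * q) (b \<otimes> a) \<in> J2"
  unfolding I2_ideal_def by (rule subsetD[OF genideal_self[OF I2_gens_carrier]], blast)+

lemma I2_least:
  assumes "ideal J A" "\<And>a. a \<in> carrier A \<Longrightarrow> a \<oplus> a \<in> J"
    "\<And>a b p q. a \<in> gr A p \<Longrightarrow> b \<in> gr A q \<Longrightarrow> a \<otimes> b \<ominus> psign A (p * q) (b \<otimes> a) \<in> J"
  shows "J2 \<subseteq> J"
  unfolding I2_ideal_def using assms by (intro genideal_minimal) auto

lemma I2_closed: "a \<in> J2 \<Longrightarrow> a \<in> carrier A"
  using I2.a_subset by blast

lemma c2_eq_iff: "a \<in> carrier A \<Longrightarrow> b \<in> carrier A \<Longrightarrow> c2 a = c2 b \<longleftrightarrow> a \<ominus> b \<in> J2"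
  unfolding A2_class_def using quotient_eq_iff_same_a_r_cos[OF I2_ideal] by simp

lemma c2_zero_iff: "a \<in> carrier A \<Longrightarrow> c2 a = c2 \<zero> \<longleftrightarrow> a \<in> J2"
  by (simp add: c2_eq_iff a_minus_def)

lemma I2_mult: "a \<in> J2 \<Longrightarrow> x \<in> carrier A \<Longrightarrow> x \<otimes> a \<in> J2" "a \<in> J2 \<Longrightarrow> x \<in> carrier A \<Longrightarrow> a \<otimes> x \<in> J2"
  by (simp_all add: I2.I_l_closed I2.I_r_closed)

lemma I2_add: "a \<in> J2 \<Longrightarrow> b \<in> J2 \<Longrightarrow> a \<oplus> b \<in> J2"
  by (rule I2.a_closed)

lemma I2_neg: "a \<in> J2 \<Longrightarrow> \<ominus> a \<in> J2"
  by (rule I2.a_inv_closed)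

lemma I2_smult:
  assumes "c \<in> carrier K" "a \<in> J2" shows "c \<odot> a \<in> J2"
  using I2_mult(1)[OF assms(2), of "c \<odot> \<one>"] assms I2_closed by (simp add: mult_smult_left)

text \<open>The generators \<open>a + a\<close> need not be homogeneous, but their components are again of this form.\<close>

lemma I2_hcomp:
  assumes "a \<in> J2" shows "hcomp A p a \<in> J2"
proof -
  let ?J = "{a \<in> carrier A. \<forall>p. hcomp A p a \<in> J2}"
  have l: "x \<otimes> a \<in> ?J" and r: "a \<otimes> x \<in> ?J" if a: "a \<in> ?J" and x: "x \<in> carrier A" for a x
  proof -
    have *: "hcomp A p (x \<otimes> a) \<in> J2 \<and> hcomp A p (a \<otimes> x) \<in> J2" for p
      using x
    proof (induction rule: gr_induct)
      case (hom q x)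
      have ac: "a \<in> carrier A" using a by simp
      note xc = gr_carrier[OF hom]
      have d: "a = hcomp A (p + q) a \<oplus> hcomp A (p + q + 1) a" using ac by (simp add: hcomp_decomp)
      have g: "x \<otimes> hcomp A (p + q) a \<in> gr A p" "x \<otimes> hcomp A (p + q + 1) a \<in> gr A (p + 1)"
        "hcomp A (p + q) a \<otimes> x \<in> gr A p" "hcomp A (p + q + 1) a \<otimes> x \<in> gr A (p + 1)"
        using mult_gr[OF hom hcomp_gr[OF ac, of "p + q"]] mult_gr[OF hom hcomp_gr[OF ac, of "p + q + 1"]]
          mult_gr[OF hcomp_gr[OF ac, of "p + q"] hom] mult_gr[OF hcomp_gr[OF ac, of "p + q + 1"] hom]
        by (simp_all add: ac_simps)
      have "x \<otimes> a = x \<otimes> hcomp A (p + q) a \<oplus> x \<otimes> hcomp A (p + q + 1) a"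
        "a \<otimes> x = hcomp A (p + q) a \<otimes> x \<oplus> hcomp A (p + q + 1) a \<otimes> x"
        using d ac xc by (metis hcomp_closed r_distr, metis hcomp_closed l_distr)
      then have "hcomp A p (x \<otimes> a) = x \<otimes> hcomp A (p + q) a" "hcomp A p (a \<otimes> x) = hcomp A (p + q) a \<otimes> x"
        using g by (simp_all add: hcomp_eq)
      then show ?case using a xc I2_mult by simp
    next
      case (add x y)
      then show ?case using a by (simp add: l_distr r_distr hcomp_add I2_add)
    qed
    show "x \<otimes> a \<in> ?J" "a \<otimes> x \<in> ?J" using * a x by auto
  qed
  have hneg: "hcomp A p (\<ominus> a) = \<ominus> hcomp A p a" if "a \<in> carrier A" for a p
    using hcomp_smult[of "\<ominus>\<^bsub>K\<^esub> \<one>\<^bsub>K\<^esub>" a p] that by (simp add: neg_smult)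
  have z: "hcomp A p \<zero> = \<zero>" for p by simp
  have zI: "\<zero> \<in> J2" by (rule I2.zero_closed)
  have "ideal ?J A"
  proof (rule idealI[OF ring_axioms _ l r])
    show "subgroup ?J (add_monoid A)"
      by (rule add.subgroupI)
        (use zI in \<open>auto simp: hcomp_add I2_add hneg I2_neg a_inv_def[symmetric] intro!: exI[of _ \<zero>]\<close>)
  qed
  moreover have mem: "x \<in> ?J" if x: "x \<in> gr A p" "x \<in> J2" for x p
  proof -
    have "hcomp A q x = (if q = p then x else \<zero>)" for q
      using hcomp_same[OF x(1)] hcomp_other[OF x(1)] by simp
    then show ?thesis using x zI gr_carrier[OF x(1)] by simp
  qed
  moreover have "a \<otimes> b \<ominus> psign A (p * q) (b \<otimes> a) \<in> ?J" if "a \<in> gr A p" "b \<in> gr A q" for a b p q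
    by (rule mem[OF commutator_gr[OF that] I2_incl(2)[OF that]])
  ultimately have "J2 \<subseteq> ?J"
    by (intro I2_least) (auto simp: hcomp_add I2_incl(1))
  then show ?thesis using assms by blast
qed

lemma A2_ops:
  "zero (A2 A) = zero (A Quot J2)" "add (A2 A) = add (A Quot J2)"
  "monoid.mult (A2 A) = monoid.mult (A Quot J2)" "one (A2 A) = one (A Quot J2)"
  by (simp_all add: A2_def Let_def)

lemma A2_carrier: "carrier (A2 A) = c2 ` carrier A"
  by (auto simp: A2_def Let_def FactRing_def A_RCOSETS_def' A2_class_def)

lemma c2_hom: "c2 \<in> ring_hom A (A Quot J2)"
  using I2.rcos_ring_hom by (simp add: A2_class_def[abs_def])

lemma c2_add: "a \<in> carrier A \<Longrightarrow> b \<in> carrier A \<Longrightarrow> c2 (a \<oplus> b) = c2 a \<oplus>\<^bsub>A2 A\<^esub> c2 b"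
  and c2_mult: "a \<in> carrier A \<Longrightarrow> b \<in> carrier A \<Longrightarrow> c2 (a \<otimes> b) = c2 a \<otimes>\<^bsub>A2 A\<^esub> c2 b"
  and c2_one: "\<one>\<^bsub>A2 A\<^esub> = c2 \<one>" and c2_zero: "\<zero>\<^bsub>A2 A\<^esub> = c2 \<zero>"
  using ring_hom_add[OF c2_hom] ring_hom_mult[OF c2_hom] ring_hom_one[OF c2_hom]
    ring_hom_zero[OF c2_hom ring_axioms I2.quotient_is_ring] by (simp_all add: A2_ops)

lemma c2_closed [simp]: "a \<in> carrier A \<Longrightarrow> c2 a \<in> carrier (A2 A)"
  by (simp add: A2_carrier)

lemma c2_double: "a \<in> carrier A \<Longrightarrow> c2 (a \<oplus> a) = c2 \<zero>"
  by (simp add: c2_zero_iff I2_incl(1))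

lemma c2_neg: "a \<in> carrier A \<Longrightarrow> c2 (\<ominus> a) = c2 a"
  using I2_neg[OF I2_incl(1)[of a]] by (simp add: c2_eq_iff a_minus_def minus_add)

lemma c2_psign: "a \<in> carrier A \<Longrightarrow> c2 (psign A r a) = c2 a"
  by (cases r) (simp_all add: c2_neg)

lemma c2_comm:
  assumes "a \<in> carrier A" "b \<in> carrier A"
  shows "c2 (a \<otimes> b) = c2 (b \<otimes> a)"
  using assms(1)
proof (induction rule: gr_induct)
  case (hom p a)
  from assms(2) show ?case
  proof (induction rule: gr_induct)
    case (hom q b)
    note c = gr_carrier[OF hom] gr_carrier[OF \<open>a \<in> gr A p\<close>]
    have "c2 (a \<otimes> b) = c2 (psign A (p * q) (b \<otimes> a))"
      using I2_incl(2)[OF \<open>a \<in> gr A p\<close> hom] c by (simp add: c2_eq_iff)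
    then show ?case using c by (simp add: c2_psign)
  next
    case (add x y)
    then show ?case using gr_carrier[OF hom] by (simp add: l_distr r_distr c2_add)
  qed
next
  case (add x y)
  then show ?case using assms(2) by (simp add: l_distr r_distr c2_add)
qed

lemma A2_cring: "char2_cring (A2 A)"
proof (intro char2_cring.intro char2_cring_axioms.intro)
  show "cring (A2 A)"
  proof (rule cringI)
    show "abelian_group (A2 A)"
      by (rule abelian_groupI)
        (auto simp: A2_carrier c2_add[symmetric] c2_zero a_ac r_neg intro!: bexI[of _ "\<ominus> x" for x])
    show "comm_monoid (A2 A)"
    proof (rule comm_monoidI)
      fix x y assume "x \<in> carrier (A2 A)" "y \<in> carrier (A2 A)"
      then show "x \<otimes>\<^bsub>A2 A\<^esub> y = y \<otimes>\<^bsub>A2 A\<^esub> x" by (auto simp: A2_carrier c2_mult[symmetric] c2_comm)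
    qed (auto simp: A2_carrier c2_mult[symmetric] c2_one m_assoc)
  qed (auto simp: A2_carrier c2_add[symmetric] c2_mult[symmetric] l_distr)
qed (auto simp: A2_carrier c2_add[symmetric] c2_zero c2_double)

lemma A2_smult:
  assumes "c \<in> carrier K" "a \<in> carrier A"
  shows "c \<odot>\<^bsub>A2 A\<^esub> c2 a = c2 (c \<odot> a)"
proof -
  have mem: "x \<in> c2 a \<Longrightarrow> x \<in> carrier A \<and> c2 x = c2 a" for x
    unfolding A2_class_def using assms(2) I2.a_elemrcos_carrier I2.a_repr_independence' by blast
  have "a \<in> c2 a" unfolding A2_class_def using assms(2) by (rule I2.a_rcos_self)
  then have ne: "c2 a \<noteq> {}" by (metis empty_iff)
  have const: "c2 (c \<odot> x) = c2 (c \<odot> a)" if "x \<in> c2 a" for x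
  proof -
    have "x \<ominus> a \<in> J2" using mem[OF that] assms c2_eq_iff by blast
    then have "c \<odot> (x \<ominus> a) \<in> J2" by (rule I2_smult[OF assms(1)])
    moreover have "x \<in> carrier A" using mem[OF that] by blast
    ultimately show ?thesis using c2_eq_iff[of "c \<odot> x" "c \<odot> a"] assms by (simp add: smult_minus)
  qed
  have "c \<odot>\<^bsub>A2 A\<^esub> c2 a = (\<Union>x\<in>c2 a. c2 (c \<odot> x))" by (simp only: A2_def Let_def module.simps)
  also have "\<dots> = (\<Union>x\<in>c2 a. c2 (c \<odot> a))" by (intro SUP_cong[OF HOL.refl] const)
  also have "\<dots> = c2 (c \<odot> a)" using ne by (simp only: UN_constant if_False)
  finally show ?thesis .
qed

lemma A2_gr: "gr (A2 A) p = c2 ` gr A p"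
  by (simp add: A2_def Let_def)

end

sublocale coefficient_superalgebra \<subseteq> A2: char2_cring "A2 A"
  by (rule A2_cring)

context coefficient_superalgebra
begin

lemma A2_graded: "graded_module K (A2 A)"
proof (rule graded_moduleI)
  show m: "module K (A2 A)"
    by (rule moduleI[OF R.is_cring A2.is_abelian_group])
      (auto simp: A2_carrier A2_smult c2_add[symmetric] smult_l_distr smult_r_distr smult_assoc1)
  fix p
  have "submodule (c2 ` gr A p) K (A2 A)"
  proof (rule module.submoduleI[OF m])
    fix x assume "x \<in> c2 ` gr A p"
    moreover then have "x \<in> carrier (A2 A)" using gr_carrier by auto
    ultimately show "\<ominus>\<^bsub>A2 A\<^esub> x \<in> c2 ` gr A p" by simp
  qed (auto simp: gr_carrier c2_zero c2_add[symmetric] A2_smult)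
  then show "submodule (gr (A2 A) p) K (A2 A)" by (simp add: A2_gr)
next
  fix x assume "x \<in> carrier (A2 A)"
  then obtain a where a: "a \<in> carrier A" "x = c2 a" by (auto simp: A2_carrier)
  then have "x = c2 (hcomp A 0 a) \<oplus>\<^bsub>A2 A\<^esub> c2 (hcomp A 1 a)"
    using hcomp_sum[of a] c2_add[of "hcomp A 0 a" "hcomp A 1 a"] by simp
  then show "\<exists>y\<in>gr (A2 A) 0. \<exists>z\<in>gr (A2 A) 1. x = y \<oplus>\<^bsub>A2 A\<^esub> z"
    using a by (auto simp: A2_gr intro!: bexI)
next
  fix x assume "x \<in> gr (A2 A) 0" "x \<in> gr (A2 A) 1"
  then obtain a b where ab: "a \<in> gr A 0" "b \<in> gr A 1" "x = c2 a" "c2 a = c2 b" by (auto simp: A2_gr)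
  then have "a \<ominus> b \<in> J2" using gr_carrier by (simp add: c2_eq_iff)
  then have "hcomp A 0 (a \<oplus> \<ominus> b) \<in> J2" using I2_hcomp by (simp add: a_minus_def)
  moreover have "hcomp A 0 (a \<oplus> \<ominus> b) = a" using ab by (intro hcomp_eq) auto
  ultimately have "a \<in> J2" by simp
  then show "x = \<zero>\<^bsub>A2 A\<^esub>" unfolding ab(3) c2_zero using c2_zero_iff[OF gr_carrier[OF ab(1)]] by blast
qed

end

section \<open>The module \<open>W\<close>\<close>

lemma parity_change_graded:
  assumes "graded_module K M" shows "graded_module K (parity_change M)"
proof -
  interpret M: graded_module K M by fact
  have ops: "carrier (parity_change M) = carrier M" "add (parity_change M) = add M"
    "zero (parity_change M) = zero M" "smult (parity_change M) = smult M"
    "gr (parity_change M) p = gr M (p + 1)" for p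
    by (simp_all add: parity_change_def)
  interpret P: module K "parity_change M" by (rule module_cong[OF M.module_axioms ops(1-4)])
  show ?thesis
  proof (rule graded_moduleI[OF P.module_axioms])
    fix p show "submodule (gr (parity_change M) p) K (parity_change M)"
      by (rule P.submoduleI) (auto simp: ops a_inv_cong[OF ops(1-3)] M.gr_carrier)
  next
    fix x assume "x \<in> carrier (parity_change M)"
    then show "\<exists>y\<in>gr (parity_change M) 0. \<exists>z\<in>gr (parity_change M) 1. x = y \<oplus>\<^bsub>parity_change M\<^esub> z"
      using M.gr_decomp[of x 1] by (simp add: ops) blast
  next
    fix x assume "x \<in> gr (parity_change M) 0" "x \<in> gr (parity_change M) 1"
    then show "x = \<zero>\<^bsub>parity_change M\<^esub>" using M.gr_disjoint[of x 0] by (simp add: ops)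
  qed
qed

lemma direct_power_graded:
  assumes "graded_module K M" shows "graded_module K (direct_power I M)"
proof -
  interpret M: graded_module K M by fact
  let ?D = "direct_power I M"
  have ops: "carrier ?D = I \<rightarrow>\<^sub>E carrier M" "\<zero>\<^bsub>?D\<^esub> = (\<lambda>i\<in>I. \<zero>\<^bsub>M\<^esub>)"
    "v \<oplus>\<^bsub>?D\<^esub> w = (\<lambda>i\<in>I. v i \<oplus>\<^bsub>M\<^esub> w i)" "c \<odot>\<^bsub>?D\<^esub> v = (\<lambda>i\<in>I. c \<odot>\<^bsub>M\<^esub> v i)"
    "gr ?D p = I \<rightarrow>\<^sub>E gr M p" for v w c p
    by (simp_all add: direct_power_def)
  have mem: "v \<in> I \<rightarrow>\<^sub>E B \<Longrightarrow> i \<in> I \<Longrightarrow> v i \<in> B" for v i B by (rule PiE_mem)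
  have grc: "v \<in> gr ?D p \<Longrightarrow> v \<in> carrier ?D" for v p
    unfolding ops using M.gr_carrier by (auto simp: PiE_iff)
  have eqI: "v = w" if "v \<in> carrier ?D" "w \<in> carrier ?D" "\<And>i. i \<in> I \<Longrightarrow> v i = w i" for v w
    using that unfolding ops by (rule PiE_ext)
  have ac: "v \<oplus>\<^bsub>?D\<^esub> w \<in> carrier ?D" if "v \<in> carrier ?D" "w \<in> carrier ?D" for v w
    using that by (simp add: ops mem restrict_PiE_iff)
  have sc: "c \<odot>\<^bsub>?D\<^esub> w \<in> carrier ?D" if "c \<in> carrier K" "w \<in> carrier ?D" for c w
    using that by (simp add: ops mem restrict_PiE_iff)
  have zc: "\<zero>\<^bsub>?D\<^esub> \<in> carrier ?D" by (simp add: ops restrict_PiE_iff)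
  have nc: "(\<lambda>i\<in>I. \<ominus>\<^bsub>M\<^esub> x i) \<in> carrier ?D" if "x \<in> carrier ?D" for x
    using that by (simp add: ops mem restrict_PiE_iff)
  have D: "module K ?D"
  proof (rule moduleI[OF M.R.is_cring])
    show "abelian_group ?D"
    proof (rule abelian_groupI)
      fix x assume x: "x \<in> carrier ?D"
      show "\<exists>y\<in>carrier ?D. y \<oplus>\<^bsub>?D\<^esub> x = \<zero>\<^bsub>?D\<^esub>"
        using x by (intro bexI[of _ "\<lambda>i\<in>I. \<ominus>\<^bsub>M\<^esub> x i"] eqI ac zc nc) (simp_all add: ops mem M.l_neg)
    next
      fix x y z assume "x \<in> carrier ?D" "y \<in> carrier ?D" "z \<in> carrier ?D"
      then show "x \<oplus>\<^bsub>?D\<^esub> y \<oplus>\<^bsub>?D\<^esub> z = x \<oplus>\<^bsub>?D\<^esub> (y \<oplus>\<^bsub>?D\<^esub> z)"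
        by (intro eqI ac) (simp_all add: ops mem M.a_assoc)
    next
      fix x y assume "x \<in> carrier ?D" "y \<in> carrier ?D"
      then show "x \<oplus>\<^bsub>?D\<^esub> y = y \<oplus>\<^bsub>?D\<^esub> x"
        by (intro eqI ac) (simp_all add: ops mem M.a_comm)
    next
      fix x assume "x \<in> carrier ?D"
      then show "\<zero>\<^bsub>?D\<^esub> \<oplus>\<^bsub>?D\<^esub> x = x"
        by (intro eqI ac zc) (simp_all add: ops mem)
    qed (fact zc ac)+
  next
    fix a b x assume "a \<in> carrier K" "b \<in> carrier K" "x \<in> carrier ?D"
    then show "(a \<oplus>\<^bsub>K\<^esub> b) \<odot>\<^bsub>?D\<^esub> x = a \<odot>\<^bsub>?D\<^esub> x \<oplus>\<^bsub>?D\<^esub> b \<odot>\<^bsub>?D\<^esub> x"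
      by (intro eqI ac sc M.R.a_closed) (simp_all add: ops mem M.smult_l_distr)
  next
    fix a x y assume "a \<in> carrier K" "x \<in> carrier ?D" "y \<in> carrier ?D"
    then show "a \<odot>\<^bsub>?D\<^esub> (x \<oplus>\<^bsub>?D\<^esub> y) = a \<odot>\<^bsub>?D\<^esub> x \<oplus>\<^bsub>?D\<^esub> a \<odot>\<^bsub>?D\<^esub> y"
      by (intro eqI ac sc) (simp_all add: ops mem M.smult_r_distr)
  next
    fix a b x assume "a \<in> carrier K" "b \<in> carrier K" "x \<in> carrier ?D"
    then show "(a \<otimes>\<^bsub>K\<^esub> b) \<odot>\<^bsub>?D\<^esub> x = a \<odot>\<^bsub>?D\<^esub> (b \<odot>\<^bsub>?D\<^esub> x)"
      by (intro eqI sc M.R.m_closed) (simp_all add: ops mem M.smult_assoc1)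
  next
    fix x assume "x \<in> carrier ?D"
    then show "\<one>\<^bsub>K\<^esub> \<odot>\<^bsub>?D\<^esub> x = x"
      by (intro eqI sc M.R.one_closed) (simp_all add: ops mem)
  qed (fact sc)
  interpret D: module K ?D by (rule D)
  have neg: "\<ominus>\<^bsub>?D\<^esub> x = (\<lambda>i\<in>I. \<ominus>\<^bsub>M\<^esub> x i)" if "x \<in> carrier ?D" for x
    using that by (intro D.minus_equality nc eqI ac zc) (simp_all add: ops mem M.l_neg)
  show ?thesis
  proof (rule graded_moduleI[OF D])
    fix p show "submodule (gr ?D p) K ?D"
    proof (rule D.submoduleI)
      show "gr ?D p \<subseteq> carrier ?D" using grc by blast
    next
      fix v assume "v \<in> gr ?D p"
      then show "\<ominus>\<^bsub>?D\<^esub> v \<in> gr ?D p" using neg[OF grc] by (simp add: ops mem restrict_PiE_iff)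
    qed (simp_all add: ops mem restrict_PiE_iff)
  next
    fix v assume v: "v \<in> carrier ?D"
    have "v = (\<lambda>i\<in>I. hcomp M 0 (v i)) \<oplus>\<^bsub>?D\<^esub> (\<lambda>i\<in>I. hcomp M 1 (v i))"
      using v M.hcomp_sum by (intro eqI ac) (simp_all add: ops mem restrict_PiE_iff)
    moreover have "(\<lambda>i\<in>I. hcomp M p (v i)) \<in> gr ?D p" for p
      using v by (simp add: ops mem restrict_PiE_iff)
    ultimately show "\<exists>y\<in>gr ?D 0. \<exists>z\<in>gr ?D 1. v = y \<oplus>\<^bsub>?D\<^esub> z" by blast
  next
    fix v assume v: "v \<in> gr ?D 0" "v \<in> gr ?D 1"
    show "v = \<zero>\<^bsub>?D\<^esub>"
    proof (rule eqI[OF grc[OF v(1)] zc])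
      fix i assume "i \<in> I"
      then show "v i = \<zero>\<^bsub>?D\<^esub> i" using v M.gr_disjoint[of "v i" 0] by (simp add: ops mem)
    qed
  qed
qed

context coefficient_superalgebra
begin

abbreviation (input) "W \<equiv> W_mod A"

lemma W_graded: "graded_module K W"
  unfolding W_mod_def by (intro direct_power_graded parity_change_graded A2_graded)

lemma W_simps:
  "carrier W = {1..6} \<rightarrow>\<^sub>E carrier (A2 A)" "\<zero>\<^bsub>W\<^esub> = (\<lambda>i\<in>{1..6}. \<zero>\<^bsub>A2 A\<^esub>)"
  "v \<oplus>\<^bsub>W\<^esub> w = (\<lambda>i\<in>{1..6}. v i \<oplus>\<^bsub>A2 A\<^esub> w i)" "c \<odot>\<^bsub>W\<^esub> v = (\<lambda>i\<in>{1..6}. c \<odot>\<^bsub>A2 A\<^esub> v i)"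
  "gr W p = {1..6} \<rightarrow>\<^sub>E gr (A2 A) (p + 1)"
  by (simp_all add: W_mod_def direct_power_def parity_change_def)

lemma W_mem: "v \<in> carrier W \<Longrightarrow> r \<in> {1..6} \<Longrightarrow> v r \<in> carrier (A2 A)"
  unfolding W_simps by (rule PiE_mem)

end

sublocale coefficient_superalgebra \<subseteq> A2: graded_module K "A2 A"
  by (rule A2_graded)

sublocale coefficient_superalgebra \<subseteq> W: graded_module K "W_mod A"
  by (rule W_graded)

context coefficient_superalgebra
begin

lemma W_neg:
  assumes "v \<in> carrier W" shows "\<ominus>\<^bsub>W\<^esub> v = v"
proof (rule W.minus_equality)
  show "v \<oplus>\<^bsub>W\<^esub> v = \<zero>\<^bsub>W\<^esub>"
    using W_mem[OF assms] by (auto simp: W_simps A2.double intro!: restrict_ext)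
qed (use assms in auto)

lemma W_psign: "v \<in> carrier W \<Longrightarrow> psign W r v = v"
  by (cases r) (simp_all add: W_neg)

end

section \<open>The cocycle\<close>

lemma index_UNIV: "distinct [i, j, k, l] \<Longrightarrow> (UNIV :: index set) = {i, j, k, l}"
proof -
  assume "distinct [i, j, k, l]"
  then have "card {i, j, k, l} = card (UNIV :: index set)" by (simp add: UNIV_index)
  from card_subset_eq[OF finite subset_UNIV this] show ?thesis by simp
qed

lemma quad_class_sym: "u \<in> quad_class v \<Longrightarrow> quad_class u = quad_class v"
  by (cases u; cases v) (auto simp: quad_class_def)

lemma quad_class_self: "u \<in> quad_class u"
  by (cases u) (simp add: quad_class_def)

lemma quad_class_quads: "u \<in> quads \<Longrightarrow> quad_class u \<subseteq> quads"
  by (cases u) (auto simp: quads_def quad_class_def)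

text \<open>
  The component of the cocycle at a class \<open>P r\<close> is given by a formula that is the same for all four
  members of the class; a representative is chosen to write it down.
\<close>

definition quad_rep :: "(nat \<Rightarrow> quad set) \<Rightarrow> nat \<Rightarrow> quad"
  where "quad_rep P r = (SOME u. u \<in> P r)"

context
  fixes P
  assumes P: "quad_labelling P"
begin

lemma P_class: "r \<in> {1..6} \<Longrightarrow> \<exists>u\<in>quads. P r = quad_class u"
  using P unfolding quad_labelling_def bij_betw_def by blast

lemma quad_rep: assumes "r \<in> {1..6}"
  shows "quad_rep P r \<in> quads" "P r = quad_class (quad_rep P r)"
proof -
  obtain u where u: "u \<in> quads" "P r = quad_class u" using P_class[OF assms] by blast
  then have "quad_rep P r \<in> quad_class u" unfolding quad_rep_def using quad_class_self[of u] by (simp add: some_in_eq) blast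
  then show "quad_rep P r \<in> quads" "P r = quad_class (quad_rep P r)"
    using u quad_class_quads[OF u(1)] quad_class_sym by blast+
qed

lemma theta:
  assumes "u \<in> quads"
  shows "theta P u \<in> {1..6}" and "r \<in> {1..6} \<Longrightarrow> u \<in> P r \<longleftrightarrow> r = theta P u"
proof -
  have inj: "inj_on P {1..6}" and img: "P ` {1..6} = quad_class ` quads"
    using P by (auto simp: quad_labelling_def bij_betw_def)
  obtain r0 where r0: "r0 \<in> {1..6}" "P r0 = quad_class u"
  proof -
    have "quad_class u \<in> P ` {1..6}" unfolding img using assms by (rule imageI)
    then show ?thesis using that by auto
  qed
  have un: "r = r0" if "r \<in> {1..6}" "u \<in> P r" for r
  proof -
    have "P r = quad_class u" using P_class[OF that(1)] that(2) quad_class_sym by metis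
    then show ?thesis using inj_onD[OF inj _ that(1) r0(1)] r0(2) by simp
  qed
  have "theta P u = r0" unfolding theta_def
  proof (rule the_equality)
    show "r0 \<in> {1..6} \<and> u \<in> P r0" using r0 quad_class_self[of u] by simp
  qed (use un in blast)
  then show "theta P u \<in> {1..6}" "r \<in> {1..6} \<Longrightarrow> u \<in> P r \<longleftrightarrow> r = theta P u"
    using r0 un quad_class_self[of u] by blast+
qed

end

text \<open>
  The polarisation of the determinant of the \<open>2\<times>2\<close> block with rows \<open>i, k\<close> and columns \<open>j, l\<close>;
  in characteristic 2 it does not change when the rows or the columns are exchanged.
\<close>

definition (in char2_cring) block :: "(index \<Rightarrow> index \<Rightarrow> 'a) \<Rightarrow> (index \<Rightarrow> index \<Rightarrow> 'a) \<Rightarrow> quad \<Rightarrow> 'a"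
  where "block X Y = (\<lambda>(i, j, k, l). (X i j \<otimes> Y k l \<oplus> X k l \<otimes> Y i j) \<oplus> (X i l \<otimes> Y k j \<oplus> X k j \<otimes> Y i l))"

definition (in char2_cring) dot :: "(index \<Rightarrow> index \<Rightarrow> 'a) \<Rightarrow> (index \<Rightarrow> index \<Rightarrow> 'a) \<Rightarrow> index \<Rightarrow> index \<Rightarrow> 'a"
  where "dot X Y i j = (\<Oplus>m\<in>UNIV. X i m \<otimes> Y m j)"

context char2_cring
begin

lemma dot_eq:
  assumes "distinct [i, j, k, l]" "\<And>m n. X m n \<in> carrier R" "\<And>m n. Y m n \<in> carrier R"
  shows "dot X Y m n = X m i \<otimes> Y i n \<oplus> (X m j \<otimes> Y j n \<oplus> (X m k \<otimes> Y k n \<oplus> X m l \<otimes> Y l n))"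
  using assms unfolding dot_def index_UNIV[OF assms(1)] by simp

lemma block_closed:
  "(\<And>m n. X m n \<in> carrier R) \<Longrightarrow> (\<And>m n. Y m n \<in> carrier R) \<Longrightarrow> block X Y u \<in> carrier R"
  by (cases u) (simp add: block_def)

text \<open>
  The rows \<open>i, k\<close> and columns \<open>j, l\<close> cut a matrix \<open>Z\<close> into a block \<open>Z\<^sub>B\<close> and two diagonal blocks \<open>Z\<^sub>A\<close>
  (rows and columns \<open>i, k\<close>) and \<open>Z\<^sub>D\<close> (rows and columns \<open>j, l\<close>). In characteristic 2 the block of
  \<open>XY + YX\<close> is \<open>(X\<^sub>A Y\<^sub>B + Y\<^sub>B X\<^sub>D) + (Y\<^sub>A X\<^sub>B + X\<^sub>B Y\<^sub>D)\<close>. The entry of the first summand in row \<open>i\<close> and column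
  \<open>j\<close> is \<open>act X Y i j k l\<close>, and \<open>act_block\<close> pairs this summand with the block of \<open>Z\<close>.
\<close>

definition act :: "(index \<Rightarrow> index \<Rightarrow> 'a) \<Rightarrow> (index \<Rightarrow> index \<Rightarrow> 'a) \<Rightarrow> index \<Rightarrow> index \<Rightarrow> index \<Rightarrow> index \<Rightarrow> 'a"
  where "act X Y i j k l = (X i i \<oplus> X j j) \<otimes> Y i j \<oplus> (X i k \<otimes> Y k j \<oplus> X l j \<otimes> Y i l)"

definition act_block where
  "act_block X Y Z i j k l = (act X Y i j k l \<otimes> Z k l \<oplus> act X Y k l i j \<otimes> Z i j)
    \<oplus> (act X Y i l k j \<otimes> Z k j \<oplus> act X Y k j i l \<otimes> Z i l)"

text \<open>
  The derivative of the determinant: if \<open>q\<close> is the polarised determinant, then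
  \<open>q(UB, B') + q(B, UB')\<close> is the trace of \<open>U\<close> times \<open>q(B, B')\<close>, and similarly for multiplication from
  the right.
\<close>

lemma act_block_sum:
  assumes X: "\<And>m n. X m n \<in> carrier R" and Y: "\<And>m n. Y m n \<in> carrier R" and Z: "\<And>m n. Z m n \<in> carrier R"
  shows "act_block X Y Z i j k l \<oplus> act_block X Z Y i j k l
    = (X i i \<oplus> (X j j \<oplus> (X k k \<oplus> X l l))) \<otimes> block Y Z (i, j, k, l)"
proof -
  define a b c d where "a = X i i" "b = X j j" "c = X k k" "d = X l l"
  define e f g h where "e = X i k" "f = X k i" "g = X j l" "h = X l j"
  define y1 y2 y3 y4 where "y1 = Y i j" "y2 = Y k l" "y3 = Y i l" "y4 = Y k j"
  define z1 z2 z3 z4 where "z1 = Z i j" "z2 = Z k l" "z3 = Z i l" "z4 = Z k j"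
  note defs = a_b_c_d_def e_f_g_h_def y1_y2_y3_y4_def z1_z2_z3_z4_def
  have cl: "a \<in> carrier R" "b \<in> carrier R" "c \<in> carrier R" "d \<in> carrier R"
    "e \<in> carrier R" "f \<in> carrier R" "g \<in> carrier R" "h \<in> carrier R"
    "y1 \<in> carrier R" "y2 \<in> carrier R" "y3 \<in> carrier R" "y4 \<in> carrier R"
    "z1 \<in> carrier R" "z2 \<in> carrier R" "z3 \<in> carrier R" "z4 \<in> carrier R"
    using X Y Z by (simp_all add: defs)
  show ?thesis
    unfolding act_block_def act_def block_def prod.case defs[symmetric] using cl
    by (simp add: l_distr r_distr m_ac a_ac double)
qed

lemma block_bracket:
  assumes d: "distinct [i, j, k, l]"
    and X: "\<And>m n. X m n \<in> carrier R" and Y: "\<And>m n. Y m n \<in> carrier R" and Z: "\<And>m n. Z m n \<in> carrier R"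
  shows "block (\<lambda>m n. dot X Y m n \<oplus> dot Y X m n) Z (i, j, k, l)
    = act_block X Y Z i j k l \<oplus> act_block Y X Z i j k l"
proof -
  have *: "dot X Y p q \<oplus> dot Y X p q = act X Y p q r s \<oplus> act Y X p q r s" if "distinct [p, q, r, s]" for p q r s
    unfolding dot_eq[OF that X Y] dot_eq[OF that Y X] act_def using X Y
    by (simp add: l_distr r_distr m_comm[of "X p q" "Y q q"] m_comm[of "X p q" "Y p p"]
        m_comm[of "Y p q" "X q q"] m_comm[of "Y p q" "X p p"] m_comm[of "X p s" "Y s q"]
        m_comm[of "Y p s" "X s q"] a_ac)
  have ac: "act X Y p q r s \<in> carrier R" "act Y X p q r s \<in> carrier R" for p q r s
    using X Y by (simp_all add: act_def)
  have d': "distinct [k, l, i, j]" "distinct [i, l, k, j]" "distinct [k, j, i, l]" using d by auto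
  show ?thesis
    unfolding block_def prod.case *[OF d] *[OF d'(1)] *[OF d'(2)] *[OF d'(3)] act_block_def
    using ac Z by (simp add: l_distr r_distr a_ac m_comm[OF Z ac(1)] m_comm[OF Z ac(2)])
qed

text \<open>
  By \<open>block_bracket\<close> the cyclic sum has six terms. They form three pairs as in \<open>act_block_sum\<close>, and each
  pair is a multiple of the trace of one of the three matrices.
\<close>

lemma block_jacobi:
  assumes d: "distinct [i, j, k, l]"
    and X: "\<And>m n. X m n \<in> carrier R" and Y: "\<And>m n. Y m n \<in> carrier R" and Z: "\<And>m n. Z m n \<in> carrier R"
    and tr: "X i i \<oplus> (X j j \<oplus> (X k k \<oplus> X l l)) = \<zero>" "Y i i \<oplus> (Y j j \<oplus> (Y k k \<oplus> Y l l)) = \<zero>"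
      "Z i i \<oplus> (Z j j \<oplus> (Z k k \<oplus> Z l l)) = \<zero>"
  shows "block (\<lambda>m n. dot X Y m n \<oplus> dot Y X m n) Z (i, j, k, l)
    \<oplus> block (\<lambda>m n. dot Y Z m n \<oplus> dot Z Y m n) X (i, j, k, l)
    \<oplus> block (\<lambda>m n. dot Z X m n \<oplus> dot X Z m n) Y (i, j, k, l) = \<zero>"
proof -
  have cl: "act_block U V W i j k l \<in> carrier R"
    if "\<And>m n. U m n \<in> carrier R" "\<And>m n. V m n \<in> carrier R" "\<And>m n. W m n \<in> carrier R" for U V W
    using that by (simp add: act_block_def act_def)
  have *: "act_block U V W i j k l = act_block U W V i j k l"
    if "\<And>m n. U m n \<in> carrier R" "\<And>m n. V m n \<in> carrier R" "\<And>m n. W m n \<in> carrier R"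
      "U i i \<oplus> (U j j \<oplus> (U k k \<oplus> U l l)) = \<zero>" for U V W
  proof -
    have "act_block U V W i j k l \<oplus> act_block U W V i j k l = \<zero>"
      unfolding act_block_sum[of U V W i j k l, OF that(1-3)] that(4)
      by (rule l_null) (rule block_closed[of V W, OF that(2,3)])
    from sum_zero_eq_neg[OF cl[OF that(1-3)] cl[OF that(1,3,2)] this] show ?thesis
      using cl[OF that(1,3,2)] by simp
  qed
  show ?thesis
    unfolding block_bracket[OF d X Y Z] block_bracket[OF d Y Z X] block_bracket[OF d Z X Y]
      *[of X Y Z, OF X Y Z tr(1)] *[of Y X Z, OF Y X Z tr(2)] *[of Z Y X, OF Z Y X tr(3)]
    using cl[OF X Z Y] cl[OF Y Z X] cl[OF Z X Y] by (simp add: a_ac double)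
qed

lemma trace_bracket:
  assumes X: "\<And>m n. X m n \<in> carrier R" and Y: "\<And>m n. Y m n \<in> carrier R" and d: "distinct [i, j, k, l]"
  shows "(dot X Y i i \<oplus> dot Y X i i) \<oplus> ((dot X Y j j \<oplus> dot Y X j j)
    \<oplus> ((dot X Y k k \<oplus> dot Y X k k) \<oplus> (dot X Y l l \<oplus> dot Y X l l))) = \<zero>"
  unfolding dot_eq[OF d X Y] dot_eq[OF d Y X] using X Y by (simp add: m_comm[OF Y X] a_ac double)

end

context coefficient_superalgebra
begin

abbreviation cm :: "(index \<Rightarrow> index \<Rightarrow> 'a) \<Rightarrow> index \<Rightarrow> index \<Rightarrow> 'a set"
  where "cm x \<equiv> \<lambda>i j. A2_class A (x i j)"

text \<open>
  Modulo \<open>I\<^sub>2\<close> all signs disappear, and the bracket is the ordinary commutator of matrices over \<open>A\<^sub>2\<close>.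
\<close>

lemma cm_bracket:
  assumes "x \<in> carrier G" "y \<in> carrier G"
  shows "c2 ((x \<otimes>\<^bsub>G\<^esub> y) i j) = A2.dot (cm x) (cm y) i j \<oplus>\<^bsub>A2 A\<^esub> A2.dot (cm y) (cm x) i j"
proof -
  have dot: "A2.dot (cm x) (cm y) i j = c2 ((x \<otimes>\<^bsub>mat_superalgebra A\<^esub> y) i j)"
    if "\<And>i j. x i j \<in> carrier A" "\<And>i j. y i j \<in> carrier A" for x y i j
    using that by (simp add: A2.dot_eq[of I1 I2 I3 I4] mat_mult c2_add c2_mult)
  have hom: "c2 ((x \<otimes>\<^bsub>G\<^esub> y) i j) = A2.dot (cm x) (cm y) i j \<oplus>\<^bsub>A2 A\<^esub> A2.dot (cm y) (cm x) i j"
    if xy: "x \<in> gr G p" "y \<in> gr G q" for x y p q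
  proof -
    have c: "\<And>i j. x i j \<in> carrier A" "\<And>i j. y i j \<in> carrier A" using xy[THEN G.gr_carrier] by auto
    have m: "(x \<otimes>\<^bsub>mat_superalgebra A\<^esub> y) i j \<in> carrier A" "(y \<otimes>\<^bsub>mat_superalgebra A\<^esub> x) i j \<in> carrier A"
      using c by (simp_all add: mat_mult)
    show ?thesis
      unfolding gl_mult_hom[OF xy] dot[OF c] dot[OF c(2,1)] a_minus_def
      using m by (simp add: c2_add c2_neg c2_psign)
  qed
  have dc: "A2.dot (cm x) (cm y) i j \<in> carrier (A2 A)" if "x \<in> carrier G" "y \<in> carrier G" for x y i j
    using that by (simp add: A2.dot_eq[of I1 I2 I3 I4])
  have dadd: "A2.dot (cm (x \<oplus>\<^bsub>G\<^esub> y)) (cm z) i j = A2.dot (cm x) (cm z) i j \<oplus>\<^bsub>A2 A\<^esub> A2.dot (cm y) (cm z) i j"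
    "A2.dot (cm z) (cm (x \<oplus>\<^bsub>G\<^esub> y)) i j = A2.dot (cm z) (cm x) i j \<oplus>\<^bsub>A2 A\<^esub> A2.dot (cm z) (cm y) i j"
    if "x \<in> carrier G" "y \<in> carrier G" "z \<in> carrier G" for x y z i j
    using that by (simp_all add: A2.dot_eq[of I1 I2 I3 I4] c2_add A2.l_distr A2.r_distr A2.a_ac)
  have cc: "(x \<otimes>\<^bsub>G\<^esub> y) i j \<in> carrier A" if "x \<in> carrier G" "y \<in> carrier G" for x y i j
    using G.mult_closed[OF that] by simp
  have cadd: "c2 ((x \<oplus>\<^bsub>G\<^esub> y) i j) = c2 (x i j) \<oplus>\<^bsub>A2 A\<^esub> c2 (y i j)" if "x i j \<in> carrier A" "y i j \<in> carrier A" for x y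
    using that by (simp add: c2_add)
  from assms(1) show ?thesis
  proof (induction rule: G.gr_induct)
    case (hom p x)
    from assms(2) show ?case
    proof (induction rule: G.gr_induct)
      case (hom q y)
      then show ?case using \<open>x \<in> gr G p\<close> by (intro \<open>\<And>x y p q. x \<in> gr G p \<Longrightarrow> y \<in> gr G q \<Longrightarrow> _ x y\<close>)
    next
      case (add y z)
      have x: "x \<in> carrier G" using hom by (rule G.gr_carrier)
      show ?case
        unfolding G.mult_add_right[OF x add(1,2)] cadd[OF cc[OF x add(1)] cc[OF x add(2)]] add.IH dadd[OF add(1,2) x]
        using dc[OF x add(1)] dc[OF x add(2)] dc[OF add(1) x] dc[OF add(2) x] by (simp add: A2.a_ac)
    qed
  next
    case (add x z)
    note y = assms(2)
    show ?case
      unfolding G.mult_add_left[OF add(1,2) y] cadd[OF cc[OF add(1) y] cc[OF add(2) y]] add.IH dadd[OF add(1,2) y]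
      using dc[OF y add(1)] dc[OF y add(2)] dc[OF add(1) y] dc[OF add(2) y] by (simp add: A2.a_ac)
  qed
qed

text \<open>The trace of a commutator vanishes over the commutative algebra \<open>A\<^sub>2\<close>.\<close>

lemma trace_Im:
  assumes "x \<in> carrier S" "distinct [i, j, k, l]"
  shows "cm (phi x) i i \<oplus>\<^bsub>A2 A\<^esub> (cm (phi x) j j \<oplus>\<^bsub>A2 A\<^esub> (cm (phi x) k k \<oplus>\<^bsub>A2 A\<^esub> cm (phi x) l l)) = \<zero>\<^bsub>A2 A\<^esub>"
  using assms(1)
proof (induction rule: S_induct)
  case (F m n a p)
  have "cm (phi (F m n a)) i i = \<zero>\<^bsub>A2 A\<^esub>" for i
    using F gr_carrier by (auto simp: phi_F E_elem_def c2_zero)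
  then show ?case by simp
next
  case zero
  then show ?case by (simp add: c2_zero[symmetric])
next
  case (add x y)
  then show ?case
    by (simp add: phi.add c2_add A2.a_ac)
next
  case (smult c x)
  have "cm (phi (c \<odot>\<^bsub>S\<^esub> x)) i j = c \<odot>\<^bsub>A2 A\<^esub> cm (phi x) i j" for i j
    using smult by (simp add: phi.smult A2_smult)
  then show ?case using smult by (simp flip: A2.smult_r_distr)
next
  case (mult x y)
  have "cm (phi (x \<otimes>\<^bsub>S\<^esub> y)) m m = A2.dot (cm (phi x)) (cm (phi y)) m m \<oplus>\<^bsub>A2 A\<^esub> A2.dot (cm (phi y)) (cm (phi x)) m m" for m
    using mult phi.closed by (simp only: phi_mult cm_bracket)
  then show ?case using A2.trace_bracket[OF _ _ assms(2), of "cm (phi x)" "cm (phi y)"] mult by simp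
qed

text \<open>
  The cocycle \<open>\<psi>\<close> as a form in the matrices that its arguments are mapped to. In this form it is bilinear
  by construction, without recourse to the decomposition of \<open>st(3,1,A)\<close>.
\<close>

definition Psi :: "(nat \<Rightarrow> quad set) \<Rightarrow> (index \<Rightarrow> index \<Rightarrow> 'a) \<Rightarrow> (index \<Rightarrow> index \<Rightarrow> 'a) \<Rightarrow> nat \<Rightarrow> 'a set"
  where "Psi P x y = (\<lambda>r\<in>{1..6}. A2.block (cm x) (cm y) (quad_rep P r))"

context
  fixes P
  assumes P: "quad_labelling P"
begin

lemma Psi_closed: "x \<in> carrier G \<Longrightarrow> y \<in> carrier G \<Longrightarrow> Psi P x y \<in> carrier W"
  by (simp add: Psi_def W_simps restrict_PiE_iff A2.block_closed)

lemma Psi_add: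
  assumes "x \<in> carrier G" "y \<in> carrier G" "z \<in> carrier G"
  shows "Psi P (x \<oplus>\<^bsub>G\<^esub> y) z = Psi P x z \<oplus>\<^bsub>W\<^esub> Psi P y z"
    and "Psi P z (x \<oplus>\<^bsub>G\<^esub> y) = Psi P z x \<oplus>\<^bsub>W\<^esub> Psi P z y"
proof -
  have "A2.block (cm (x \<oplus>\<^bsub>G\<^esub> y)) (cm z) u = A2.block (cm x) (cm z) u \<oplus>\<^bsub>A2 A\<^esub> A2.block (cm y) (cm z) u"
    "A2.block (cm z) (cm (x \<oplus>\<^bsub>G\<^esub> y)) u = A2.block (cm z) (cm x) u \<oplus>\<^bsub>A2 A\<^esub> A2.block (cm z) (cm y) u" for u
    using assms by (cases u; simp add: A2.block_def c2_add A2.l_distr A2.r_distr A2.a_ac)+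
  then show "Psi P (x \<oplus>\<^bsub>G\<^esub> y) z = Psi P x z \<oplus>\<^bsub>W\<^esub> Psi P y z"
    "Psi P z (x \<oplus>\<^bsub>G\<^esub> y) = Psi P z x \<oplus>\<^bsub>W\<^esub> Psi P z y"
    by (auto simp: Psi_def W_simps intro!: restrict_ext)
qed

lemma A2_smult_mult:
  assumes "c \<in> carrier K" "x \<in> carrier (A2 A)" "y \<in> carrier (A2 A)"
  shows "(c \<odot>\<^bsub>A2 A\<^esub> x) \<otimes>\<^bsub>A2 A\<^esub> y = c \<odot>\<^bsub>A2 A\<^esub> (x \<otimes>\<^bsub>A2 A\<^esub> y)"
    "x \<otimes>\<^bsub>A2 A\<^esub> (c \<odot>\<^bsub>A2 A\<^esub> y) = c \<odot>\<^bsub>A2 A\<^esub> (x \<otimes>\<^bsub>A2 A\<^esub> y)"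
  using assms by (auto simp: A2_carrier A2_smult c2_mult[symmetric] mult_smult_left mult_smult_right)

lemma Psi_smult:
  assumes "c \<in> carrier K" "x \<in> carrier G" "z \<in> carrier G"
  shows "Psi P (c \<odot>\<^bsub>G\<^esub> x) z = c \<odot>\<^bsub>W\<^esub> Psi P x z"
    and "Psi P z (c \<odot>\<^bsub>G\<^esub> x) = c \<odot>\<^bsub>W\<^esub> Psi P z x"
proof -
  have "A2.block (cm (c \<odot>\<^bsub>G\<^esub> x)) (cm z) u = c \<odot>\<^bsub>A2 A\<^esub> A2.block (cm x) (cm z) u"
    "A2.block (cm z) (cm (c \<odot>\<^bsub>G\<^esub> x)) u = c \<odot>\<^bsub>A2 A\<^esub> A2.block (cm z) (cm x) u" for u
    using assms by (cases u; simp add: A2.block_def A2_smult[symmetric] A2_smult_mult A2.smult_r_distr)+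
  then show "Psi P (c \<odot>\<^bsub>G\<^esub> x) z = c \<odot>\<^bsub>W\<^esub> Psi P x z" "Psi P z (c \<odot>\<^bsub>G\<^esub> x) = c \<odot>\<^bsub>W\<^esub> Psi P z x"
    by (auto simp: Psi_def W_simps intro!: restrict_ext)
qed

lemma Psi_sym:
  assumes "x \<in> carrier G" "y \<in> carrier G"
  shows "Psi P x y = Psi P y x"
proof -
  have "A2.block (cm x) (cm y) u = A2.block (cm y) (cm x) u" for u
    using assms by (cases u) (simp add: A2.block_def A2.m_comm A2.a_comm)
  then show ?thesis by (simp add: Psi_def)
qed

lemma Psi_alt:
  assumes "x \<in> carrier G"
  shows "Psi P x x = \<zero>\<^bsub>W\<^esub>"
proof -
  have "A2.block (cm x) (cm x) u = \<zero>\<^bsub>A2 A\<^esub>" for u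
    using assms by (cases u) (simp add: A2.block_def A2.m_comm A2.double)
  then show ?thesis by (auto simp: Psi_def W_simps intro!: restrict_ext)
qed

lemma Psi_gr:
  assumes "x \<in> gr G p" "y \<in> gr G q"
  shows "Psi P x y \<in> gr W (p + q)"
proof -
  have "A2.block (cm x) (cm y) u \<in> gr (A2 A) (p + q + 1)" if u: "u \<in> quads" for u
  proof -
    obtain i j k l where u': "u = (i, j, k, l)" by (cases u)
    have d: "distinct [i, j, k, l]" using u u' by (simp add: quads_def)
    \<comment> \<open>exactly one of four distinct indices is odd, which accounts for the parity change in \<open>W\<close>\<close>
    have par: "par i + par j + par k + par l = 1"
      using d by (cases i; cases j; cases k; cases l) auto
    have "c2 (x m n) \<otimes>\<^bsub>A2 A\<^esub> c2 (y m' n') \<in> gr (A2 A) (p + q + 1)"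
      if "par m + par n + par m' + par n' = 1" for m n m' n'
    proof -
      have xy: "x m n \<in> gr A (p + par m + par n)" "y m' n' \<in> gr A (q + par m' + par n')" using assms by auto
      have "x m n \<otimes> y m' n' \<in> gr A (p + q + (par m + par n + par m' + par n'))"
        using mult_gr[OF xy] by (simp add: ac_simps)
      then have "c2 (x m n \<otimes> y m' n') \<in> gr (A2 A) (p + q + 1)" unfolding that A2_gr by blast
      then show ?thesis using xy[THEN gr_carrier] by (simp add: c2_mult)
    qed
    then show ?thesis using par by (simp add: u' A2.block_def ac_simps)
  qed
  then show ?thesis using quad_rep[OF P] by (auto simp: Psi_def W_simps restrict_PiE_iff)
qed

lemma Psi_jacobi:
  assumes "x \<in> carrier S" "y \<in> carrier S" "z \<in> carrier S"
  shows "Psi P (phi x \<otimes>\<^bsub>G\<^esub> phi y) (phi z) \<oplus>\<^bsub>W\<^esub> Psi P (phi y \<otimes>\<^bsub>G\<^esub> phi z) (phi x)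
    \<oplus>\<^bsub>W\<^esub> Psi P (phi z \<otimes>\<^bsub>G\<^esub> phi x) (phi y) = \<zero>\<^bsub>W\<^esub>"
proof -
  note c = assms[THEN phi.closed]
  have "A2.block (cm (phi x \<otimes>\<^bsub>G\<^esub> phi y)) (cm (phi z)) u \<oplus>\<^bsub>A2 A\<^esub> A2.block (cm (phi y \<otimes>\<^bsub>G\<^esub> phi z)) (cm (phi x)) u
    \<oplus>\<^bsub>A2 A\<^esub> A2.block (cm (phi z \<otimes>\<^bsub>G\<^esub> phi x)) (cm (phi y)) u = \<zero>\<^bsub>A2 A\<^esub>" if "u \<in> quads" for u
  proof -
    obtain i j k l where u1: "u = (i, j, k, l)" by (cases u)
    then have u: "u = (i, j, k, l)" "distinct [i, j, k, l]" using that by (simp_all add: quads_def)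
    show ?thesis unfolding u(1) cm_bracket[OF c(1,2)] cm_bracket[OF c(2,3)] cm_bracket[OF c(3,1)]
      using assms by (intro A2.block_jacobi[OF u(2)] trace_Im[OF _ u(2)]) auto
  qed
  from this[OF quad_rep(1)[OF P]] show ?thesis
    unfolding Psi_def W_simps by (intro restrict_ext) (simp only: restrict_apply if_True)
qed

lemma Psi_E:
  assumes "a \<in> carrier A" "b \<in> carrier A"
  shows "Psi P (E i j a) (E k l b)
    = (if distinct [i, j, k, l] then W_incl A (theta P (i, j, k, l)) (c2 (a \<otimes> b)) else \<zero>\<^bsub>W\<^esub>)"
proof -
  have "A2.block (cm (E i j a)) (cm (E k l b)) u = (if (i, j, k, l) \<in> quad_class u then c2 (a \<otimes> b) else \<zero>\<^bsub>A2 A\<^esub>)"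
    if u: "u \<in> quads" for u
  proof -
    have E: "cm (E i j a) = (\<lambda>m n. if m = i \<and> n = j then c2 a else \<zero>\<^bsub>A2 A\<^esub>)" for i j a
      by (simp add: E_elem_def fun_eq_iff c2_zero)
    show ?thesis unfolding E using assms u
      by (cases u) (auto simp: A2.block_def quads_def quad_class_def c2_mult)
  qed
  note block = this
  show ?thesis
  proof (cases "distinct [i, j, k, l]")
    case True
    then have q: "(i, j, k, l) \<in> quads" by (simp add: quads_def)
    show ?thesis unfolding Psi_def W_incl_def using True
      by (auto simp: block quad_rep(1)[OF P] quad_rep(2)[OF P, symmetric] theta(2)[OF P q] intro!: restrict_ext)
  next
    case False
    then have q: "(i, j, k, l) \<notin> quads" by (simp add: quads_def)
    have "(i, j, k, l) \<notin> quad_class (quad_rep P r)" if "r \<in> {1..6}" for r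
      using q quad_class_quads[OF quad_rep(1)[OF P that]] by auto
    then have "A2.block (cm (E i j a)) (cm (E k l b)) (quad_rep P r) = \<zero>\<^bsub>A2 A\<^esub>" if "r \<in> {1..6}" for r
      using block[OF quad_rep(1)[OF P that]] that by (simp only: if_False)
    then show ?thesis unfolding Psi_def W_simps if_not_P[OF False] by (intro restrict_ext)
  qed
qed

end

end

section \<open>The extension of the Steinberg Lie superalgebra\<close>

locale labelled_superalgebra = coefficient_superalgebra K A
  for K :: "('k, 'r) ring_scheme" and A :: "('k, 'a) superalgebra" (structure) +
  fixes P :: "nat \<Rightarrow> quad set"
  assumes P: "quad_labelling P"
begin

lemmas Psi_closed = Psi_closed[OF P] and Psi_add = Psi_add[OF P] and Psi_smult = Psi_smult[OF P]
  and Psi_sym = Psi_sym[OF P] and Psi_alt = Psi_alt[OF P] and Psi_gr = Psi_gr[OF P]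
  and Psi_jacobi = Psi_jacobi[OF P] and Psi_E = Psi_E[OF P]

lemma Psi_diag:
  assumes "\<And>i j. i \<noteq> j \<Longrightarrow> h i j = \<zero>" "x \<in> carrier G"
  shows "Psi P x h = \<zero>\<^bsub>W\<^esub>" "Psi P h x = \<zero>\<^bsub>W\<^esub>"
proof -
  have "A2.block (cm x) (cm h) u = \<zero>\<^bsub>A2 A\<^esub> \<and> A2.block (cm h) (cm x) u = \<zero>\<^bsub>A2 A\<^esub>" if u: "u \<in> quads" for u
  proof -
    obtain i j k l where u1: "u = (i, j, k, l)" by (cases u)
    then have "i \<noteq> j" "k \<noteq> l" "i \<noteq> l" "k \<noteq> j" using u by (auto simp: quads_def)
    then show ?thesis using assms by (simp add: u1 A2.block_def c2_zero[symmetric])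
  qed
  note b = this[OF quad_rep(1)[OF P]]
  show "Psi P x h = \<zero>\<^bsub>W\<^esub>" "Psi P h x = \<zero>\<^bsub>W\<^esub>"
    unfolding Psi_def W_simps using b by (intro restrict_ext; blast)+
qed

lemma Psi_zero:
  assumes "x \<in> carrier G"
  shows "Psi P x (\<lambda>i j. \<zero>) = \<zero>\<^bsub>W\<^esub>" "Psi P (\<lambda>i j. \<zero>) x = \<zero>\<^bsub>W\<^esub>"
  using Psi_diag[of "\<lambda>i j. \<zero>" x] assms by simp_all

lemma phi_closed: "x \<in> carrier S \<Longrightarrow> phi x \<in> carrier G"
  by (rule phi.closed)

lemma is_psi_Psi:
  "is_psi K A P (\<lambda>(x, y)\<in>carrier S \<times> carrier S. Psi P (phi x) (phi y))"
  unfolding is_psi_def Let_def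
proof (intro conjI ballI allI impI)
  show "(\<lambda>(x, y)\<in>carrier S \<times> carrier S. Psi P (phi x) (phi y)) \<in> carrier S \<times> carrier S \<rightarrow>\<^sub>E carrier W"
    by (auto intro!: restrict_PiE_iff[THEN iffD2] Psi_closed simp del: gl_simps simp: phi_closed)
qed (auto simp: phi_closed phi.add phi.smult Psi_add Psi_smult phi_F F_closed Psi_E Hs_carrier phi_Hs
    intro: Psi_diag simp del: gl_simps)

text \<open>
  The conditions on \<open>\<psi>\<close> prescribe it on \<open>H\<close> and on all \<open>F\<^sub>i\<^sub>j(A)\<close>, which span the Steinberg Lie
  superalgebra.
\<close>

lemma is_psi_unique:
  assumes "is_psi K A P f" "x \<in> carrier S" "y \<in> carrier S"
  shows "f (x, y) = Psi P (phi x) (phi y)"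
proof -
  have f_add: "f (x \<oplus>\<^bsub>S\<^esub> y, z) = f (x, z) \<oplus>\<^bsub>W\<^esub> f (y, z)" "f (z, x \<oplus>\<^bsub>S\<^esub> y) = f (z, x) \<oplus>\<^bsub>W\<^esub> f (z, y)"
    if "x \<in> carrier S" "y \<in> carrier S" "z \<in> carrier S" for x y z
    using assms(1) that unfolding is_psi_def Let_def by blast+
  have fF: "f (F i j a, F k l b) =
         (if distinct [i, j, k, l] then W_incl A (theta P (i, j, k, l)) (A2_class A (a \<otimes> b)) else \<zero>\<^bsub>W\<^esub>)"
    if "a \<in> carrier A" "b \<in> carrier A" "i \<noteq> j" "k \<noteq> l" for i j k l a b
    using assms(1) that unfolding is_psi_def Let_def by blast
  have fH: "f (x, h) = \<zero>\<^bsub>W\<^esub>" "f (h, x) = \<zero>\<^bsub>W\<^esub>" if "x \<in> carrier S" "h \<in> Hs" for x h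
    using assms(1) that unfolding is_psi_def Let_def by blast+
  from assms(2) show ?thesis
  proof (induction rule: st_induct)
    case (H h)
    then show ?case using fH(2)[OF assms(3) H]
        Psi_diag(2)[OF phi_Hs[OF H] phi_closed[OF assms(3)]] by simp
  next
    case (F i j a)
    note Fx = F
    have c: "F i j a \<in> carrier S" using F by (simp add: F_closed)
    from assms(3) show ?case
    proof (induction rule: st_induct)
      case (H h)
      then show ?case using fH(1)[OF c H]
          Psi_diag(1)[OF phi_Hs[OF H] phi_closed[OF c]] by simp
    next
      case (F k l b)
      then show ?case using Fx by (simp add: fF phi_F Psi_E)
    next
      case (add y z)
      then show ?case using c phi_closed
        by (simp add: f_add phi.add Psi_add del: gl_simps)
    qed
  next
    case (add x z)
    then show ?case using assms(3) phi_closed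
      by (simp add: f_add phi.add Psi_add del: gl_simps)
  qed
qed

lemma psi_eq: "psi K A P = (\<lambda>(x, y)\<in>carrier S \<times> carrier S. Psi P (phi x) (phi y))"
  unfolding psi_def
proof (rule the_equality[where P = "is_psi K A P"])
  fix f assume f: "is_psi K A P f"
  then have "f \<in> carrier S \<times> carrier S \<rightarrow>\<^sub>E carrier W" unfolding is_psi_def Let_def by blast
  with is_psi_unique[OF f] show "f = (\<lambda>(x, y)\<in>carrier S \<times> carrier S. Psi P (phi x) (phi y))"
    by (auto simp: fun_eq_iff restrict_def PiE_iff extensional_def)
qed (rule is_psi_Psi)

lemma psi: "x \<in> carrier S \<Longrightarrow> y \<in> carrier S \<Longrightarrow> psi K A P (x, y) = Psi P (phi x) (phi y)"
  by (simp add: psi_eq)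

abbreviation (input) "SH \<equiv> st31_sharp K A P"

lemma SH_simps:
  "carrier SH = carrier S \<times> carrier W" "\<zero>\<^bsub>SH\<^esub> = (\<zero>\<^bsub>S\<^esub>, \<zero>\<^bsub>W\<^esub>)"
  "(x, v) \<oplus>\<^bsub>SH\<^esub> (y, w) = (x \<oplus>\<^bsub>S\<^esub> y, v \<oplus>\<^bsub>W\<^esub> w)" "c \<odot>\<^bsub>SH\<^esub> (x, v) = (c \<odot>\<^bsub>S\<^esub> x, c \<odot>\<^bsub>W\<^esub> v)"
  "gr SH p = gr S p \<times> gr W p"
  by (simp_all add: st31_sharp_def Let_def)

lemma SH_mult: "x \<in> carrier S \<Longrightarrow> y \<in> carrier S \<Longrightarrow> (x, v) \<otimes>\<^bsub>SH\<^esub> (y, w) = (x \<otimes>\<^bsub>S\<^esub> y, Psi P (phi x) (phi y))"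
  by (simp add: st31_sharp_def Let_def psi)

lemma SH_module: "module K SH"
proof (rule moduleI[OF R.is_cring])
  show "abelian_group SH"
  proof (rule abelian_groupI)
    fix x assume "x \<in> carrier SH"
    then show "\<exists>y\<in>carrier SH. y \<oplus>\<^bsub>SH\<^esub> x = \<zero>\<^bsub>SH\<^esub>"
      by (cases x) (auto simp: SH_simps S.M.l_neg W.M.l_neg intro!: bexI[of _ "(\<ominus>\<^bsub>S\<^esub> fst x, \<ominus>\<^bsub>W\<^esub> snd x)"])
  qed (auto simp: SH_simps S.M.a_ac W.M.a_ac)
qed (auto simp: SH_simps S.smult_l_distr S.smult_r_distr S.smult_assoc1
    W.smult_l_distr W.smult_r_distr W.smult_assoc1)

lemma SH_neg:
  assumes "x \<in> carrier S" "v \<in> carrier W" shows "\<ominus>\<^bsub>SH\<^esub> (x, v) = (\<ominus>\<^bsub>S\<^esub> x, \<ominus>\<^bsub>W\<^esub> v)"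
proof -
  interpret SH: module K SH by (rule SH_module)
  show ?thesis using assms by (intro SH.minus_equality) (simp_all add: SH_simps S.M.l_neg W.M.l_neg)
qed

lemma SH_psign:
  "x \<in> carrier S \<Longrightarrow> v \<in> carrier W \<Longrightarrow> psign SH r (x, v) = (psign S r x, psign W r v)"
  by (simp add: psign_def SH_neg)

lemma SH_graded: "graded_module K SH"
proof (rule graded_moduleI[OF SH_module])
  fix p show "submodule (gr SH p) K SH"
    by (rule module.submoduleI[OF SH_module]) (auto simp: SH_simps S.gr_carrier W.gr_carrier SH_neg)
next
  fix u assume "u \<in> carrier SH"
  then obtain x v where u: "u = (x, v)" "x \<in> carrier S" "v \<in> carrier W" by (auto simp: SH_simps)
  then have "u = (hcomp S 0 x, hcomp W 0 v) \<oplus>\<^bsub>SH\<^esub> (hcomp S 1 x, hcomp W 1 v)"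
    by (simp add: SH_simps S.hcomp_sum[symmetric] W.hcomp_sum[symmetric])
  moreover have "(hcomp S p x, hcomp W p v) \<in> gr SH p" for p using u by (simp add: SH_simps)
  ultimately show "\<exists>y\<in>gr SH 0. \<exists>z\<in>gr SH 1. u = y \<oplus>\<^bsub>SH\<^esub> z" by blast
next
  fix u assume "u \<in> gr SH 0" "u \<in> gr SH 1"
  then show "u = \<zero>\<^bsub>SH\<^esub>" using S.gr_disjoint[of "fst u" 0] W.gr_disjoint[of "snd u" 0] by (auto simp: SH_simps)
qed

lemma SH_lie: "lie_superalgebra K SH"
proof (rule lie_superalgebraI)
  show "superalgebra K SH"
  proof (rule superalgebraI[OF SH_graded])
    fix x y p q assume "x \<in> gr SH p" "y \<in> gr SH q"
    then show "x \<otimes>\<^bsub>SH\<^esub> y \<in> gr SH (p + q)"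
      using Psi_gr phi.gr by (auto simp: SH_simps SH_mult S.gr_carrier S.mult_gr simp del: gl_simps W_simps)
  qed (auto simp: SH_simps SH_mult S.mult_closed Psi_closed phi_closed S.mult_add_left S.mult_add_right
      S.mult_smult_left S.mult_smult_right phi.add phi.smult Psi_add Psi_smult simp del: gl_simps)
next
  fix u v p q assume "u \<in> gr SH p" "v \<in> gr SH q"
  then obtain x w y w' where u: "u = (x, w)" "x \<in> gr S p" and v: "v = (y, w')" "y \<in> gr S q" by (auto simp: SH_simps)
  note c = u(2)[THEN S.gr_carrier] v(2)[THEN S.gr_carrier]
  note xy = phi_closed[OF c(1)] phi_closed[OF c(2)]
  have W: "Psi P (phi y) (phi x) \<in> carrier W" using xy by (simp add: Psi_closed del: gl_simps)
  show "u \<otimes>\<^bsub>SH\<^esub> v = \<ominus>\<^bsub>SH\<^esub> psign SH (p * q) (v \<otimes>\<^bsub>SH\<^esub> u)"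
    using c W S.skew[OF u(2) v(2)] Psi_sym[OF xy]
    by (simp add: u(1) v(1) SH_mult SH_psign SH_neg S.mult_closed W_psign W_neg)
next
  fix u assume "u \<in> gr SH 0"
  then obtain x w where u: "u = (x, w)" "x \<in> gr S 0" by (auto simp: SH_simps)
  show "u \<otimes>\<^bsub>SH\<^esub> u = \<zero>\<^bsub>SH\<^esub>"
    using u(2) S.gr_carrier[OF u(2)] Psi_alt[OF phi_closed] S.even_alt by (simp add: u(1) SH_mult SH_simps(2))
next
  fix u v t p q r assume "u \<in> gr SH p" "v \<in> gr SH q" "t \<in> gr SH r"
  then obtain x w y w' z w'' where u: "u = (x, w)" "x \<in> gr S p" and v: "v = (y, w')" "y \<in> gr S q"
    and t: "t = (z, w'')" "z \<in> gr S r" by (auto simp: SH_simps)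
  note c = u(2)[THEN S.gr_carrier] v(2)[THEN S.gr_carrier] t(2)[THEN S.gr_carrier]
  have W: "Psi P (phi (x \<otimes>\<^bsub>S\<^esub> y)) (phi z) \<in> carrier W" if "x \<in> carrier S" "y \<in> carrier S" "z \<in> carrier S" for x y z
    using that by (simp add: Psi_closed phi_closed S.mult_closed del: gl_simps)
  show "psign SH (p * r) ((u \<otimes>\<^bsub>SH\<^esub> v) \<otimes>\<^bsub>SH\<^esub> t) \<oplus>\<^bsub>SH\<^esub> psign SH (p * q) ((v \<otimes>\<^bsub>SH\<^esub> t) \<otimes>\<^bsub>SH\<^esub> u)
        \<oplus>\<^bsub>SH\<^esub> psign SH (q * r) ((t \<otimes>\<^bsub>SH\<^esub> u) \<otimes>\<^bsub>SH\<^esub> v) = \<zero>\<^bsub>SH\<^esub>"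
    using c W S.jacobi[OF u(2) v(2) t(2)] Psi_jacobi[OF c]
    by (simp add: u(1) v(1) t(1) SH_mult SH_psign S.mult_closed W_psign SH_simps(2,3) phi_mult)
qed

lemma fst_hom: "fst \<in> lie_hom K SH S"
  by (intro lie_homI graded_homI) (auto simp: SH_simps SH_mult)

lemma SH_central:
  assumes "u \<in> carrier SH" "phi (fst u) = (\<lambda>i j. \<zero>)"
  shows "u \<in> centre SH"
  using assms kernel_central[OF _ assms(2)] Psi_zero(2)[OF phi_closed]
  by (auto simp: centre_def SH_simps SH_mult)

text \<open>
  The elements \<open>(0, \<epsilon>\<^sub>r(a))\<close> are the brackets of \<open>(F\<^sub>i\<^sub>j(a), 0)\<close> and \<open>(F\<^sub>k\<^sub>l(1), 0)\<close> for \<open>(i, j, k, l)\<close> in the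
  class \<open>r\<close>, and \<open>F\<^sub>i\<^sub>j(a) = [F\<^sub>i\<^sub>m(a), F\<^sub>m\<^sub>j(1)]\<close> where the cocycle vanishes.
\<close>

lemma SH_perfect:
  assumes N: "submodule N K SH" and br: "\<And>u v. u \<in> carrier SH \<Longrightarrow> v \<in> carrier SH \<Longrightarrow> u \<otimes>\<^bsub>SH\<^esub> v \<in> N"
  shows "carrier SH \<subseteq> N"
proof -
  interpret SH: graded_module K SH by (rule SH_graded)
  have zW: "\<zero>\<^bsub>W\<^esub> \<in> carrier W" by simp
  have br': "(x \<otimes>\<^bsub>S\<^esub> y, Psi P (phi x) (phi y)) \<in> N" if "x \<in> carrier S" "y \<in> carrier S" for x y
    using br[of "(x, \<zero>\<^bsub>W\<^esub>)" "(y, \<zero>\<^bsub>W\<^esub>)"] that by (simp add: SH_mult SH_simps(1))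
  have incl: "(\<zero>\<^bsub>S\<^esub>, W_incl A r v) \<in> N" if r: "r \<in> {1..6}" and v: "v \<in> carrier (A2 A)" for r v
  proof -
    obtain a where a: "a \<in> carrier A" "v = c2 a" using v by (auto simp: A2_carrier)
    obtain i j k l where u: "quad_rep P r = (i, j, k, l)" by (cases "quad_rep P r")
    have q: "(i, j, k, l) \<in> quads" using quad_rep(1)[OF P r] u by simp
    then have d: "distinct [i, j, k, l]" by (simp add: quads_def)
    have "(i, j, k, l) \<in> P r" using quad_rep(2)[OF P r] quad_class_self u by simp
    then have th: "theta P (i, j, k, l) = r" using theta(2)[OF P q r] by simp
    have "(F i j a \<otimes>\<^bsub>S\<^esub> F k l \<one>, Psi P (phi (F i j a)) (phi (F k l \<one>))) \<in> N"
      using d a by (intro br') (auto simp: F_closed)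
    then show ?thesis using d a th by (simp add: F_mult0 phi_F Psi_E)
  qed
  have W: "(\<zero>\<^bsub>S\<^esub>, w) \<in> N" if w: "w \<in> carrier W" for w
  proof -
    have "(\<zero>\<^bsub>S\<^esub>, \<lambda>r\<in>{1..6}. if r \<in> D then w r else \<zero>\<^bsub>A2 A\<^esub>) \<in> N" if "finite D" "D \<subseteq> {1..6}" for D
      using that
    proof (induction D)
      case empty
      then show ?case using SH.submodule_zero[OF N] by (simp add: SH_simps(2) W_simps restrict_def)
    next
      case (insert d D)
      have d: "d \<in> {1..6}" using insert by auto
      have wd: "w r \<in> carrier (A2 A)" if "r \<in> {1..6}" for r using W_mem[OF w that] .
      have eq: "(\<zero>\<^bsub>S\<^esub>, \<lambda>r\<in>{1..6}. if r \<in> insert d D then w r else \<zero>\<^bsub>A2 A\<^esub>)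
         = (\<zero>\<^bsub>S\<^esub>, W_incl A d (w d)) \<oplus>\<^bsub>SH\<^esub> (\<zero>\<^bsub>S\<^esub>, \<lambda>r\<in>{1..6}. if r \<in> D then w r else \<zero>\<^bsub>A2 A\<^esub>)"
        using wd d insert(2) by (simp add: SH_simps(3) W_simps W_incl_def) (intro restrict_ext, simp)
      have "D \<subseteq> {1..6}" using insert.prems by simp
      from SH.submoduleE(5)[OF N incl[OF d wd[OF d]] insert.IH[OF this]] show ?case unfolding eq .
    qed
    from this[of "{1..6}"] have "(\<zero>\<^bsub>S\<^esub>, \<lambda>r\<in>{1..6}. w r) \<in> N"
      by (simp cong: restrict_cong)
    moreover have "(\<lambda>r\<in>{1..6}. w r) = w" using w unfolding W_simps by (rule PiE_restrict)
    ultimately show ?thesis by simp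
  qed
  have S0: "(x, \<zero>\<^bsub>W\<^esub>) \<in> N" if "x \<in> carrier S" for x
    using that
  proof (induction rule: S_induct)
    case (F i j a p)
    have a: "a \<in> carrier A" using F gr_carrier by blast
    obtain m where m: "m \<noteq> i" "m \<noteq> j" using ex_third by blast
    have "(F i m a \<otimes>\<^bsub>S\<^esub> F m j \<one>, Psi P (phi (F i m a)) (phi (F m j \<one>))) \<in> N"
      using m a by (intro br') (auto simp: F_closed)
    moreover have "F i m a \<otimes>\<^bsub>S\<^esub> F m j \<one> = F i j a" using m a F by (intro F_factor[symmetric]) auto
    ultimately show ?case using m a by (simp add: phi_F Psi_E)
  next
    case zero
    then show ?case using W[of "\<zero>\<^bsub>W\<^esub>"] by simp
  next
    case (add x y)
    then show ?case using SH.submoduleE(5)[OF N add.IH] by (simp add: SH_simps(3))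
  next
    case (smult c x)
    then show ?case using SH.submoduleE(4)[OF N smult(1) smult.IH] by (simp add: SH_simps(4))
  next
    case (mult x y)
    have c: "Psi P (phi x) (phi y) \<in> carrier W" using mult by (simp add: Psi_closed phi_closed del: gl_simps)
    have "(x \<otimes>\<^bsub>S\<^esub> y, Psi P (phi x) (phi y)) \<oplus>\<^bsub>SH\<^esub> (\<zero>\<^bsub>S\<^esub>, Psi P (phi x) (phi y)) \<in> N"
      using mult c by (intro SH.submoduleE(5)[OF N] br' W)
    moreover have "Psi P (phi x) (phi y) \<oplus>\<^bsub>W\<^esub> Psi P (phi x) (phi y) = \<zero>\<^bsub>W\<^esub>"
      using W_neg[OF c] W.M.r_neg[OF c] by simp
    ultimately show ?case using mult by (simp add: SH_simps(3) S.mult_closed)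
  qed
  show ?thesis
  proof
    fix u assume "u \<in> carrier SH"
    then obtain x w where u: "u = (x, w)" "x \<in> carrier S" "w \<in> carrier W" by (auto simp: SH_simps(1))
    have "(x, \<zero>\<^bsub>W\<^esub>) \<oplus>\<^bsub>SH\<^esub> (\<zero>\<^bsub>S\<^esub>, w) \<in> N" using u S0 W by (intro SH.submoduleE(5)[OF N])
    then show "u \<in> N" using u by (simp add: SH_simps(3))
  qed
qed

end

section \<open>Twisting a bracket by a cocycle\<close>

text \<open>
  Adding a cocycle with central values to a bracket gives a Lie superalgebra again. The condition \<open>bb\<close>
  makes the iterated bracket differ from the original one by a single term.
\<close>

lemma (in lie_superalgebra) twist_lie:
  fixes b :: "'a \<Rightarrow> 'a \<Rightarrow> 'a"
  assumes T: "carrier T = carrier L" "add T = add L" "zero T = zero L" "smult T = smult L"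
     "gr T = gr L" "\<And>x y. x \<otimes>\<^bsub>T\<^esub> y = x \<otimes> y \<oplus> b x y"
    and closed: "\<And>x y. x \<in> carrier L \<Longrightarrow> y \<in> carrier L \<Longrightarrow> b x y \<in> carrier L"
    and add: "\<And>x y z. x \<in> carrier L \<Longrightarrow> y \<in> carrier L \<Longrightarrow> z \<in> carrier L \<Longrightarrow> b (x \<oplus> y) z = b x z \<oplus> b y z"
      "\<And>x y z. x \<in> carrier L \<Longrightarrow> y \<in> carrier L \<Longrightarrow> z \<in> carrier L \<Longrightarrow> b z (x \<oplus> y) = b z x \<oplus> b z y"
    and smult: "\<And>c x y. c \<in> carrier K \<Longrightarrow> x \<in> carrier L \<Longrightarrow> y \<in> carrier L \<Longrightarrow> b (c \<odot> x) y = c \<odot> b x y"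
      "\<And>c x y. c \<in> carrier K \<Longrightarrow> x \<in> carrier L \<Longrightarrow> y \<in> carrier L \<Longrightarrow> b x (c \<odot> y) = c \<odot> b x y"
    and gr: "\<And>x y p q. x \<in> gr L p \<Longrightarrow> y \<in> gr L q \<Longrightarrow> b x y \<in> gr L (p + q)"
    and skew_b: "\<And>x y p q. x \<in> gr L p \<Longrightarrow> y \<in> gr L q \<Longrightarrow> b x y = \<ominus> psign L (p * q) (b y x)"
    and alt: "\<And>x. x \<in> gr L 0 \<Longrightarrow> b x x = \<zero>"
    and central: "\<And>x y z. x \<in> carrier L \<Longrightarrow> y \<in> carrier L \<Longrightarrow> z \<in> carrier L \<Longrightarrow> b x y \<otimes> z = \<zero>"
    and bb: "\<And>x y z. x \<in> carrier L \<Longrightarrow> y \<in> carrier L \<Longrightarrow> z \<in> carrier L \<Longrightarrow> b (b x y) z = \<zero>"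
    and jac: "\<And>x y z p q r. x \<in> gr L p \<Longrightarrow> y \<in> gr L q \<Longrightarrow> z \<in> gr L r \<Longrightarrow>
      psign L (p * r) (b (x \<otimes> y) z) \<oplus> psign L (p * q) (b (y \<otimes> z) x) \<oplus> psign L (q * r) (b (z \<otimes> x) y) = \<zero>"
  shows "lie_superalgebra K T"
proof -
  have inv: "a_inv T = a_inv L" using T by (intro a_inv_cong)
  have ps: "psign T = psign L" by (intro ext) (simp only: psign_def inv)
  have ps_add: "psign L r (x \<oplus> y) = psign L r x \<oplus> psign L r y" if "x \<in> carrier L" "y \<in> carrier L" for r x y
    using that by (cases r) (simp_all add: M.minus_add)
  have tt: "(x \<otimes>\<^bsub>T\<^esub> y) \<otimes>\<^bsub>T\<^esub> z = (x \<otimes> y) \<otimes> z \<oplus> b (x \<otimes> y) z" if "x \<in> carrier L" "y \<in> carrier L" "z \<in> carrier L" for x y z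
    using that by (simp add: T(6) mult_add_left central add bb closed mult_closed)
  have g: "graded_module K T" by (rule graded_module_cong[OF graded_module_axioms T(1-5)])
  show ?thesis
  proof (rule lie_superalgebraI, unfold T(1-5) inv ps)
    show "superalgebra K T"
      by (rule superalgebraI[OF g])
        (simp_all add: T closed add smult gr mult_closed mult_add_left mult_add_right mult_smult_left
          mult_smult_right mult_gr smult_r_distr M.a_ac)
  next
    fix x y p q assume xy: "x \<in> gr L p" "y \<in> gr L q"
    have c: "x \<in> carrier L" "y \<in> carrier L" using xy gr_carrier by auto
    have "x \<otimes>\<^bsub>T\<^esub> y = \<ominus> psign L (p * q) (y \<otimes> x) \<oplus> \<ominus> psign L (p * q) (b y x)"
      unfolding T(6) using skew[OF xy] skew_b[OF xy] by (rule arg_cong2)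
    also have "\<dots> = \<ominus> psign L (p * q) (y \<otimes>\<^bsub>T\<^esub> x)"
      using c by (simp add: T(6) ps_add mult_closed closed M.minus_add M.a_comm)
    finally show "x \<otimes>\<^bsub>T\<^esub> y = \<ominus> psign L (p * q) (y \<otimes>\<^bsub>T\<^esub> x)" .
  next
    fix x assume "x \<in> gr L 0" then show "x \<otimes>\<^bsub>T\<^esub> x = \<zero>" by (simp add: T(6) alt even_alt)
  next
    fix x y z p q r assume xyz: "x \<in> gr L p" "y \<in> gr L q" "z \<in> gr L r"
    note c = xyz[THEN gr_carrier]
    let ?a = "psign L (p * r) ((x \<otimes> y) \<otimes> z)" and ?a' = "psign L (p * r) (b (x \<otimes> y) z)"
    let ?b = "psign L (p * q) ((y \<otimes> z) \<otimes> x)" and ?b' = "psign L (p * q) (b (y \<otimes> z) x)"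
    let ?c = "psign L (q * r) ((z \<otimes> x) \<otimes> y)" and ?c' = "psign L (q * r) (b (z \<otimes> x) y)"
    have cl: "?a \<in> carrier L" "?a' \<in> carrier L" "?b \<in> carrier L" "?b' \<in> carrier L" "?c \<in> carrier L" "?c' \<in> carrier L"
      using c by (simp_all add: mult_closed closed)
    have "(?a \<oplus> ?a') \<oplus> (?b \<oplus> ?b') \<oplus> (?c \<oplus> ?c') = (?a \<oplus> ?b \<oplus> ?c) \<oplus> (?a' \<oplus> ?b' \<oplus> ?c')"
      using cl by (simp add: M.a_ac)
    also have "\<dots> = \<zero>" unfolding jacobi[OF xyz] jac[OF xyz] by simp
    finally show "psign L (p * r) ((x \<otimes>\<^bsub>T\<^esub> y) \<otimes>\<^bsub>T\<^esub> z) \<oplus> psign L (p * q) ((y \<otimes>\<^bsub>T\<^esub> z) \<otimes>\<^bsub>T\<^esub> x)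
        \<oplus> psign L (q * r) ((z \<otimes>\<^bsub>T\<^esub> x) \<otimes>\<^bsub>T\<^esub> y) = \<zero>"
      using c by (simp add: tt ps_add mult_closed closed)
  qed
qed

section \<open>Lifting to a central extension\<close>

text \<open>
  A central extension \<open>\<tau>\<close> of a quotient \<open>L\<close> of the Steinberg Lie superalgebra that lies over the image
  of the canonical map. The two cases of interest are that \<open>L\<close> is this image and that \<open>q\<close> is the
  identity.
\<close>

locale central_lift = labelled_superalgebra K A P + M: lie_superalgebra K M + L: lie_superalgebra K L
  for K :: "('k, 'r) ring_scheme" and A :: "('k, 'a) superalgebra" (structure) and P
    and M :: "('k, 'n) superalgebra" and L :: "('k, 'l) superalgebra" +
  fixes \<tau> :: "'n \<Rightarrow> 'l" and q :: "('k, 'a st_gen) lterm set \<Rightarrow> 'l" and m :: "'l \<Rightarrow> index \<Rightarrow> index \<Rightarrow> 'a"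
  assumes tau: "\<tau> \<in> lie_hom K M L" "\<tau> ` carrier M = carrier L" "a_kernel M L \<tau> \<subseteq> centre M"
    and q: "q \<in> lie_hom K (st31 K A) L" "q ` carrier (st31 K A) = carrier L"
    and m: "m \<in> lie_hom K L (gl31 A)" "\<And>x. x \<in> carrier (st31 K A) \<Longrightarrow> m (q x) = phi x"

sublocale central_lift \<subseteq> tau: graded_map K M L \<tau>
  by unfold_locales (rule lie_homD(1)[OF tau(1)])

sublocale central_lift \<subseteq> q: graded_map K "st31 K A" L q
  by unfold_locales (rule lie_homD(1)[OF q(1)])

sublocale central_lift \<subseteq> m: graded_map K L "gl31 A" m
  by unfold_locales (rule lie_homD(1)[OF m(1)])

context central_lift
begin

lemmas tau_mult = lie_homD(2)[OF tau(1)] and q_mult = lie_homD(2)[OF q(1)] and m_mult = lie_homD(2)[OF m(1)]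

lemma kernel_left: "z \<in> carrier M \<Longrightarrow> \<tau> z = \<zero>\<^bsub>L\<^esub> \<Longrightarrow> x \<in> carrier M \<Longrightarrow> z \<otimes>\<^bsub>M\<^esub> x = \<zero>\<^bsub>M\<^esub>"
  using tau(3) by (auto simp: a_kernel_def' centre_def)

lemma kernel_right:
  assumes "z \<in> carrier M" "\<tau> z = \<zero>\<^bsub>L\<^esub>" "x \<in> carrier M" shows "x \<otimes>\<^bsub>M\<^esub> z = \<zero>\<^bsub>M\<^esub>"
proof -
  have "x \<otimes>\<^bsub>M\<^esub> z \<in> {\<zero>\<^bsub>M\<^esub>}"
  proof (rule M.transporter_right[OF M.carrier_is_submodule _ M.zero_submodule])
    show "z \<in> M.transporter (carrier M) {\<zero>\<^bsub>M\<^esub>}" using assms kernel_left by (simp add: M.transporter_def)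
  qed (use assms M.hcomp_same[OF M.gr_zero] in auto)
  then show ?thesis by simp
qed

lemma mult_depends:
  assumes "u \<in> carrier M" "u' \<in> carrier M" "v \<in> carrier M" "v' \<in> carrier M" "\<tau> u = \<tau> u'" "\<tau> v = \<tau> v'"
  shows "u \<otimes>\<^bsub>M\<^esub> v = u' \<otimes>\<^bsub>M\<^esub> v'"
proof -
  have *: "\<exists>z\<in>carrier M. \<tau> z = \<zero>\<^bsub>L\<^esub> \<and> u = u' \<oplus>\<^bsub>M\<^esub> z" if "u \<in> carrier M" "u' \<in> carrier M" "\<tau> u = \<tau> u'" for u u'
    using that by (intro bexI[of _ "\<ominus>\<^bsub>M\<^esub> u' \<oplus>\<^bsub>M\<^esub> u"])
      (auto simp: tau.add tau.neg L.M.l_neg M.M.r_neg2)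
  obtain z w where z: "z \<in> carrier M" "\<tau> z = \<zero>\<^bsub>L\<^esub>" "u = u' \<oplus>\<^bsub>M\<^esub> z"
    and w: "w \<in> carrier M" "\<tau> w = \<zero>\<^bsub>L\<^esub>" "v = v' \<oplus>\<^bsub>M\<^esub> w"
    using *[of u u'] *[of v v'] assms by blast
  show ?thesis unfolding z(3) w(3) using assms z(1,2) w(1,2)
    by (simp add: M.mult_add_left M.mult_add_right kernel_left kernel_right M.mult_closed)
qed

text \<open>
  The lifts need not be additive or homogeneous. Only their brackets are used, which do not depend on
  the choice of lifts by \<open>mult_depends\<close>, so \<open>B\<close> inherits all identities of a bracket.
\<close>

definition lift where "lift x = (SOME u. u \<in> carrier M \<and> \<tau> u = q x)"

lemma lift: assumes "x \<in> carrier S" shows "lift x \<in> carrier M" "\<tau> (lift x) = q x"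
proof -
  have "\<exists>u. u \<in> carrier M \<and> \<tau> u = q x" using assms tau(2) by (metis imageE q.closed)
  from someI_ex[OF this] show "lift x \<in> carrier M" "\<tau> (lift x) = q x" by (simp_all add: lift_def)
qed

definition B where "B x y = lift x \<otimes>\<^bsub>M\<^esub> lift y"

lemma B_eq:
  "\<lbrakk>x \<in> carrier S; y \<in> carrier S; u \<in> carrier M; v \<in> carrier M; \<tau> u = q x; \<tau> v = q y\<rbrakk> \<Longrightarrow> B x y = u \<otimes>\<^bsub>M\<^esub> v"
  unfolding B_def using lift by (intro mult_depends) auto

lemma B_closed [simp]: "x \<in> carrier S \<Longrightarrow> y \<in> carrier S \<Longrightarrow> B x y \<in> carrier M"
  by (simp add: B_def lift M.mult_closed)

lemma tau_B: "x \<in> carrier S \<Longrightarrow> y \<in> carrier S \<Longrightarrow> \<tau> (B x y) = q (x \<otimes>\<^bsub>S\<^esub> y)"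
  by (simp add: B_def lift tau_mult q_mult)

lemma B_add:
  assumes "x \<in> carrier S" "y \<in> carrier S" "z \<in> carrier S"
  shows "B (x \<oplus>\<^bsub>S\<^esub> y) z = B x z \<oplus>\<^bsub>M\<^esub> B y z" "B z (x \<oplus>\<^bsub>S\<^esub> y) = B z x \<oplus>\<^bsub>M\<^esub> B z y"
proof -
  have "B (x \<oplus>\<^bsub>S\<^esub> y) z = (lift x \<oplus>\<^bsub>M\<^esub> lift y) \<otimes>\<^bsub>M\<^esub> lift z"
    "B z (x \<oplus>\<^bsub>S\<^esub> y) = lift z \<otimes>\<^bsub>M\<^esub> (lift x \<oplus>\<^bsub>M\<^esub> lift y)"
    using assms by (intro B_eq; simp add: lift tau.add q.add)+
  then show "B (x \<oplus>\<^bsub>S\<^esub> y) z = B x z \<oplus>\<^bsub>M\<^esub> B y z" "B z (x \<oplus>\<^bsub>S\<^esub> y) = B z x \<oplus>\<^bsub>M\<^esub> B z y"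
    using assms by (simp_all add: B_def lift M.mult_add_left M.mult_add_right)
qed

lemma B_smult:
  assumes "c \<in> carrier K" "x \<in> carrier S" "z \<in> carrier S"
  shows "B (c \<odot>\<^bsub>S\<^esub> x) z = c \<odot>\<^bsub>M\<^esub> B x z" "B z (c \<odot>\<^bsub>S\<^esub> x) = c \<odot>\<^bsub>M\<^esub> B z x"
proof -
  have "B (c \<odot>\<^bsub>S\<^esub> x) z = (c \<odot>\<^bsub>M\<^esub> lift x) \<otimes>\<^bsub>M\<^esub> lift z" "B z (c \<odot>\<^bsub>S\<^esub> x) = lift z \<otimes>\<^bsub>M\<^esub> (c \<odot>\<^bsub>M\<^esub> lift x)"
    using assms by (intro B_eq; simp add: lift tau.smult q.smult)+
  then show "B (c \<odot>\<^bsub>S\<^esub> x) z = c \<odot>\<^bsub>M\<^esub> B x z" "B z (c \<odot>\<^bsub>S\<^esub> x) = c \<odot>\<^bsub>M\<^esub> B z x"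
    using assms by (simp_all add: B_def lift M.mult_smult_left M.mult_smult_right)
qed

lemma B_zero [simp]: "x \<in> carrier S \<Longrightarrow> B \<zero>\<^bsub>S\<^esub> x = \<zero>\<^bsub>M\<^esub>" "x \<in> carrier S \<Longrightarrow> B x \<zero>\<^bsub>S\<^esub> = \<zero>\<^bsub>M\<^esub>"
  using B_smult[of "\<zero>\<^bsub>K\<^esub>" "\<zero>\<^bsub>S\<^esub>" x] by simp_all

lemma B_neg:
  "x \<in> carrier S \<Longrightarrow> y \<in> carrier S \<Longrightarrow> B (\<ominus>\<^bsub>S\<^esub> x) y = \<ominus>\<^bsub>M\<^esub> B x y"
  using B_smult(1)[of "\<ominus>\<^bsub>K\<^esub> \<one>\<^bsub>K\<^esub>" x y] by (simp add: S.neg_smult M.neg_smult)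

lemma B_psign:
  "x \<in> carrier S \<Longrightarrow> y \<in> carrier S \<Longrightarrow> B (psign S r x) y = psign M r (B x y)"
  by (cases r) (simp_all add: B_neg)

lemma hom_lift: "x \<in> gr S p \<Longrightarrow> \<exists>u\<in>gr M p. \<tau> u = q x"
proof -
  assume x: "x \<in> gr S p"
  have c: "x \<in> carrier S" using x by (rule S.gr_carrier)
  have "\<tau> (hcomp M p (lift x)) = q x"
    using lift[OF c] L.hcomp_same[OF q.gr[OF x]] by (simp add: tau.hcomp)
  then show ?thesis using lift[OF c] by (intro bexI) auto
qed

lemma B_gr: assumes "x \<in> gr S p" "y \<in> gr S r" shows "B x y \<in> gr M (p + r)"
proof -
  obtain u v where "u \<in> gr M p" "\<tau> u = q x" "v \<in> gr M r" "\<tau> v = q y" using hom_lift assms by blast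
  then show ?thesis using B_eq[of x y u v] M.mult_gr[of u p v r] assms S.gr_carrier M.gr_carrier by simp
qed

lemma B_skew: assumes "x \<in> gr S p" "y \<in> gr S r" shows "B x y = \<ominus>\<^bsub>M\<^esub> psign M (p * r) (B y x)"
proof -
  obtain u v where "u \<in> gr M p" "\<tau> u = q x" "v \<in> gr M r" "\<tau> v = q y" using hom_lift assms by blast
  then show ?thesis using B_eq[of x y u v] B_eq[of y x v u] M.skew[of u p v r] assms S.gr_carrier M.gr_carrier by simp
qed

lemma B_leibniz:
  assumes "x \<in> gr S p" "y \<in> gr S r" "z \<in> gr S s"
  shows "B x (y \<otimes>\<^bsub>S\<^esub> z) = B (x \<otimes>\<^bsub>S\<^esub> y) z \<oplus>\<^bsub>M\<^esub> psign M (p * r) (B y (x \<otimes>\<^bsub>S\<^esub> z))"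
proof -
  obtain u v w where uvw: "u \<in> gr M p" "v \<in> gr M r" "w \<in> gr M s" and t: "\<tau> u = q x" "\<tau> v = q y" "\<tau> w = q z"
    using hom_lift assms by meson
  note c = uvw[THEN M.gr_carrier] and d = assms[THEN S.gr_carrier]
  have "B x (y \<otimes>\<^bsub>S\<^esub> z) = u \<otimes>\<^bsub>M\<^esub> (v \<otimes>\<^bsub>M\<^esub> w)" "B (x \<otimes>\<^bsub>S\<^esub> y) z = (u \<otimes>\<^bsub>M\<^esub> v) \<otimes>\<^bsub>M\<^esub> w"
    "B y (x \<otimes>\<^bsub>S\<^esub> z) = v \<otimes>\<^bsub>M\<^esub> (u \<otimes>\<^bsub>M\<^esub> w)"
    using c d t by (auto intro!: B_eq simp: S.mult_closed M.mult_closed tau_mult q_mult)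
  then show ?thesis using M.leibniz[OF uvw] by simp
qed

lemma B_left:
  assumes "x \<in> gr S p" "y \<in> gr S r" "z \<in> gr S s" "x \<otimes>\<^bsub>S\<^esub> z = \<zero>\<^bsub>S\<^esub>"
  shows "B x (y \<otimes>\<^bsub>S\<^esub> z) = B (x \<otimes>\<^bsub>S\<^esub> y) z"
  using B_leibniz[OF assms(1-3)] assms(1-3)[THEN S.gr_carrier] assms(4) by (simp add: S.mult_closed)

lemma B_right:
  assumes "x \<in> gr S p" "y \<in> gr S r" "z \<in> gr S s" "x \<otimes>\<^bsub>S\<^esub> y = \<zero>\<^bsub>S\<^esub>"
  shows "B x (y \<otimes>\<^bsub>S\<^esub> z) = psign M (p * r) (B y (x \<otimes>\<^bsub>S\<^esub> z))"
  using B_leibniz[OF assms(1-3)] assms(1-3)[THEN S.gr_carrier] assms(4) by (simp add: S.mult_closed)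

text \<open>
  Since \<open>F\<^sub>k\<^sub>j(cb) = [F\<^sub>k\<^sub>l(c), F\<^sub>l\<^sub>j(b)]\<close> and \<open>F\<^sub>i\<^sub>k(a)\<close> commutes with \<open>F\<^sub>l\<^sub>j(b)\<close>, the middle index can be changed
  and the factor \<open>c\<close> can be moved to the left.
\<close>

lemma B_shift:
  assumes d: "distinct [i, j, k, l]" and h: "a \<in> gr A p" "b \<in> gr A r" "c \<in> gr A s"
  shows "B (F i k a) (F k j (c \<otimes> b)) = B (F i l (a \<otimes> c)) (F l j b)"
proof -
  note g = h[THEN gr_carrier]
  have "B (F i k a) (F k l c \<otimes>\<^bsub>S\<^esub> F l j b) = B (F i k a \<otimes>\<^bsub>S\<^esub> F k l c) (F l j b)"
    using d g by (intro B_left[OF F_gr[OF _ h(1)] F_gr[OF _ h(3)] F_gr[OF _ h(2)]]) (auto simp: F_mult0)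
  moreover have "F k l c \<otimes>\<^bsub>S\<^esub> F l j b = F k j (c \<otimes> b)" "F i k a \<otimes>\<^bsub>S\<^esub> F k l c = F i l (a \<otimes> c)"
    using d g by (intro F_mult; auto)+
  ultimately show ?thesis by simp
qed

definition mid :: "index \<Rightarrow> index \<Rightarrow> index" where "mid i j = (SOME k. k \<noteq> i \<and> k \<noteq> j)"

lemma mid: "mid i j \<noteq> i" "mid i j \<noteq> j"
  using someI_ex[OF ex_third[of i j]] by (simp_all add: mid_def)

text \<open>
  The lift of \<open>F\<^sub>i\<^sub>j(a)\<close> that is used to construct a homomorphism; it is linear in \<open>a\<close> because \<open>B\<close> is
  bilinear. By \<open>B_chain\<close> it does not depend on the middle index.
\<close>

definition f where "f i j a = B (F i (mid i j) a) (F (mid i j) j \<one>)"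

lemma ex_fourth: assumes "distinct [i, j, k]" shows "\<exists>l::index. distinct [i, j, k, l]"
proof -
  have "card {i, j, k} \<noteq> card (UNIV :: index set)" using assms by (simp add: UNIV_index)
  then have "{i, j, k} \<noteq> UNIV" by metis
  then show ?thesis using assms by auto
qed

lemma B_chain:
  assumes d: "distinct [i, k, j]" and h: "a \<in> gr A p" "b \<in> gr A r"
  shows "B (F i k a) (F k j b) = f i j (a \<otimes> b)"
proof -
  note g = h[THEN gr_carrier]
  have ab: "a \<otimes> b \<in> gr A (p + r)" by (rule mult_gr[OF h])
  show ?thesis
  proof (cases "mid i j = k")
    case False
    then have "distinct [i, j, k, mid i j]" using d mid[of i j] mid[of i j, THEN not_sym] by auto
    from B_shift[OF this h(1) one_even h(2)] show ?thesis using g by (simp add: f_def)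
  next
    case True
    obtain l where "distinct [i, j, k, l]" using ex_fourth[of i j k] d by auto
    from B_shift[OF this h(1) one_even h(2)] B_shift[OF this ab one_even one_even] show ?thesis
      using g True by (simp add: f_def)
  qed
qed

lemma f_gr: "i \<noteq> j \<Longrightarrow> a \<in> gr A p \<Longrightarrow> f i j a \<in> gr M (par i + par j + p)"
  using B_gr[OF F_gr[of i "mid i j" a p] F_gr[of "mid i j" j \<one> 0]] mid[of i j] one_even
  by (simp add: f_def ac_simps)

lemma f_add: "i \<noteq> j \<Longrightarrow> a \<in> carrier A \<Longrightarrow> b \<in> carrier A \<Longrightarrow> f i j (a \<oplus> b) = f i j a \<oplus>\<^bsub>M\<^esub> f i j b"
  using mid[of i j] by (simp add: f_def F_add B_add F_closed not_sym)

lemma f_smult: "i \<noteq> j \<Longrightarrow> c \<in> carrier K \<Longrightarrow> a \<in> carrier A \<Longrightarrow> f i j (c \<odot> a) = c \<odot>\<^bsub>M\<^esub> f i j a"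
  using mid[of i j] by (simp add: f_def F_smult B_smult F_closed not_sym)

lemma tau_f: "i \<noteq> j \<Longrightarrow> a \<in> carrier A \<Longrightarrow> \<tau> (f i j a) = q (F i j a)"
  using mid[of i j] F_factor[of i "mid i j" j a] by (simp add: f_def tau_B F_closed not_sym)

lemma f_closed: "i \<noteq> j \<Longrightarrow> a \<in> carrier A \<Longrightarrow> f i j a \<in> carrier M"
  using mid[of i j] by (simp add: f_def F_closed not_sym)

lemma f_mult:
  "\<lbrakk>i \<noteq> j; k \<noteq> l; a \<in> carrier A; b \<in> carrier A\<rbrakk> \<Longrightarrow> f i j a \<otimes>\<^bsub>M\<^esub> f k l b = B (F i j a) (F k l b)"
  by (rule B_eq[symmetric]) (auto simp: F_closed f_closed tau_f)

text \<open>
  If the indices are not distinct, there is an index \<open>n\<close> different from all of them. Both factors of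
  \<open>F\<^sub>k\<^sub>l(b) = [F\<^sub>k\<^sub>n(b), F\<^sub>n\<^sub>l(1)]\<close> commute with \<open>F\<^sub>i\<^sub>j(a)\<close>.
\<close>

lemma B_vanish:
  assumes ne: "i \<noteq> j" "k \<noteq> l" "j \<noteq> k" "i \<noteq> l" and nd: "\<not> distinct [i, j, k, l]"
    and h: "a \<in> gr A p" "b \<in> gr A r"
  shows "B (F i j a) (F k l b) = \<zero>\<^bsub>M\<^esub>"
proof -
  have "card {i, j, k, l} < card (UNIV :: index set)"
  proof -
    have "card {i, j, k, l} < 4" using nd card_distinct[of "[i, j, k, l]"] card_length[of "[i, j, k, l]"] by fastforce
    then show ?thesis by (simp add: UNIV_index)
  qed
  then have "{i, j, k, l} \<noteq> UNIV" by (metis less_irrefl)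
  then obtain n where n: "n \<noteq> i" "n \<noteq> j" "n \<noteq> k" "n \<noteq> l" by auto
  note g = h[THEN gr_carrier]
  have F: "F k l b = F k n b \<otimes>\<^bsub>S\<^esub> F n l \<one>" using n ne g by (intro F_factor) auto
  have 1: "F i j a \<otimes>\<^bsub>S\<^esub> F k n b = \<zero>\<^bsub>S\<^esub>" "F i j a \<otimes>\<^bsub>S\<^esub> F n l \<one> = \<zero>\<^bsub>S\<^esub>"
    using n ne g by (simp_all add: F_mult0)
  have "B (F i j a) (F k n b \<otimes>\<^bsub>S\<^esub> F n l \<one>) = B (F i j a \<otimes>\<^bsub>S\<^esub> F k n b) (F n l \<one>)"
    using n ne 1 by (intro B_left[OF F_gr[OF _ h(1)] F_gr[OF _ h(2)] F_gr[OF _ one_even]]) auto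
  then show ?thesis unfolding F 1 using n ne by (simp add: F_closed)
qed

section \<open>The obstruction for four distinct indices\<close>

lemma par_even: "i \<noteq> I4 \<Longrightarrow> par i = 0"
  by (cases i) auto

lemma torsion_signs:
  assumes "x \<in> carrier M" "x \<oplus>\<^bsub>M\<^esub> x = \<zero>\<^bsub>M\<^esub>"
  shows "\<ominus>\<^bsub>M\<^esub> x = x" "psign M r x = x"
proof -
  show "\<ominus>\<^bsub>M\<^esub> x = x" using assms by (simp add: M.M.minus_equality)
  then show "psign M r x = x" by (simp add: psign_def)
qed

lemma torsion_sign_cong:
  assumes "x \<in> carrier M" "x \<oplus>\<^bsub>M\<^esub> x = \<zero>\<^bsub>M\<^esub>" "y = \<ominus>\<^bsub>M\<^esub> psign M r x \<or> y = psign M r x"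
  shows "y = x"
  using assms torsion_signs[OF assms(1,2)] by auto

text \<open>
  The two ways of writing \<open>F\<^sub>k\<^sub>l(bc)\<close> as a bracket, through the index \<open>i\<close> here and through \<open>j\<close> in the next
  lemma, give two expressions of the obstruction at \<open>(i, j, k, l)\<close> by the one at \<open>(k, j, i, l)\<close>. For
  \<open>a = 1\<close> their signs differ by \<open>-(-1)\<^bsup>|i| + |j|\<^esup>\<close>.
\<close>

lemma B_swap_left:
  assumes d: "distinct [i, j, k, l]" and h: "a \<in> gr A p" "b \<in> gr A r" "c \<in> gr A s"
  shows "B (F i j a) (F k l (b \<otimes> c))
    = \<ominus>\<^bsub>M\<^esub> psign M ((par i + par j + p) * (par k + par i + r)) (B (F k j (b \<otimes> a)) (F i l c))"
proof -
  note g = h[THEN gr_carrier]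
  have gr: "F i j a \<in> gr S (par i + par j + p)" "F k i b \<in> gr S (par k + par i + r)" "F i l c \<in> gr S (par i + par l + s)"
    using d h by (auto intro: F_gr)
  have "B (F i j a) (F k i b \<otimes>\<^bsub>S\<^esub> F i l c) = B (F i j a \<otimes>\<^bsub>S\<^esub> F k i b) (F i l c)"
    using d g by (intro B_left[OF gr]) (auto simp: F_mult0)
  moreover have "F i j a \<otimes>\<^bsub>S\<^esub> F k i b = \<ominus>\<^bsub>S\<^esub> psign S ((par i + par j + p) * (par k + par i + r)) (F k j (b \<otimes> a))"
  proof -
    have "F k i b \<otimes>\<^bsub>S\<^esub> F i j a = F k j (b \<otimes> a)" using d g by (intro F_mult) auto
    then show ?thesis using S.skew[OF gr(1,2)] by simp
  qed
  moreover have "F k i b \<otimes>\<^bsub>S\<^esub> F i l c = F k l (b \<otimes> c)" using d g by (intro F_mult) auto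
  moreover have "F k j (b \<otimes> a) \<in> carrier S" "F i l c \<in> carrier S" using d g by (auto intro: F_closed)
  ultimately show ?thesis by (simp add: B_neg B_psign)
qed

lemma B_swap_right:
  assumes d: "distinct [i, j, k, l]" and h: "a \<in> gr A p" "b \<in> gr A r" "c \<in> gr A s"
  shows "B (F i j a) (F k l (b \<otimes> c))
    = psign M ((par i + par j + p) * (par k + par j + r)) (B (F k j b) (F i l (a \<otimes> c)))"
proof -
  note g = h[THEN gr_carrier]
  have gr: "F i j a \<in> gr S (par i + par j + p)" "F k j b \<in> gr S (par k + par j + r)" "F j l c \<in> gr S (par j + par l + s)"
    using d h by (auto intro: F_gr)
  have "B (F i j a) (F k j b \<otimes>\<^bsub>S\<^esub> F j l c)
    = psign M ((par i + par j + p) * (par k + par j + r)) (B (F k j b) (F i j a \<otimes>\<^bsub>S\<^esub> F j l c))"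
    using d g by (intro B_right[OF gr]) (auto simp: F_mult0)
  moreover have "F k j b \<otimes>\<^bsub>S\<^esub> F j l c = F k l (b \<otimes> c)" "F i j a \<otimes>\<^bsub>S\<^esub> F j l c = F i l (a \<otimes> c)"
    using d g by (intro F_mult; auto)+
  ultimately show ?thesis by simp
qed

text \<open>
  If \<open>i\<close> and \<open>j\<close> are even, then the two expressions for \<open>a = c = 1\<close> are negatives of each other.
\<close>

lemma B_one_even:
  assumes d: "distinct [i, j, k, l]" and ij: "i \<noteq> I4" "j \<noteq> I4" and b: "b \<in> gr A r"
  shows "B (F i j \<one>) (F k l b) = B (F k j b) (F i l \<one>)"
    and "B (F k j b) (F i l \<one>) \<oplus>\<^bsub>M\<^esub> B (F k j b) (F i l \<one>) = \<zero>\<^bsub>M\<^esub>"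
proof -
  note bc = gr_carrier[OF b]
  have c: "B (F k j b) (F i l \<one>) \<in> carrier M" using d bc by (intro B_closed) (auto intro: F_closed)
  have 1: "B (F i j \<one>) (F k l b) = \<ominus>\<^bsub>M\<^esub> B (F k j b) (F i l \<one>)"
    using B_swap_left[OF d one_even b one_even] bc ij by (simp add: par_even)
  show 2: "B (F i j \<one>) (F k l b) = B (F k j b) (F i l \<one>)"
    using B_swap_right[OF d one_even b one_even] bc ij by (simp add: par_even)
  show "B (F k j b) (F i l \<one>) \<oplus>\<^bsub>M\<^esub> B (F k j b) (F i l \<one>) = \<zero>\<^bsub>M\<^esub>"
    using M.M.r_neg[OF c] 1 2 by simp
qed

text \<open>
  The odd index is in one of four positions. If it is neither in the second nor in the third one, then
  \<open>B_one_even\<close> applies directly; otherwise it applies after exchanging \<open>i\<close> with \<open>k\<close>, or \<open>(i, j)\<close> with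
  \<open>(k, l)\<close>.
\<close>

lemma B_torsion_one:
  assumes d: "distinct [i, j, k, l]" and b: "b \<in> gr A r"
  shows "B (F i j b) (F k l \<one>) \<oplus>\<^bsub>M\<^esub> B (F i j b) (F k l \<one>) = \<zero>\<^bsub>M\<^esub>"
proof -
  note bc = gr_carrier[OF b]
  have cl: "B (F i j b) (F k l c) \<in> carrier M" if "distinct [i, j, k, l]" "b \<in> carrier A" "c \<in> carrier A" for i j k l b c
    using that by (intro B_closed) (auto intro: F_closed)
  have main: "B (F i j b) (F k l \<one>) \<oplus>\<^bsub>M\<^esub> B (F i j b) (F k l \<one>) = \<zero>\<^bsub>M\<^esub>"
    if "distinct [i, j, k, l]" "j \<noteq> I4" "k \<noteq> I4" for i j k l
    using B_one_even(2)[of k j i l b r] that b by auto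
  consider "j \<noteq> I4" "k \<noteq> I4" | "k = I4" "j \<noteq> I4" "i \<noteq> I4" | "j = I4" "k \<noteq> I4" "l \<noteq> I4" using d by auto
  then show ?thesis
  proof cases
    case 1
    then show ?thesis using main d by blast
  next
    case 2
    have d': "distinct [k, j, i, l]" using d by auto
    have t: "B (F k j b) (F i l \<one>) \<oplus>\<^bsub>M\<^esub> B (F k j b) (F i l \<one>) = \<zero>\<^bsub>M\<^esub>"
      using main[OF d'] 2 by blast
    have "B (F i j b) (F k l \<one>) = B (F k j b) (F i l \<one>)"
      using B_swap_left[OF d b one_even one_even] bc by (intro torsion_sign_cong[OF cl[OF d' bc] t]) auto
    then show ?thesis using t by simp
  next
    case 3
    have d': "distinct [k, l, i, j]" "distinct [i, l, k, j]" using d by auto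
    have t: "B (F k l \<one>) (F i j b) \<oplus>\<^bsub>M\<^esub> B (F k l \<one>) (F i j b) = \<zero>\<^bsub>M\<^esub>"
      using B_one_even[OF d'(1) 3(2,3) b] by simp
    have "B (F i j b) (F k l \<one>) = B (F k l \<one>) (F i j b)"
      using B_skew[OF F_gr[OF _ b] F_gr[OF _ one_even], of i j k l] d
      by (intro torsion_sign_cong[OF cl[OF d'(1) _ bc] t]) auto
    then show ?thesis using t by simp
  qed
qed

lemma B_torsion:
  assumes d: "distinct [i, j, k, l]" and h: "a \<in> gr A p" "b \<in> gr A r"
  shows "B (F i j a) (F k l b) \<oplus>\<^bsub>M\<^esub> B (F i j a) (F k l b) = \<zero>\<^bsub>M\<^esub>"
proof -
  have d': "distinct [k, j, i, l]" using d by auto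
  note g = h[THEN gr_carrier]
  have t: "B (F k j (b \<otimes> a)) (F i l \<one>) \<oplus>\<^bsub>M\<^esub> B (F k j (b \<otimes> a)) (F i l \<one>) = \<zero>\<^bsub>M\<^esub>"
    by (rule B_torsion_one[OF d' mult_gr[OF h(2,1)]])
  have c: "B (F k j (b \<otimes> a)) (F i l \<one>) \<in> carrier M" using d g by (intro B_closed) (auto intro: F_closed)
  have "B (F i j a) (F k l b) = B (F k j (b \<otimes> a)) (F i l \<one>)"
    using B_swap_left[OF d h one_even] g by (intro torsion_sign_cong[OF c t]) auto
  then show ?thesis using t by simp
qed

text \<open>
  As the values are their own negatives, the signs can be dropped.
\<close>

lemma B_swap:
  assumes d: "distinct [i, j, k, l]" and h: "a \<in> gr A p" "b \<in> gr A r" "c \<in> gr A s"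
  shows "B (F i j a) (F k l (b \<otimes> c)) = B (F k j (b \<otimes> a)) (F i l c)"
    and "B (F i j a) (F k l (b \<otimes> c)) = B (F k j b) (F i l (a \<otimes> c))"
    and "B (F i j a) (F k l b) = B (F k l b) (F i j a)"
proof -
  have d': "distinct [k, j, i, l]" "distinct [k, l, i, j]" using d by auto
  note g = h[THEN gr_carrier]
  have c: "B (F k j (b \<otimes> a)) (F i l c) \<in> carrier M" "B (F k j b) (F i l (a \<otimes> c)) \<in> carrier M"
    "B (F k l b) (F i j a) \<in> carrier M"
    using d g by (auto intro!: B_closed F_closed)
  show "B (F i j a) (F k l (b \<otimes> c)) = B (F k j (b \<otimes> a)) (F i l c)"
    using B_swap_left[OF d h] by (intro torsion_sign_cong[OF c(1) B_torsion[OF d'(1) mult_gr[OF h(2,1)] h(3)]]) blast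
  show "B (F i j a) (F k l (b \<otimes> c)) = B (F k j b) (F i l (a \<otimes> c))"
    using B_swap_right[OF d h] by (intro torsion_sign_cong[OF c(2) B_torsion[OF d'(1) h(2) mult_gr[OF h(1,3)]]]) blast
  show "B (F i j a) (F k l b) = B (F k l b) (F i j a)"
    using B_skew[OF F_gr[OF _ h(1)] F_gr[OF _ h(2)], of i j k l] d
    by (intro torsion_sign_cong[OF c(3) B_torsion[OF d'(2) h(2,1)]]) auto
qed

text \<open>
  The obstruction at a quadruple as a function of one element of \<open>A\<close>; by \<open>B_gam\<close> its values for two
  elements reduce to it.
\<close>

definition gam :: "quad \<Rightarrow> 'a \<Rightarrow> 'n"
  where "gam = (\<lambda>(i, j, k, l) a. B (F i j a) (F k l \<one>))"

lemma gam_eq: "gam (i, j, k, l) a = B (F i j a) (F k l \<one>)"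
  by (simp add: gam_def)

lemma gam_closed: "u \<in> quads \<Longrightarrow> a \<in> carrier A \<Longrightarrow> gam u a \<in> carrier M"
  by (auto simp: gam_def quads_def intro!: B_closed F_closed)

lemma gam_add: "u \<in> quads \<Longrightarrow> a \<in> carrier A \<Longrightarrow> b \<in> carrier A \<Longrightarrow> gam u (a \<oplus> b) = gam u a \<oplus>\<^bsub>M\<^esub> gam u b"
  by (auto simp: gam_def quads_def F_add B_add F_closed)

lemma gam_smult: "u \<in> quads \<Longrightarrow> c \<in> carrier K \<Longrightarrow> a \<in> carrier A \<Longrightarrow> gam u (c \<odot> a) = c \<odot>\<^bsub>M\<^esub> gam u a"
  by (auto simp: gam_def quads_def F_smult B_smult F_closed)

lemma gam_zero: "u \<in> quads \<Longrightarrow> gam u \<zero> = \<zero>\<^bsub>M\<^esub>"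
  by (auto simp: gam_def quads_def F_closed)

lemma gam_tau: "u \<in> quads \<Longrightarrow> a \<in> carrier A \<Longrightarrow> \<tau> (gam u a) = \<zero>\<^bsub>L\<^esub>"
  by (auto simp: gam_def quads_def tau_B F_closed F_mult0)

lemma gam_gr:
  assumes "u \<in> quads" "a \<in> gr A (p + 1)" shows "gam u a \<in> gr M p"
proof -
  obtain i j k l where u: "u = (i, j, k, l)" by (cases u)
  have d: "distinct [i, j, k, l]" using assms(1) u by (simp add: quads_def)
  have par: "par i + par j + par k + par l = 1" using d by (cases i; cases j; cases k; cases l) auto
  have "gam u a \<in> gr M ((par i + par j + (p + 1)) + (par k + par l + 0))"
    unfolding u gam_eq using d assms(2) one_even by (intro B_gr F_gr) auto
  moreover have "(par i + par j + (p + 1)) + (par k + par l + 0) = p"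
  proof -
    have "(par i + par j + (p + 1)) + (par k + par l + 0) = p + 1 + (par i + par j + par k + par l)"
      by (simp add: ac_simps)
    also have "\<dots> = p" unfolding par by (simp add: add.assoc)
    finally show ?thesis .
  qed
  ultimately show ?thesis by (simp only:)
qed

lemma gam_torsion:
  assumes u: "u \<in> quads" and a: "a \<in> carrier A"
  shows "gam u a \<oplus>\<^bsub>M\<^esub> gam u a = \<zero>\<^bsub>M\<^esub>"
  using a
proof (induction rule: gr_induct)
  case (hom p a)
  then show ?case using u B_torsion_one by (auto simp: gam_def quads_def)
next
  case (add a b)
  have "(gam u a \<oplus>\<^bsub>M\<^esub> gam u b) \<oplus>\<^bsub>M\<^esub> (gam u a \<oplus>\<^bsub>M\<^esub> gam u b)
    = (gam u a \<oplus>\<^bsub>M\<^esub> gam u a) \<oplus>\<^bsub>M\<^esub> (gam u b \<oplus>\<^bsub>M\<^esub> gam u b)"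
    using add(1,2) u by (simp add: gam_closed M.M.a_ac)
  then show ?case using add u by (simp add: gam_add)
qed

lemma gam_psign: "u \<in> quads \<Longrightarrow> a \<in> carrier A \<Longrightarrow> gam u (\<ominus> psign A r a) = gam u a"
proof -
  assume u: "u \<in> quads" and a: "a \<in> carrier A"
  have "gam u (\<ominus> a) = gam u a" if "a \<in> carrier A" for a
    using gam_smult[OF u, of "\<ominus>\<^bsub>K\<^esub> \<one>\<^bsub>K\<^esub>" a] that gam_closed[OF u that]
      torsion_signs(1)[OF gam_closed[OF u that] gam_torsion[OF u that]] by (simp add: neg_smult M.neg_smult)
  then show ?thesis using a by (cases r) simp_all
qed

lemma B_gam:
  assumes d: "distinct [i, j, k, l]" and h: "a \<in> gr A p" "b \<in> gr A r"
  shows "B (F i j a) (F k l b) = gam (i, j, k, l) (b \<otimes> a)"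
    and "gam (i, j, k, l) a = gam (k, j, i, l) a" and "gam (i, j, k, l) a = gam (k, l, i, j) a"
    and "gam (i, j, k, l) (a \<otimes> b) = gam (i, j, k, l) (b \<otimes> a)"
proof -
  have d': "distinct [k, j, i, l]" "distinct [k, l, i, j]" using d by auto
  note g = h[THEN gr_carrier]
  have swap: "gam (i, j, k, l) x = gam (k, j, i, l) x" if "x \<in> gr A s" "distinct [i, j, k, l]" for x s i j k l
    using B_swap(1)[OF that(2,1) one_even one_even] gr_carrier[OF that(1)] by (simp add: gam_eq)
  have eq: "B (F i j a) (F k l b) = gam (i, j, k, l) (b \<otimes> a)"
    if h: "a \<in> gr A p" "b \<in> gr A r" and d: "distinct [i, j, k, l]" for a b p r i j k l
    using B_swap(1)[OF d h one_even] h[THEN gr_carrier] swap[OF mult_gr[OF h(2,1)] d] by (simp add: gam_eq)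
  show "B (F i j a) (F k l b) = gam (i, j, k, l) (b \<otimes> a)" by (rule eq[OF h d])
  show "gam (i, j, k, l) a = gam (k, j, i, l) a" by (rule swap[OF h(1) d])
  show "gam (i, j, k, l) a = gam (k, l, i, j) a"
    using B_swap(3)[OF d h(1) one_even one_even] eq[OF one_even h(1) d'(2)] g by (simp add: gam_eq)
  show "gam (i, j, k, l) (a \<otimes> b) = gam (i, j, k, l) (b \<otimes> a)"
    using B_swap(2)[OF d h one_even] eq[OF h d] eq[OF h(2,1) d'(1)] swap[OF mult_gr[OF h] d] g by simp
qed

text \<open>
  The element \<open>c\<close> can be moved from the right of \<open>b\<close> to its left by exchanging the roles of \<open>i\<close> and \<open>k\<close>.
\<close>

lemma gam_cyc:
  assumes d: "distinct [i, j, k, l]" and h: "a \<in> gr A p" "b \<in> gr A r" "c \<in> gr A s"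
  shows "gam (i, j, k, l) ((b \<otimes> c) \<otimes> a) = gam (i, j, k, l) ((c \<otimes> b) \<otimes> a)"
proof -
  have d': "distinct [k, j, i, l]" using d by auto
  note g = h[THEN gr_carrier]
  have "gam (i, j, k, l) ((b \<otimes> c) \<otimes> a) = B (F i j a) (F k l (b \<otimes> c))"
    using B_gam(1)[OF d h(1) mult_gr[OF h(2,3)]] by simp
  also have "\<dots> = gam (k, j, i, l) (c \<otimes> (b \<otimes> a))"
    using B_swap(1)[OF d h] B_gam(1)[OF d' mult_gr[OF h(2,1)] h(3)] by simp
  also have "\<dots> = gam (i, j, k, l) ((c \<otimes> b) \<otimes> a)"
    using B_gam(2)[OF d mult_gr[OF h(3) mult_gr[OF h(2,1)]] one_even] g by (simp add: m_assoc)
  finally show ?thesis .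
qed

text \<open>
  By \<open>B_gam(4)\<close> the argument can be rotated, so that \<open>gam_cyc\<close> applies to the product \<open>ab\<close>.
\<close>

lemma gam_inner:
  assumes u: "u \<in> quads" and h: "a \<in> gr A p" "b \<in> gr A r" and yz: "y \<in> carrier A" "z \<in> carrier A"
  shows "gam u (y \<otimes> (a \<otimes> b) \<otimes> z) = gam u (y \<otimes> (b \<otimes> a) \<otimes> z)"
  using yz(1)
proof (induction rule: gr_induct)
  case (hom s y)
  note y = hom
  from yz(2) show ?case
  proof (induction rule: gr_induct)
    case (hom t z)
    obtain i j k l where u': "u = (i, j, k, l)" by (cases u)
    have d: "distinct [i, j, k, l]" using u u' by (simp add: quads_def)
    note g = h[THEN gr_carrier] y[THEN gr_carrier] hom[THEN gr_carrier]
    have *: "gam u (y \<otimes> (a \<otimes> b) \<otimes> z) = gam u ((a \<otimes> b) \<otimes> (z \<otimes> y))"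
      if "a \<in> gr A p" "b \<in> gr A r" for a b p r
      using B_gam(4)[OF d y mult_gr[OF mult_gr[OF that] hom]] g that[THEN gr_carrier] unfolding u'
      by (simp add: m_assoc)
    show ?case
      unfolding *[OF h] *[OF h(2,1)] unfolding u' by (rule gam_cyc[OF d mult_gr[OF hom y] h])
  next
    case (add z w)
    then show ?case using u h[THEN gr_carrier] gr_carrier[OF y] by (simp add: r_distr gam_add)
  qed
next
  case (add x w)
  then show ?case using u h[THEN gr_carrier] yz(2) by (simp add: l_distr gam_add)
qed

text \<open>
  The elements \<open>x\<close> such that \<open>gam u\<close> vanishes on all products \<open>yxz\<close> form an ideal; it contains the elements
  \<open>a + a\<close> by \<open>gam_torsion\<close> and the supercommutators by \<open>gam_inner\<close>.
\<close>

lemma gam_I2: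
  assumes u: "u \<in> quads" and a: "a \<in> I2_ideal A"
  shows "gam u a = \<zero>\<^bsub>M\<^esub>"
proof -
  let ?Z = "{x \<in> carrier A. \<forall>y\<in>carrier A. \<forall>z\<in>carrier A. gam u (y \<otimes> x \<otimes> z) = \<zero>\<^bsub>M\<^esub>}"
  have neg: "gam u (\<ominus> a) = gam u a" if "a \<in> carrier A" for a
    using gam_psign[OF u that, of 0] by simp
  have "ideal ?Z A"
  proof (rule idealI[OF ring_axioms])
    show "subgroup ?Z (add_monoid A)"
    proof (rule add.subgroupI)
      show "?Z \<noteq> {}" using gam_zero[OF u] by (auto intro!: exI[of _ \<zero>])
    qed (auto simp: l_distr r_distr gam_add[OF u] l_minus r_minus neg a_inv_def[symmetric])
  next
    fix x y assume x: "x \<in> ?Z" and y: "y \<in> carrier A"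
    have "gam u (v \<otimes> (y \<otimes> x) \<otimes> w) = \<zero>\<^bsub>M\<^esub> \<and> gam u (v \<otimes> (x \<otimes> y) \<otimes> w) = \<zero>\<^bsub>M\<^esub>" if vw: "v \<in> carrier A" "w \<in> carrier A" for v w
    proof -
      have "v \<otimes> (y \<otimes> x) \<otimes> w = (v \<otimes> y) \<otimes> x \<otimes> w" "v \<otimes> (x \<otimes> y) \<otimes> w = v \<otimes> x \<otimes> (y \<otimes> w)"
        using x y vw by (simp_all add: m_assoc)
      then show ?thesis using x y vw by simp
    qed
    then show "y \<otimes> x \<in> ?Z" "x \<otimes> y \<in> ?Z" using x y by auto
  qed
  moreover have "x \<oplus> x \<in> ?Z" if "x \<in> carrier A" for x
    using that gam_torsion[OF u] by (simp add: l_distr r_distr gam_add[OF u])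
  moreover have "a \<otimes> b \<ominus> psign A (p * r) (b \<otimes> a) \<in> ?Z" if h: "a \<in> gr A p" "b \<in> gr A r" for a b p r
  proof -
    note g = h[THEN gr_carrier]
    have "gam u (y \<otimes> (a \<otimes> b \<ominus> psign A (p * r) (b \<otimes> a)) \<otimes> z) = \<zero>\<^bsub>M\<^esub>" if yz: "y \<in> carrier A" "z \<in> carrier A" for y z
    proof -
      have "y \<otimes> (a \<otimes> b \<ominus> psign A (p * r) (b \<otimes> a)) \<otimes> z
          = y \<otimes> (a \<otimes> b) \<otimes> z \<oplus> \<ominus> psign A (p * r) (y \<otimes> (b \<otimes> a) \<otimes> z)"
        using g yz by (simp add: a_minus_def l_distr r_distr l_minus r_minus mult_psign_left mult_psign_right)
      then show ?thesis
        using g yz gam_torsion[OF u] gam_inner[OF u h yz] by (simp add: gam_add[OF u] gam_psign[OF u])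
    qed
    then show ?thesis using gr_carrier[OF commutator_gr[OF h]] by simp
  qed
  ultimately have "a \<in> ?Z" using I2_least[of ?Z] a by blast
  then have "gam u (\<one> \<otimes> a \<otimes> \<one>) = \<zero>\<^bsub>M\<^esub>" by blast
  then show ?thesis using I2_closed[OF a] by simp
qed

text \<open>
  A class is the orbit of a quadruple under the exchange of \<open>i\<close> with \<open>k\<close> and of \<open>j\<close> with \<open>l\<close>.
\<close>

lemma gam_class:
  assumes u: "u \<in> quads" and v: "v \<in> quad_class u" and a: "a \<in> carrier A"
  shows "gam v a = gam u a"
proof -
  have vq: "v \<in> quads" using u v quad_class_quads by blast
  from a show ?thesis
  proof (induction rule: gr_induct)
    case (hom p a)
    obtain i j k l where u': "u = (i, j, k, l)" by (cases u)
    have d: "distinct [i, j, k, l]" "distinct [k, l, i, j]" using u u' by (auto simp: quads_def)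
    have "gam (i, j, k, l) a = gam (k, j, i, l) a" "gam (i, j, k, l) a = gam (k, l, i, j) a"
      "gam (k, l, i, j) a = gam (i, l, k, j) a"
      using B_gam(2,3)[OF d(1) hom one_even] B_gam(2)[OF d(2) hom one_even] by auto
    then show ?case using v unfolding u' by (auto simp: quad_class_def)
  next
    case (add a b)
    then show ?case by (simp add: gam_add[OF u] gam_add[OF vq])
  qed
qed

text \<open>
  The map induced by \<open>gam\<close> on \<open>A\<^sub>2\<close>; the choice of a representative does not matter by \<open>gam_I2\<close>.
\<close>

definition gam2 :: "nat \<Rightarrow> 'a set \<Rightarrow> 'n"
  where "gam2 r x = gam (quad_rep P r) (SOME a. a \<in> carrier A \<and> A2_class A a = x)"

lemma gam2:
  assumes r: "r \<in> {1..6}" and a: "a \<in> carrier A"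
  shows "gam2 r (c2 a) = gam (quad_rep P r) a"
proof -
  let ?b = "SOME b. b \<in> carrier A \<and> c2 b = c2 a"
  note u = quad_rep(1)[OF P r]
  have "\<exists>b. b \<in> carrier A \<and> c2 b = c2 a" using a by blast
  from someI_ex[OF this] have b: "?b \<in> carrier A" "c2 ?b = c2 a" by auto
  then have "?b \<ominus> a \<in> I2_ideal A" using a c2_eq_iff by blast
  then have "gam (quad_rep P r) (?b \<ominus> a) = \<zero>\<^bsub>M\<^esub>" by (rule gam_I2[OF u])
  moreover have "gam (quad_rep P r) ((?b \<ominus> a) \<oplus> a) = gam (quad_rep P r) (?b \<ominus> a) \<oplus>\<^bsub>M\<^esub> gam (quad_rep P r) a"
    using a b(1) by (intro gam_add[OF u]) auto
  moreover have "(?b \<ominus> a) \<oplus> a = ?b" using a b(1) by (simp add: a_minus_def a_assoc l_neg)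
  ultimately show ?thesis using gam_closed[OF u a] by (simp add: gam2_def)
qed

text \<open>
  The total obstruction, a linear map from \<open>W\<close> to the kernel of \<open>\<tau>\<close>.
\<close>

definition ghat :: "(nat \<Rightarrow> 'a set) \<Rightarrow> 'n"
  where "ghat w = (\<Oplus>\<^bsub>M\<^esub>r\<in>{1..6}. gam2 r (w r))"

lemma gam2_props:
  assumes r: "r \<in> {1..6}"
  shows "x \<in> carrier (A2 A) \<Longrightarrow> gam2 r x \<in> carrier M"
    and "x \<in> carrier (A2 A) \<Longrightarrow> y \<in> carrier (A2 A) \<Longrightarrow> gam2 r (x \<oplus>\<^bsub>A2 A\<^esub> y) = gam2 r x \<oplus>\<^bsub>M\<^esub> gam2 r y"
    and "c \<in> carrier K \<Longrightarrow> x \<in> carrier (A2 A) \<Longrightarrow> gam2 r (c \<odot>\<^bsub>A2 A\<^esub> x) = c \<odot>\<^bsub>M\<^esub> gam2 r x"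
    and "x \<in> gr (A2 A) (p + 1) \<Longrightarrow> gam2 r x \<in> gr M p"
    and "x \<in> carrier (A2 A) \<Longrightarrow> \<tau> (gam2 r x) = \<zero>\<^bsub>L\<^esub>"
    and "gam2 r \<zero>\<^bsub>A2 A\<^esub> = \<zero>\<^bsub>M\<^esub>"
  using quad_rep(1)[OF P r]
  by (auto simp: A2_carrier A2_gr gam2[OF r] gam_closed gam_add gam_smult gam_tau gam_zero c2_zero
      A2_smult c2_add[symmetric] gr_carrier intro: gam_gr)

lemma ghat_closed: "w \<in> carrier W \<Longrightarrow> ghat w \<in> carrier M"
  unfolding ghat_def using W_mem gam2_props(1) by (intro M.M.finsum_closed) blast

lemma ghat_add:
  assumes "v \<in> carrier W" "w \<in> carrier W" shows "ghat (v \<oplus>\<^bsub>W\<^esub> w) = ghat v \<oplus>\<^bsub>M\<^esub> ghat w"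
proof -
  have "ghat (v \<oplus>\<^bsub>W\<^esub> w) = (\<Oplus>\<^bsub>M\<^esub>r\<in>{1..6}. gam2 r (v r) \<oplus>\<^bsub>M\<^esub> gam2 r (w r))"
    unfolding ghat_def
    using gam2_props(1,2) W_mem[OF assms(1)] W_mem[OF assms(2)]
    by (intro M.M.finsum_cong') (auto simp: W_simps(3) simp del: One_nat_def)
  also have "\<dots> = ghat v \<oplus>\<^bsub>M\<^esub> ghat w"
    unfolding ghat_def using W_mem assms gam2_props(1) by (intro M.M.finsum_addf) blast+
  finally show ?thesis .
qed

lemma ghat_smult:
  assumes "c \<in> carrier K" "w \<in> carrier W" shows "ghat (c \<odot>\<^bsub>W\<^esub> w) = c \<odot>\<^bsub>M\<^esub> ghat w"
proof -
  have "ghat (c \<odot>\<^bsub>W\<^esub> w) = (\<Oplus>\<^bsub>M\<^esub>r\<in>{1..6}. c \<odot>\<^bsub>M\<^esub> gam2 r (w r))"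
    unfolding ghat_def
    using gam2_props(1,3) W_mem[OF assms(2)] assms(1)
    by (intro M.M.finsum_cong') (auto simp: W_simps(4) simp del: One_nat_def)
  also have "\<dots> = c \<odot>\<^bsub>M\<^esub> ghat w"
    unfolding ghat_def using W_mem assms gam2_props(1)
    by (intro M.finsum_smult_ldistr[symmetric]) (auto simp del: One_nat_def)
  finally show ?thesis .
qed

lemma ghat_gr:
  assumes "w \<in> gr W p" shows "ghat w \<in> gr M p"
proof -
  have w: "gam2 r (w r) \<in> gr M p" if "r \<in> {1..6}" for r
    using assms that unfolding W_simps by (intro gam2_props(4)) (auto simp del: One_nat_def)
  have "(\<Oplus>\<^bsub>M\<^esub>r\<in>D. gam2 r (w r)) \<in> gr M p" if "finite D" "D \<subseteq> {1..6}" for D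
    using that
  proof (induction D)
    case (insert d D)
    have "(\<lambda>r. gam2 r (w r)) \<in> D \<rightarrow> carrier M" "gam2 d (w d) \<in> carrier M" "gam2 d (w d) \<in> gr M p"
      using insert.prems w M.gr_carrier[OF w] by (auto simp del: One_nat_def)
    then show ?case using insert by simp
  qed simp
  then show ?thesis unfolding ghat_def by simp
qed

lemma ghat_tau:
  assumes "w \<in> carrier W" shows "\<tau> (ghat w) = \<zero>\<^bsub>L\<^esub>"
proof -
  have "\<tau> (\<Oplus>\<^bsub>M\<^esub>r\<in>D. gam2 r (w r)) = \<zero>\<^bsub>L\<^esub>" if "finite D" "D \<subseteq> {1..6}" for D
    using that
  proof (induction D)
    case (insert d D)
    have "(\<lambda>r. gam2 r (w r)) \<in> D \<rightarrow> carrier M" "gam2 d (w d) \<in> carrier M" "\<tau> (gam2 d (w d)) = \<zero>\<^bsub>L\<^esub>"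
      using insert.prems gam2_props(1,5) W_mem[OF assms] by (auto simp del: One_nat_def)
    then show ?case using insert by (simp add: tau.add)
  qed simp
  then show ?thesis unfolding ghat_def by simp
qed

lemma ghat_incl:
  assumes "u \<in> quads" "a \<in> carrier A" shows "ghat (W_incl A (theta P u) (c2 a)) = gam u a"
proof -
  note th = theta(1)[OF P assms(1)]
  have rep: "quad_rep P (theta P u) \<in> quads" "P (theta P u) = quad_class (quad_rep P (theta P u))"
    using quad_rep[OF P th] .
  have "u \<in> P (theta P u)" using theta(2)[OF P assms(1) th] by simp
  then have gu: "gam u a = gam2 (theta P u) (c2 a)"
    using rep gam_class[OF rep(1) _ assms(2)] gam2[OF th assms(2)] by simp
  have "ghat (W_incl A (theta P u) (c2 a))
    = (\<Oplus>\<^bsub>M\<^esub>r\<in>{1..6}. if theta P u = r then gam2 r (c2 a) else \<zero>\<^bsub>M\<^esub>)"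
    unfolding ghat_def using gam2_props(1,6) assms(2)
    by (intro M.M.finsum_cong') (auto simp: W_incl_def simp del: One_nat_def)
  also have "\<dots> = gam2 (theta P u) (c2 a)"
    using th gam2_props(1) assms(2)
    by (intro M.M.add.finprod_singleton) (auto simp del: One_nat_def)
  finally show ?thesis using gu by simp
qed

lemma ghat_zero: "ghat \<zero>\<^bsub>W\<^esub> = \<zero>\<^bsub>M\<^esub>"
  using ghat_smult[of "\<zero>\<^bsub>K\<^esub>" "\<zero>\<^bsub>W\<^esub>"] ghat_closed by simp

lemma ghat_torsion: "w \<in> carrier W \<Longrightarrow> ghat w \<oplus>\<^bsub>M\<^esub> ghat w = \<zero>\<^bsub>M\<^esub>"
  using ghat_add[of w w] W.M.r_neg[of w] W_neg[of w] ghat_zero by simp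

lemma ghat_signs: "w \<in> carrier W \<Longrightarrow> \<ominus>\<^bsub>M\<^esub> ghat w = ghat w" "w \<in> carrier W \<Longrightarrow> psign M r (ghat w) = ghat w"
  using torsion_signs[OF ghat_closed ghat_torsion] by auto

section \<open>Existence and uniqueness of lifts\<close>

text \<open>
  With respect to the bracket of \<open>M\<close> changed by \<open>beta\<close>, the lifts \<open>f i j a\<close> satisfy all relations of the
  Steinberg Lie superalgebra: for four distinct indices the obstruction \<open>ghat\<close> occurs twice and is its
  own negative. Both brackets agree modulo the kernel of \<open>\<tau>\<close>.
\<close>

definition beta :: "'n \<Rightarrow> 'n \<Rightarrow> 'n"
  where "beta x y = ghat (Psi P (m (\<tau> x)) (m (\<tau> y)))"

definition twisted :: "('k, 'n) superalgebra"
  where "twisted = M\<lparr>mult := \<lambda>x y. x \<otimes>\<^bsub>M\<^esub> y \<oplus>\<^bsub>M\<^esub> beta x y\<rparr>"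

lemma mt_closed: "x \<in> carrier M \<Longrightarrow> m (\<tau> x) \<in> carrier G"
  by (intro m.closed tau.closed)

lemma mt_phi: assumes "x \<in> carrier M" shows "\<exists>x'\<in>carrier S. m (\<tau> x) = phi x'"
proof -
  have "\<tau> x \<in> q ` carrier S" using tau.closed[OF assms] q(2) by simp
  then show ?thesis using m(2) by auto
qed

lemma twisted_lie: "lie_superalgebra K twisted"
proof (rule M.twist_lie[of twisted beta])
  note c = Psi_closed[OF mt_closed mt_closed]
  show "x \<otimes>\<^bsub>twisted\<^esub> y = x \<otimes>\<^bsub>M\<^esub> y \<oplus>\<^bsub>M\<^esub> beta x y" for x y by (simp add: twisted_def)
  show "beta x y \<in> carrier M" if "x \<in> carrier M" "y \<in> carrier M" for x y
    unfolding beta_def using c that by (intro ghat_closed)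
  show "beta (x \<oplus>\<^bsub>M\<^esub> y) z = beta x z \<oplus>\<^bsub>M\<^esub> beta y z" "beta z (x \<oplus>\<^bsub>M\<^esub> y) = beta z x \<oplus>\<^bsub>M\<^esub> beta z y"
    if "x \<in> carrier M" "y \<in> carrier M" "z \<in> carrier M" for x y z
    using that c mt_closed by (simp_all add: beta_def tau.add m.add Psi_add ghat_add del: gl_simps)
  show "beta (k \<odot>\<^bsub>M\<^esub> x) y = k \<odot>\<^bsub>M\<^esub> beta x y" "beta x (k \<odot>\<^bsub>M\<^esub> y) = k \<odot>\<^bsub>M\<^esub> beta x y"
    if "k \<in> carrier K" "x \<in> carrier M" "y \<in> carrier M" for k x y
    using that c mt_closed by (simp_all add: beta_def tau.smult m.smult Psi_smult ghat_smult del: gl_simps)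
  show "beta x y \<in> gr M (p + r)" if "x \<in> gr M p" "y \<in> gr M r" for x y p r
    unfolding beta_def using that by (intro ghat_gr Psi_gr m.gr tau.gr)
  show "beta x y = \<ominus>\<^bsub>M\<^esub> psign M (p * r) (beta y x)" if "x \<in> gr M p" "y \<in> gr M r" for x y p r
    using that[THEN M.gr_carrier] c mt_closed Psi_sym[of "m (\<tau> x)" "m (\<tau> y)"]
    by (simp add: beta_def ghat_signs del: gl_simps)
  show "beta x x = \<zero>\<^bsub>M\<^esub>" if "x \<in> gr M 0" for x
    using M.gr_carrier[OF that] mt_closed by (simp add: beta_def Psi_alt ghat_zero del: gl_simps)
  show "beta x y \<otimes>\<^bsub>M\<^esub> z = \<zero>\<^bsub>M\<^esub>" if "x \<in> carrier M" "y \<in> carrier M" "z \<in> carrier M" for x y z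
    unfolding beta_def using that c by (intro kernel_left ghat_closed ghat_tau)
  show "beta (beta x y) z = \<zero>\<^bsub>M\<^esub>" if "x \<in> carrier M" "y \<in> carrier M" "z \<in> carrier M" for x y z
  proof -
    have "\<tau> (beta x y) = \<zero>\<^bsub>L\<^esub>" unfolding beta_def using that c by (intro ghat_tau)
    then have "m (\<tau> (beta x y)) = (\<lambda>i j. \<zero>)" by simp
    then show ?thesis using Psi_zero(2)[OF mt_closed[OF that(3)]] by (simp add: beta_def[of _ z] ghat_zero)
  qed
  show "psign M (p * s) (beta (x \<otimes>\<^bsub>M\<^esub> y) z) \<oplus>\<^bsub>M\<^esub> psign M (p * r) (beta (y \<otimes>\<^bsub>M\<^esub> z) x)
    \<oplus>\<^bsub>M\<^esub> psign M (r * s) (beta (z \<otimes>\<^bsub>M\<^esub> x) y) = \<zero>\<^bsub>M\<^esub>"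
    if "x \<in> gr M p" "y \<in> gr M r" "z \<in> gr M s" for x y z p r s
  proof -
    note xyz = that[THEN M.gr_carrier]
    obtain x' y' z' where x': "x' \<in> carrier S" "y' \<in> carrier S" "z' \<in> carrier S"
      and eq: "m (\<tau> x) = phi x'" "m (\<tau> y) = phi y'" "m (\<tau> z) = phi z'"
      using mt_phi xyz by meson
    have br: "m (\<tau> (u \<otimes>\<^bsub>M\<^esub> v)) = m (\<tau> u) \<otimes>\<^bsub>G\<^esub> m (\<tau> v)" if "u \<in> carrier M" "v \<in> carrier M" for u v
      using that by (simp add: tau_mult m_mult)
    have cl: "Psi P (phi u \<otimes>\<^bsub>G\<^esub> phi v) (phi w) \<in> carrier W" if "u \<in> carrier S" "v \<in> carrier S" "w \<in> carrier S" for u v w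
      using that by (intro Psi_closed phi_closed G.mult_closed)
    have "beta (x \<otimes>\<^bsub>M\<^esub> y) z \<oplus>\<^bsub>M\<^esub> beta (y \<otimes>\<^bsub>M\<^esub> z) x \<oplus>\<^bsub>M\<^esub> beta (z \<otimes>\<^bsub>M\<^esub> x) y = ghat \<zero>\<^bsub>W\<^esub>"
      unfolding beta_def br[OF xyz(1,2)] br[OF xyz(2,3)] br[OF xyz(3,1)] eq Psi_jacobi[OF x', symmetric]
      using cl x' by (simp add: ghat_add W.M.a_closed)
    then show ?thesis
      unfolding beta_def br[OF xyz(1,2)] br[OF xyz(2,3)] br[OF xyz(3,1)] eq
      using cl x' by (simp add: ghat_signs ghat_zero)
  qed
qed (simp_all add: twisted_def)

lemma twisted_simps:
  "carrier twisted = carrier M" "add twisted = add M" "zero twisted = zero M" "smult twisted = smult M"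
  "gr twisted = gr M" "x \<otimes>\<^bsub>twisted\<^esub> y = x \<otimes>\<^bsub>M\<^esub> y \<oplus>\<^bsub>M\<^esub> beta x y"
  by (simp_all add: twisted_def)

lemma beta_f:
  assumes "i \<noteq> j" "k \<noteq> l" "a \<in> carrier A" "b \<in> carrier A"
  shows "beta (f i j a) (f k l b) = (if distinct [i, j, k, l] then gam (i, j, k, l) (a \<otimes> b) else \<zero>\<^bsub>M\<^esub>)"
  using assms ghat_incl[of "(i, j, k, l)" "a \<otimes> b"]
  by (simp add: beta_def tau_f m(2) F_closed phi_F Psi_E ghat_zero quads_def)

lemma sigma_exists:
  obtains \<sigma> where "\<sigma> \<in> lie_hom K S twisted" "\<And>i j a. i \<noteq> j \<Longrightarrow> a \<in> carrier A \<Longrightarrow> \<sigma> (F i j a) = f i j a"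
proof -
  obtain h where h: "h \<in> lie_hom K S twisted" "\<And>i j a. i \<noteq> j \<Longrightarrow> a \<in> carrier A \<Longrightarrow>
      h (F i j a) = f i j (hcomp A 0 a) \<oplus>\<^bsub>twisted\<^esub> f i j (hcomp A 1 a)"
  proof (rule st_hom[OF twisted_lie, of f])
    show "f i j a \<in> gr twisted (par i + par j + p)" if "i \<noteq> j" "a \<in> gr A p" for i j a p
      using that by (simp add: twisted_simps f_gr)
    show "f i j (a \<oplus> b) = f i j a \<oplus>\<^bsub>twisted\<^esub> f i j b" if "i \<noteq> j" "a \<in> gr A p" "b \<in> gr A p" for i j a b p
      using that gr_carrier[OF that(2)] gr_carrier[OF that(3)] by (simp add: twisted_simps f_add)
    show "f i j (c \<odot> a) = c \<odot>\<^bsub>twisted\<^esub> f i j a" if "i \<noteq> j" "c \<in> carrier K" "a \<in> gr A p" for i j c a p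
      using that gr_carrier[OF that(3)] by (simp add: twisted_simps f_smult)
    show "f i j a \<otimes>\<^bsub>twisted\<^esub> f j k b = f i k (a \<otimes> b)" if d: "distinct [i, j, k]" and h: "a \<in> gr A p" "b \<in> gr A r" for i j k a b p r
      using B_chain[OF d h] d h[THEN gr_carrier] beta_f[of i j j k a b] f_mult[of i j j k a b] f_closed[of i k "a \<otimes> b"]
      by (simp add: twisted_simps)
    show "f i j a \<otimes>\<^bsub>twisted\<^esub> f k l b = \<zero>\<^bsub>twisted\<^esub>"
      if ne: "i \<noteq> j" "k \<noteq> l" "j \<noteq> k" "i \<noteq> l" and h: "a \<in> gr A p" "b \<in> gr A r" for i j k l a b p r
    proof (cases "distinct [i, j, k, l]")
      case True
      then have q: "(i, j, k, l) \<in> quads" by (simp add: quads_def)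
      have "B (F i j a) (F k l b) = gam (i, j, k, l) (a \<otimes> b)"
        using B_gam(1,4)[OF True h] by simp
      then show ?thesis
        using True ne h[THEN gr_carrier] beta_f[of i j k l a b] f_mult[of i j k l a b] gam_torsion[OF q, of "a \<otimes> b"]
        by (simp add: twisted_simps)
    next
      case False
      then show ?thesis
        using ne h[THEN gr_carrier] beta_f[of i j k l a b] f_mult[of i j k l a b] B_vanish[OF ne False h]
        by (auto simp: twisted_simps)
    qed
  qed (rule that)
  show thesis
  proof (rule that[OF h(1)])
    fix i j :: index and a assume ij: "i \<noteq> j" and a: "a \<in> carrier A"
    then show "h (F i j a) = f i j a"
      using h(2)[OF ij a] f_add[OF ij, of "hcomp A 0 a" "hcomp A 1 a"] hcomp_sum[OF a] by (simp add: twisted_simps)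
  qed
qed

text \<open>
  A homomorphism \<open>\<sigma>\<close> to the changed Lie superalgebra fails to preserve the original bracket by the
  obstruction applied to the cocycle. The second component of \<open>st(3,1,A)\<^sup>\<sharp>\<close> compensates this.
\<close>

lemma lift_exists: "\<exists>\<rho>\<in>lie_hom K SH M. \<forall>u\<in>carrier SH. \<tau> (\<rho> u) = q (fst u)"
proof -
  obtain \<sigma> where s: "\<sigma> \<in> lie_hom K S twisted" and sF: "\<And>i j a. i \<noteq> j \<Longrightarrow> a \<in> carrier A \<Longrightarrow> \<sigma> (F i j a) = f i j a"
    by (rule sigma_exists) blast
  interpret T: lie_superalgebra K twisted by (rule twisted_lie)
  interpret s: graded_map K S twisted \<sigma> using lie_homD(1)[OF s] by unfold_locales
  have tT: "\<tau> \<in> lie_hom K twisted L"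
  proof (intro lie_homI graded_homI)
    fix x y assume xy: "x \<in> carrier twisted" "y \<in> carrier twisted"
    then have "Psi P (m (\<tau> x)) (m (\<tau> y)) \<in> carrier W" by (intro Psi_closed mt_closed) (simp_all add: twisted_simps)
    then show "\<tau> (x \<otimes>\<^bsub>twisted\<^esub> y) = \<tau> x \<otimes>\<^bsub>L\<^esub> \<tau> y"
      using xy L.mult_closed by (simp add: twisted_simps tau.add beta_def ghat_tau ghat_closed M.mult_closed tau_mult)
  qed (auto simp: twisted_simps tau.add tau.smult tau.gr)
  have ts: "\<tau> (\<sigma> x) = q x" if "x \<in> carrier S" for x
  proof -
    have "(\<tau> \<circ> \<sigma>) x = q x"
    proof (rule st_hom_unique[OF L.lie_superalgebra_axioms lie_hom_comp[OF s tT] q(1) _ that])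
      fix i j :: index and a p assume *: "i \<noteq> j" "a \<in> gr A p"
      show "(\<tau> \<circ> \<sigma>) (F i j a) = q (F i j a)" using sF[OF *(1) gr_carrier[OF *(2)]] tau_f[OF *(1) gr_carrier[OF *(2)]] by simp
    qed
    then show ?thesis by simp
  qed
  have sc: "\<sigma> x \<in> carrier M" if "x \<in> carrier S" for x using s.closed[OF that] by (simp add: twisted_simps)
  define \<rho> where "\<rho> = (\<lambda>(x, w). \<sigma> x \<oplus>\<^bsub>M\<^esub> ghat w)"
  have "\<rho> \<in> lie_hom K SH M"
  proof (intro lie_homI graded_homI)
    fix u v assume "u \<in> carrier SH" "v \<in> carrier SH"
    then obtain x w y w' where u: "u = (x, w)" "x \<in> carrier S" "w \<in> carrier W"
      and v: "v = (y, w')" "y \<in> carrier S" "w' \<in> carrier W" by (auto simp: SH_simps(1))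
    note c = sc[OF u(2)] sc[OF v(2)] ghat_closed[OF u(3)] ghat_closed[OF v(3)]
    have "\<sigma> (x \<oplus>\<^bsub>S\<^esub> y) = \<sigma> x \<oplus>\<^bsub>M\<^esub> \<sigma> y" using s.add[OF u(2) v(2)] by (simp add: twisted_simps)
    then show "\<rho> (u \<oplus>\<^bsub>SH\<^esub> v) = \<rho> u \<oplus>\<^bsub>M\<^esub> \<rho> v"
      using c u(3) v(3) by (simp add: u(1) v(1) \<rho>_def SH_simps(3) ghat_add M.M.a_ac)
    have Pc: "Psi P (phi x) (phi y) \<in> carrier W" using u v by (intro Psi_closed phi_closed)
    have "\<sigma> (x \<otimes>\<^bsub>S\<^esub> y) = \<sigma> x \<otimes>\<^bsub>M\<^esub> \<sigma> y \<oplus>\<^bsub>M\<^esub> ghat (Psi P (phi x) (phi y))"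
      using lie_homD(2)[OF s u(2) v(2)] u(2) v(2) by (simp add: twisted_simps beta_def ts m(2))
    then have "\<rho> (u \<otimes>\<^bsub>SH\<^esub> v) = \<sigma> x \<otimes>\<^bsub>M\<^esub> \<sigma> y"
      using u v c ghat_torsion[OF Pc] ghat_closed[OF Pc] by (simp add: \<rho>_def SH_mult M.M.a_assoc M.mult_closed)
    also have "\<dots> = \<rho> u \<otimes>\<^bsub>M\<^esub> \<rho> v"
      using c u(3) v(3) by (simp add: u(1) v(1) \<rho>_def M.mult_add_left M.mult_add_right kernel_left kernel_right ghat_tau M.mult_closed)
    finally show "\<rho> (u \<otimes>\<^bsub>SH\<^esub> v) = \<rho> u \<otimes>\<^bsub>M\<^esub> \<rho> v" .
  next
    fix u assume "u \<in> carrier SH" then show "\<rho> u \<in> carrier M"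
      by (auto simp: SH_simps(1) \<rho>_def sc ghat_closed)
  next
    fix c u assume cu: "c \<in> carrier K" "u \<in> carrier SH"
    then obtain x w where u: "u = (x, w)" "x \<in> carrier S" "w \<in> carrier W" by (auto simp: SH_simps(1))
    have "\<sigma> (c \<odot>\<^bsub>S\<^esub> x) = c \<odot>\<^bsub>M\<^esub> \<sigma> x" using s.smult[OF cu(1) u(2)] by (simp add: twisted_simps)
    then show "\<rho> (c \<odot>\<^bsub>SH\<^esub> u) = c \<odot>\<^bsub>M\<^esub> \<rho> u"
      using cu(1) u sc[OF u(2)] ghat_closed[OF u(3)] by (simp add: \<rho>_def SH_simps(4) ghat_smult M.smult_r_distr)
  next
    fix u p assume "u \<in> gr SH p"
    then obtain x w where u: "u = (x, w)" "x \<in> gr S p" "w \<in> gr W p" by (auto simp: SH_simps(5))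
    show "\<rho> u \<in> gr M p" using s.gr[OF u(2)] ghat_gr[OF u(3)] by (simp add: u(1) \<rho>_def twisted_simps)
  qed
  moreover have "\<tau> (\<rho> u) = q (fst u)" if "u \<in> carrier SH" for u
    using that by (auto simp: SH_simps(1) \<rho>_def tau.add sc ghat_closed ts ghat_tau)
  ultimately show ?thesis by blast
qed

text \<open>
  Two lifts differ by central elements, so they agree on brackets, and these generate by \<open>SH_perfect\<close>.
\<close>

lemma lift_unique:
  assumes r: "\<rho> \<in> lie_hom K SH M" "\<rho>' \<in> lie_hom K SH M"
    and eq: "\<And>u. u \<in> carrier SH \<Longrightarrow> \<tau> (\<rho> u) = \<tau> (\<rho>' u)" and u: "u \<in> carrier SH"
  shows "\<rho> u = \<rho>' u"
proof -
  interpret SH: lie_superalgebra K SH by (rule SH_lie)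
  interpret r: graded_map K SH M \<rho> using lie_homD(1)[OF r(1)] by unfold_locales
  interpret r': graded_map K SH M \<rho>' using lie_homD(1)[OF r(2)] by unfold_locales
  let ?N = "{u \<in> carrier SH. \<rho> u = \<rho>' u}"
  have "submodule ?N K SH"
    by (rule SH.submoduleI) (auto simp: r.add r'.add r.smult r'.smult r.neg r'.neg)
  moreover have "u \<otimes>\<^bsub>SH\<^esub> v \<in> ?N" if "u \<in> carrier SH" "v \<in> carrier SH" for u v
    using that eq mult_depends[of "\<rho> u" "\<rho>' u" "\<rho> v" "\<rho>' v"]
    by (simp add: SH.mult_closed lie_homD(2)[OF r(1)] lie_homD(2)[OF r(2)])
  ultimately have "carrier SH \<subseteq> ?N" by (rule SH_perfect)
  with u show ?thesis by blast
qed

end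

section \<open>The universal central extension\<close>

context labelled_superalgebra
begin

text \<open>
  The kernel of \<open>\<pi>\<close> is central, since its elements have image zero in \<open>gl(3,1,A)\<close>, on which both the
  cocycle and, by \<open>kernel_central\<close>, the bracket depend.
\<close>

lemma universal:
  fixes L :: "('k, 'l) superalgebra"
  assumes L: "lie_superalgebra K L" and q: "q \<in> lie_hom K S L" "q ` carrier S = carrier L"
    and m: "m \<in> lie_hom K L G" "\<And>x. x \<in> carrier S \<Longrightarrow> m (q x) = phi x"
    and p: "\<pi> \<in> lie_hom K SH L" "\<And>u. u \<in> carrier SH \<Longrightarrow> \<pi> u = q (fst u)"
  shows "universal_central_extension TYPE('n) K SH L \<pi>"
proof -
  interpret L: lie_superalgebra K L by (rule L)
  interpret m: graded_map K L G m using lie_homD(1)[OF m(1)] by unfold_locales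
  have surj: "\<pi> ` carrier SH = carrier L"
  proof -
    have "\<pi> ` carrier SH = (\<lambda>u. q (fst u)) ` carrier SH" using p(2) by (rule image_cong[OF HOL.refl])
    also have "\<dots> = q ` fst ` (carrier S \<times> carrier W)" by (simp only: SH_simps(1) image_image)
    also have "fst ` (carrier S \<times> carrier W) = carrier S"
      using W.M.zero_closed by (metis empty_iff fst_image_times)
    finally show ?thesis using q(2) by simp
  qed
  have ker: "a_kernel SH L \<pi> \<subseteq> centre SH"
  proof
    fix u assume u: "u \<in> a_kernel SH L \<pi>"
    then have c: "u \<in> carrier SH" "q (fst u) = \<zero>\<^bsub>L\<^esub>" using p(2)[of u] by (simp_all add: a_kernel_def')
    then have "phi (fst u) = (\<lambda>i j. \<zero>)" using m(2)[of "fst u"] by (auto simp: SH_simps(1))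
    then show "u \<in> centre SH" by (rule SH_central[OF c(1)])
  qed
  have ce: "central_extension K SH L \<pi>"
    unfolding central_extension_def using SH_lie L p(1) surj ker by blast
  have "(\<exists>\<rho> \<in> lie_hom K SH M'. \<forall>x\<in>carrier SH. \<tau> (\<rho> x) = \<pi> x) \<and>
      (\<forall>\<rho> \<in> lie_hom K SH M'. \<forall>\<rho>' \<in> lie_hom K SH M'.
         (\<forall>x\<in>carrier SH. \<tau> (\<rho> x) = \<pi> x) \<and> (\<forall>x\<in>carrier SH. \<tau> (\<rho>' x) = \<pi> x) \<longrightarrow>
         (\<forall>x\<in>carrier SH. \<rho> x = \<rho>' x))"
    if t: "central_extension K M' L \<tau>" for M' :: "('k, 'n) superalgebra" and \<tau>
  proof -
    interpret M': lie_superalgebra K M' using t by (simp add: central_extension_def)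
    interpret central_lift K A P M' L \<tau> q m
      using t q m by unfold_locales (auto simp: central_extension_def)
    show ?thesis using lift_exists lift_unique p(2) by auto
  qed
  with ce show ?thesis unfolding universal_central_extension_def by blast
qed

lemma universal_sl:
  "universal_central_extension TYPE('n) K SH (sl31 K A) (st31_to_sl31 K A \<circ> fst)"
proof (rule universal[OF sl_lie phi_sl_hom sl_carrier[symmetric] sl_incl_hom])
  have "restrict phi (carrier S) \<in> lie_hom K S (sl31 K A)"
    using phi_sl_hom unfolding lie_hom_def graded_hom_def
    by (auto simp: S.gr_carrier S.mult_closed image_subset_iff)
  then show "st31_to_sl31 K A \<circ> fst \<in> lie_hom K SH (sl31 K A)"
    unfolding st31_to_sl31_eq by (rule lie_hom_comp[OF fst_hom])
qed (auto simp: st31_to_sl31_eq SH_simps(1))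

lemma universal_st: "universal_central_extension TYPE('n) K SH S fst"
proof (rule universal[OF S.lie_superalgebra_axioms _ _ phi_hom _ fst_hom, where q = "\<lambda>x. x"])
  show "(\<lambda>x. x) \<in> lie_hom K S S" by (intro lie_homI graded_homI) simp_all
qed simp_all

lemma kernel_fst: "a_kernel SH S fst = {\<zero>\<^bsub>S\<^esub>} \<times> carrier W"
proof (rule Set.set_eqI)
  fix u show "u \<in> a_kernel SH S fst \<longleftrightarrow> u \<in> {\<zero>\<^bsub>S\<^esub>} \<times> carrier W"
    using S.M.zero_closed
    by (cases u) (simp only: a_kernel_def' SH_simps(1) mem_Collect_eq mem_Sigma_iff fst_conv singleton_iff, blast)
qed

lemma second_homology: "is_second_homology TYPE('n) K S SH fst W"
proof -
  let ?V = "restrict_to SH (a_kernel SH S fst)"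
  have V: "carrier ?V = {\<zero>\<^bsub>S\<^esub>} \<times> carrier W" "add ?V = add SH" "smult ?V = smult SH"
    "gr ?V p = {\<zero>\<^bsub>S\<^esub>} \<times> gr W p" for p
  proof -
    have "gr SH p \<inter> {\<zero>\<^bsub>S\<^esub>} \<times> carrier W = {\<zero>\<^bsub>S\<^esub>} \<times> gr W p"
      unfolding SH_simps(5) using S.gr_zero W.gr_carrier by blast
    then show "gr ?V p = {\<zero>\<^bsub>S\<^esub>} \<times> gr W p" by (simp add: restrict_to_def kernel_fst)
  qed (simp_all add: restrict_to_def kernel_fst)
  have "graded_iso K ?V W"
    unfolding graded_iso_def
  proof (intro bexI[of _ snd] conjI allI)
    show "snd \<in> graded_hom K ?V W"
      by (rule graded_homI) (auto simp: V SH_simps(3,4))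
    show "bij_betw snd (carrier ?V) (carrier W)" by (auto simp: V bij_betw_def inj_on_def)
    show "snd ` gr ?V p = gr W p" for p by (auto simp: V)
  qed
  then show ?thesis unfolding is_second_homology_def using st_perfect universal_st by blast
qed

end

theorem corollary5p3:
  fixes K :: "'k ring" and A :: "('k, 'a) superalgebra" and P :: "nat \<Rightarrow> quad set"
  assumes "cring K"
    and "assoc_superalgebra K A"
    and "\<exists>B. is_basis K A B \<and> \<one>\<^bsub>A\<^esub> \<in> B"
    and "quad_labelling P"
  shows "universal_central_extension TYPE('n) K (st31_sharp K A P) (sl31 K A)
           (st31_to_sl31 K A \<circ> fst)
         \<and> is_second_homology TYPE('n) K (st31 K A) (st31_sharp K A P) fst (W_mod A)"
proof -
  interpret labelled_superalgebra K A P
    using assms(2,4) by (intro labelled_superalgebra.intro coefficient_superalgebra.intro labelled_superalgebra_axioms.intro)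
  show ?thesis using universal_sl second_homology by blast
qed

end
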